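(* Let $n\ge2$, $1\le k \le n-1$, and let $a$ be a function on $[0,1]$ with $$\int^1_0 |a(\tau)|\, (1-\tau^2)^{(k-1)/2} \tau^{n-k-1}\, d\tau <\infty .$$ Let $Y_j$ be a spherical harmonic of even degree $j$ on $S^n$ and let $\hat Y_j$ be the Stiefel harmonic induced by $Y_j$, $$\hat Y_j (v)= \varkappa_j \sqrt {d_n(j)}\int_{S^n} Y_j (x)\, R^{(\rho, \sigma)}_{j/2} (2|x^T v|^2-1)\, d_*x,\qquad v\in V_{n+1,n-k},$$ where $\rho=(k-1)/2$, $\sigma=(n-k)/2-1$. Then, for $x\in S^n$, $$\int_{V_{n+1, n-k}} a(|x^T v|)\, \hat Y_{j} (v)\, d_*v = \hat a(j)\,Y_{j} (x),$$ where $$\hat a(j) = \frac{\varkappa_j\, \sigma_{n-k-1} \sigma_k}{\sigma_n\sqrt {d_n(j)}}\int^1_0 R^{(\rho,\sigma)}_{j/2} (2\tau^2-1)\, a(\tau)\, (1-\tau^2)^{(k-1)/2} \tau^{n-k-1}\, d\tau .$$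
   Context: $S^n\subset\mathbb{R}^{n+1}$ is the unit sphere, $d_*x$ its normalized (probability) surface measure, $\sigma_m=2\pi^{(m+1)/2}/\Gamma((m+1)/2)$ the area of $S^m$ (so $\sigma_0=2$; note $\sigma$ without index is a real parameter). $V_{n+1,n-k}$ is the Stiefel manifold of real $(n+1)\times(n-k)$ matrices $v$ with $v^Tv=I_{n-k}$, and $d_*v$ is its left $O(n+1)$- and right $O(n-k)$-invariant probability measure. For $x\in S^n$ (a column vector), $|x^Tv|$ is the Euclidean norm of the row vector $x^Tv$. Constants and polynomials: $d_n(j)=(n+2j-1)\dfrac{\Gamma(n+j-1)}{\Gamma(j+1)\Gamma(n)}$ is the dimension of the space of spherical harmonics of degree $j$ on $S^n$; $R^{(\rho,\sigma)}_m(t)=P^{(\rho,\sigma)}_m(t)/P^{(\rho,\sigma)}_m(1)$ is the normalized Jacobi polynomial; for $j$ even, $$\varkappa_j=\left[\frac{\sigma_n\,(2j+n-1)\,\Gamma\left(\frac{j+k+1}{2}\right)\Gamma\left(\frac{j+n-1}{2}\right)}{\sigma_{n-k-1}\sigma_k\,\Gamma^2\left(\frac{k+1}{2}\right)\Gamma\left(\frac j2+1\right)\Gamma\left(\frac{j+n-k}{2}\right)}\right]^{1/2}.$$ *)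

theory Defs
  imports "HOL-Analysis.Analysis" "HOL-Probability.Probability"
begin

definition partial_deriv :: "'a::euclidean_space \<Rightarrow> ('a \<Rightarrow> complex) \<Rightarrow> 'a \<Rightarrow> complex" where
  "partial_deriv b f x = vector_derivative (\<lambda>t. f (x + t *\<^sub>R b)) (at 0)"

definition laplacian :: "('a::euclidean_space \<Rightarrow> complex) \<Rightarrow> 'a \<Rightarrow> complex" where
  "laplacian f x = (\<Sum>b\<in>Basis. partial_deriv b (partial_deriv b f) x)"

text \<open>A spherical harmonic is the restriction to the unit sphere of a homogeneous harmonic
  polynomial. Complex values are allowed; real spherical harmonics are the special case of values
  in \<^term>\<open>\<real> :: complex set\<close>. The values of \<open>Y\<close> off the sphere are arbitrary.\<close>

definition spherical_harmonic :: "nat \<Rightarrow> ('a::euclidean_space \<Rightarrow> complex) \<Rightarrow> bool" where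
  "spherical_harmonic j Y \<longleftrightarrow>
     (\<exists>p. polynomial_function p
        \<and> (\<forall>t x. p (t *\<^sub>R x) = t ^ j *\<^sub>R p x)
        \<and> (\<forall>x. laplacian p x = 0)
        \<and> (\<forall>x\<in>sphere 0 1. Y x = p x))"

text \<open>Normalized surface measure: the measure of a Borel subset of the sphere is the normalized
  volume of the cone over it in the unit ball. The push-forward is first taken on the whole space
  because the null point \<open>0\<close> has no radial projection to the sphere.\<close>

definition sphere_measure :: "'a::euclidean_space measure" where
  "sphere_measure =
     restrict_space (distr (uniform_measure lborel (ball 0 1)) borel (\<lambda>x. x /\<^sub>R norm x)) (sphere 0 1)"

definition sphere_area :: "nat \<Rightarrow> real" where
  "sphere_area m = 2 * pi powr ((real m + 1) / 2) / Gamma ((real m + 1) / 2)"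

definition stiefel :: "(real ^ 'm ^ 'd) set" where
  "stiefel = {v. transpose v ** v = mat 1}"

text \<open>The left and right invariant Borel probability measure on the Stiefel manifold exists and is unique;
  the predicate describes it.\<close>

definition stiefel_measure :: "(real ^ 'm ^ 'd) measure \<Rightarrow> bool" where
  "stiefel_measure \<mu> \<longleftrightarrow>
     prob_space \<mu> \<and> sets \<mu> = sets (restrict_space borel stiefel)
     \<and> (\<forall>U :: real ^ 'd ^ 'd. orthogonal_matrix U \<longrightarrow> distr \<mu> \<mu> (\<lambda>v. U ** v) = \<mu>)
     \<and> (\<forall>W :: real ^ 'm ^ 'm. orthogonal_matrix W \<longrightarrow> distr \<mu> \<mu> (\<lambda>v. v ** W) = \<mu>)"

text \<open>The two-binomial form of the Jacobi polynomial, valid for real parameters \<open>\<alpha>, \<beta> > -1\<close>.\<close>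

definition jacobi :: "real \<Rightarrow> real \<Rightarrow> nat \<Rightarrow> real \<Rightarrow> real" where
  "jacobi \<alpha> \<beta> m t =
     (\<Sum>s\<le>m. ((real m + \<alpha>) gchoose (m - s)) * ((real m + \<beta>) gchoose s)
              * ((t - 1) / 2) ^ s * ((t + 1) / 2) ^ (m - s))"

definition jacobi_R :: "real \<Rightarrow> real \<Rightarrow> nat \<Rightarrow> real \<Rightarrow> real" where
  "jacobi_R \<alpha> \<beta> m t = jacobi \<alpha> \<beta> m t / jacobi \<alpha> \<beta> m 1"

definition harmonic_dim :: "nat \<Rightarrow> nat \<Rightarrow> real" where
  "harmonic_dim n j =
     (real n + 2 * real j - 1) * Gamma (real n + real j - 1) / (Gamma (real j + 1) * Gamma (real n))"

definition varkappa :: "nat \<Rightarrow> nat \<Rightarrow> nat \<Rightarrow> real" where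
  "varkappa n k j =
     sqrt ((sphere_area n * (2 * real j + real n - 1)
              * Gamma ((real j + real k + 1) / 2) * Gamma ((real j + real n - 1) / 2))
           / (sphere_area (n - k - 1) * sphere_area k * (Gamma ((real k + 1) / 2))\<^sup>2
              * Gamma (real j / 2 + 1) * Gamma ((real j + real n - real k) / 2)))"

text \<open>The radial factor as a function of \<open>\<tau> = |x\<^sup>T v|\<close>, where the row vector \<open>x\<^sup>T v\<close> is
  \<^term>\<open>x v* v\<close>; only even \<open>j\<close> are meaningful.\<close>

definition stiefel_R :: "nat \<Rightarrow> nat \<Rightarrow> nat \<Rightarrow> real \<Rightarrow> real" where
  "stiefel_R n k j \<tau> =
     jacobi_R ((real k - 1) / 2) ((real n - real k) / 2 - 1) (j div 2) (2 * \<tau>\<^sup>2 - 1)"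

definition stiefel_harmonic ::
    "nat \<Rightarrow> nat \<Rightarrow> nat \<Rightarrow> (real ^ 'd \<Rightarrow> complex) \<Rightarrow> real ^ 'm ^ 'd \<Rightarrow> complex" where
  "stiefel_harmonic n k j Y v =
     of_real (varkappa n k j * sqrt (harmonic_dim n j))
     * (LINT x|sphere_measure. Y x * of_real (stiefel_R n k j (norm (x v* v))))"

text \<open>Since \<open>0 powr 0 = 0\<close>, the weight for \<open>k = 1\<close> vanishes at \<open>\<tau> = 1\<close>, which is
  immaterial under the integral.\<close>

definition stiefel_weight :: "nat \<Rightarrow> nat \<Rightarrow> real \<Rightarrow> real" where
  "stiefel_weight n k \<tau> = (1 - \<tau>\<^sup>2) powr ((real k - 1) / 2) * \<tau> ^ (n - k - 1)"

definition multiplier :: "nat \<Rightarrow> nat \<Rightarrow> (real \<Rightarrow> complex) \<Rightarrow> nat \<Rightarrow> complex" where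
  "multiplier n k a j =
     of_real (varkappa n k j * sphere_area (n - k - 1) * sphere_area k
              / (sphere_area n * sqrt (harmonic_dim n j)))
     * (LINT \<tau>:{0..1}|lebesgue. of_real (stiefel_R n k j \<tau>) * a \<tau> * of_real (stiefel_weight n k \<tau>))"

end

theory Submission
  imports Defs
begin

text \<open>Write \<open>\<sigma>\<close> for the normalized surface measure, \<open>R\<close> for the radial Jacobi factor, \<open>R\<^sub>v(y) = R(|y\<^sup>T v|)\<close>,
  \<open>\<langle>\<cdot>,\<cdot>\<rangle>\<close> for the bilinear pairing \<open>\<integral> f g d\<sigma>\<close> and \<open>D = d\<^sub>n(j)\<close>. The Stiefel harmonic is
  \<open>\<kappa>\<^sub>j \<surd>D \<langle>Y,R\<^sub>v\<rangle>\<close>, so \<open>\<kappa>\<^sub>j\<close> cancels and the theorem says that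

  \<open>\<integral> a(|x\<^sup>T v|) \<langle>Y,R\<^sub>v\<rangle> d\<mu>(v) = (\<alpha> / D) Y(x)\<close>, where \<open>\<alpha> = \<integral> a(|x\<^sup>T v|) R(|x\<^sup>T v|) d\<mu>(v)\<close>.

  By Fubini the left-hand side is \<open>\<langle>Y,K\<rangle>\<close> for the kernel \<open>K(y) = \<integral> a(|x\<^sup>T v|) R\<^sub>v(y) d\<mu>(v)\<close>. The left
  invariance of \<open>\<mu>\<close> makes \<open>K\<close> invariant under the orthogonal maps that fix \<open>x\<close>, so \<open>K(y)\<close> is a continuous
  function of \<open>x \<bullet> y\<close>. Pairing a spherical harmonic \<open>P\<close> of degree \<open>j\<close> with such a function only sees
  the value \<open>P(x)\<close>: if \<open>Z\<close> is the zonal harmonic of degree \<open>j\<close> with pole \<open>x\<close>, then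
  \<open>\<langle>P,K\<rangle> Z(x) = P(x) \<langle>Z,K\<rangle>\<close>. Moreover \<open>R\<^sub>v\<close> is itself a spherical harmonic of degree \<open>j\<close>, and
  \<open>\<langle>P,Z\<rangle> = P(x) Z(x) / D\<close> for all such \<open>P\<close>; hence \<open>\<langle>Z,K\<rangle> = \<integral> a(|x\<^sup>T v|) \<langle>Z,R\<^sub>v\<rangle> d\<mu>(v) = (\<alpha> / D) Z(x)\<close>.\<close>

text \<open>That \<open>R\<^sub>v\<close> is harmonic is the two-term recurrence of the Jacobi coefficients
  (\<open>solid_harmonic_jacobi_form\<close>). The pairings come from one identity, \<open>integral_inner_power_solid_harmonic\<close>:
  \<open>\<integral> (x \<bullet> y)\<^sup>l P(y) d\<sigma>(y) = A(l,j) P(x)\<close> with a constant \<open>A(l,j)\<close> that vanishes for \<open>l < j\<close>. Weierstrass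
  approximation extends it from powers to continuous functions of \<open>x \<bullet> y\<close>, and applied to \<open>Z\<close> it leaves only
  the leading coefficient of \<open>Z\<close>, a Vandermonde sum, which gives \<open>Z(x) / D\<close> (\<open>zonal_normalization\<close>).
  The identity is proved by induction with an integration by parts on the sphere,
  \<open>integral_sphere_by_parts\<close>, and that formula follows from rotation invariance alone: the derivative at
  \<open>\<theta> = 0\<close> of \<open>\<integral> f(rotated by \<theta>) d\<sigma>\<close> is zero.\<close>

text \<open>It remains to express \<open>\<alpha>\<close> by an integral over \<open>[0,1]\<close>. The even moments of \<open>|x\<^sup>T v|\<close> satisfy, again by
  integration by parts, the recurrence of the Beta integral, and a distribution on \<open>[0,1]\<close> is determined by
  its moments; so \<open>|x\<^sup>T v|\<close> has density \<open>2 / B((n-k)/2, (k+1)/2)\<close> times the weight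
  (\<open>distr_stiefel_norm\<close>), and that constant is \<open>\<sigma>\<^sub>n\<^sub>-\<^sub>k\<^sub>-\<^sub>1 \<sigma>\<^sub>k / \<sigma>\<^sub>n\<close>.\<close>

section \<open>Directional derivatives of polynomial functions\<close>

text \<open>The formula of \<open>partial_deriv\<close>, for arbitrary directions and values, so that
  \<open>partial_deriv\<close> unfolds to it. For real polynomial functions it is the Frechet derivative, from which
  linearity in the direction and all rules of calculus are inherited.\<close>

definition dirderiv :: "'a::real_normed_vector \<Rightarrow> ('a \<Rightarrow> 'b::real_normed_vector) \<Rightarrow> 'a \<Rightarrow> 'b" where
  "dirderiv u f x = vector_derivative (\<lambda>t. f (x + t *\<^sub>R u)) (at 0)"

lemma dirderiv_eq:
  assumes "(f has_derivative F) (at x)"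
  shows "dirderiv u f x = F u"
proof -
  interpret bounded_linear F by (rule has_derivative_bounded_linear[OF assms])
  have "(f has_derivative F) (at (x + 0 *\<^sub>R u))" using assms by simp
  moreover have "((\<lambda>t::real. x + t *\<^sub>R u) has_derivative (\<lambda>t. t *\<^sub>R u)) (at 0)"
    by (auto intro!: derivative_eq_intros)
  ultimately have "((\<lambda>t. f (x + t *\<^sub>R u)) has_derivative (\<lambda>t. F (t *\<^sub>R u))) (at 0)"
    by (rule has_derivative_compose[rotated])
  then have "((\<lambda>t. f (x + t *\<^sub>R u)) has_vector_derivative F u) (at 0)"
    by (simp add: has_vector_derivative_def scaleR)
  then show ?thesis
    unfolding dirderiv_def by (rule vector_derivative_at)
qed

lemma real_polynomial_function_has_derivative:
  assumes "real_polynomial_function f"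
  shows "\<exists>F. (\<forall>x. (f has_derivative F x) (at x)) \<and> (\<forall>u. real_polynomial_function (\<lambda>x. F x u))"
  using assms
proof (induction f)
  case (linear f)
  then show ?case
    by (intro exI[of _ "\<lambda>x. f"]) (auto simp: bounded_linear_imp_has_derivative)
next
  case (const c)
  show ?case by (intro exI[of _ "\<lambda>x u. 0"]) auto
next
  case (add f g)
  then obtain F G where "\<forall>x. (f has_derivative F x) (at x)" "\<forall>u. real_polynomial_function (\<lambda>x. F x u)"
    "\<forall>x. (g has_derivative G x) (at x)" "\<forall>u. real_polynomial_function (\<lambda>x. G x u)" by auto
  then show ?case
    by (intro exI[of _ "\<lambda>x u. F x u + G x u"]) (auto intro!: has_derivative_add)
next
  case (mult f g)
  then obtain F G where "\<forall>x. (f has_derivative F x) (at x)" "\<forall>u. real_polynomial_function (\<lambda>x. F x u)"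
    "\<forall>x. (g has_derivative G x) (at x)" "\<forall>u. real_polynomial_function (\<lambda>x. G x u)" by auto
  with mult.hyps show ?case
    by (intro exI[of _ "\<lambda>x u. f x * G x u + F x u * g x"]) (auto intro!: has_derivative_mult real_polynomial_function.intros(3,4))
qed

lemma has_derivative_dirderiv:
  assumes "real_polynomial_function f"
  shows "(f has_derivative (\<lambda>u. dirderiv u f x)) (at x)"
proof -
  obtain F where F: "(f has_derivative F) (at x)"
    using real_polynomial_function_has_derivative[OF assms] by auto
  then have "(\<lambda>u. dirderiv u f x) = F" by (auto simp: dirderiv_eq)
  with F show ?thesis by simp
qed

lemma rpf_dirderiv [intro]:
  assumes "real_polynomial_function f"
  shows "real_polynomial_function (dirderiv u f)"
proof -
  obtain F where F: "\<And>x. (f has_derivative F x) (at x)" "real_polynomial_function (\<lambda>x. F x u)"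
    using real_polynomial_function_has_derivative[OF assms] by auto
  then have "dirderiv u f = (\<lambda>x. F x u)" by (auto simp: dirderiv_eq)
  with F show ?thesis by simp
qed

lemma rpf_inner [intro]: "real_polynomial_function (\<lambda>y::'a::real_inner. u \<bullet> y)"
  by (intro real_polynomial_function.intros(1) bounded_linear_inner_right)

lemma rpf_cmult [intro]: "real_polynomial_function f \<Longrightarrow> real_polynomial_function (\<lambda>y. c * f y)"
  by (intro real_polynomial_function.intros(4) real_polynomial_function.intros(2))

lemma dirderiv_const [simp]: "dirderiv u (\<lambda>y. c) x = 0"
  by (rule dirderiv_eq[of _ "\<lambda>u. 0"]) simp

lemma dirderiv_inner [simp]: "dirderiv u (\<lambda>y::'a::real_inner. w \<bullet> y) x = w \<bullet> u"
  by (rule dirderiv_eq[of _ "\<lambda>u. w \<bullet> u"])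
     (intro bounded_linear_imp_has_derivative bounded_linear_inner_right)

lemma dirderiv_add:
  assumes f: "real_polynomial_function f" and g: "real_polynomial_function g"
  shows "dirderiv u (\<lambda>y. f y + g y) x = dirderiv u f x + dirderiv u g x"
  by (rule dirderiv_eq[of _ "\<lambda>u. dirderiv u f x + dirderiv u g x"])
     (intro has_derivative_add has_derivative_dirderiv f g)

lemma dirderiv_diff:
  assumes f: "real_polynomial_function f" and g: "real_polynomial_function g"
  shows "dirderiv u (\<lambda>y. f y - g y) x = dirderiv u f x - dirderiv u g x"
  by (rule dirderiv_eq[of _ "\<lambda>u. dirderiv u f x - dirderiv u g x"])
     (intro has_derivative_diff has_derivative_dirderiv f g)

lemma dirderiv_mult:
  assumes f: "real_polynomial_function f" and g: "real_polynomial_function g"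
  shows "dirderiv u (\<lambda>y. f y * g y) x = f x * dirderiv u g x + dirderiv u f x * g x"
  by (rule dirderiv_eq[of _ "\<lambda>u. f x * dirderiv u g x + dirderiv u f x * g x"])
     (intro has_derivative_mult has_derivative_dirderiv f g)

lemma dirderiv_cmult:
  assumes f: "real_polynomial_function f"
  shows "dirderiv u (\<lambda>y. c * f y) x = c * dirderiv u f x"
  by (rule dirderiv_eq[of _ "\<lambda>u. c * dirderiv u f x"])
     (intro has_derivative_mult_right has_derivative_dirderiv f)

lemma dirderiv_power:
  assumes f: "real_polynomial_function f"
  shows "dirderiv u (\<lambda>y. f y ^ n) x = real n * f x ^ (n - 1) * dirderiv u f x"
  by (rule dirderiv_eq[of _ "\<lambda>u. real n * f x ^ (n - 1) * dirderiv u f x"])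
     (use has_derivative_power[OF has_derivative_dirderiv[OF f]] in \<open>simp add: mult_ac\<close>)

lemma dirderiv_sum:
  assumes "\<And>i. i \<in> I \<Longrightarrow> real_polynomial_function (f i)"
  shows "dirderiv u (\<lambda>y. \<Sum>i\<in>I. f i y) x = (\<Sum>i\<in>I. dirderiv u (f i) x)"
  by (rule dirderiv_eq[of _ "\<lambda>u. \<Sum>i\<in>I. dirderiv u (f i) x"])
     (intro has_derivative_sum has_derivative_dirderiv assms)

text \<open>For polynomial functions the symmetry of second derivatives is purely algebraic: it survives sums and,
  by the Leibniz rule, products.\<close>

lemma dirderiv_commute:
  assumes "real_polynomial_function f"
  shows "dirderiv u (dirderiv w f) = dirderiv w (dirderiv u f)"
  using assms
proof (induction f)
  case (linear f)
  then have "dirderiv u f = (\<lambda>x. f u)" for u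
    by (auto intro!: dirderiv_eq bounded_linear_imp_has_derivative)
  then show ?case by simp
next
  case (const c)
  have "dirderiv u (\<lambda>y. c) = (\<lambda>x. 0)" for u :: 'a
    by (rule ext) simp
  then show ?case by simp
next
  case (add f g)
  then have "dirderiv v (\<lambda>x. f x + g x) = (\<lambda>x. dirderiv v f x + dirderiv v g x)" for v
    by (intro ext dirderiv_add)
  with add show ?case by (auto simp: dirderiv_add rpf_dirderiv)
next
  case (mult f g)
  then have "dirderiv v (\<lambda>x. f x * g x) = (\<lambda>x. f x * dirderiv v g x + dirderiv v f x * g x)" for v
    by (intro ext dirderiv_mult)
  with mult show ?case
    by (auto simp: dirderiv_add dirderiv_mult rpf_dirderiv real_polynomial_function.intros(4) algebra_simps)
qed

definition homogeneous :: "nat \<Rightarrow> ('a::real_vector \<Rightarrow> real) \<Rightarrow> bool" where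
  "homogeneous j f \<longleftrightarrow> (\<forall>t x. f (t *\<^sub>R x) = t ^ j * f x)"

lemma homogeneous_mult:
  "homogeneous i f \<Longrightarrow> homogeneous j g \<Longrightarrow> homogeneous (i + j) (\<lambda>x. f x * g x)"
  by (simp add: homogeneous_def power_add)

lemma homogeneous_cmult: "homogeneous i f \<Longrightarrow> homogeneous i (\<lambda>x. c * f x)"
  by (simp add: homogeneous_def)

lemma homogeneous_power: "homogeneous i f \<Longrightarrow> homogeneous (i * n) (\<lambda>x. f x ^ n)"
  by (simp add: homogeneous_def power_mult_distrib power_mult)

lemma homogeneous_inner: "homogeneous 1 (\<lambda>x. u \<bullet> x)"
  by (simp add: homogeneous_def)

lemma homogeneous_sum: "(\<And>i. i \<in> I \<Longrightarrow> homogeneous j (f i)) \<Longrightarrow> homogeneous j (\<lambda>x. \<Sum>i\<in>I. f i x)"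
  by (simp add: homogeneous_def sum_distrib_left)

lemma has_real_derivative_along_ray:
  assumes "real_polynomial_function f"
  shows "((\<lambda>t. f (x + t *\<^sub>R u)) has_real_derivative dirderiv u f (x + s *\<^sub>R u)) (at s)"
proof -
  have "((\<lambda>t::real. x + t *\<^sub>R u) has_derivative (\<lambda>t. t *\<^sub>R u)) (at s)"
    by (auto intro!: derivative_eq_intros)
  from has_derivative_compose[OF this has_derivative_dirderiv[OF assms]]
  have D: "((\<lambda>t. f (x + t *\<^sub>R u)) has_derivative (\<lambda>t. dirderiv (t *\<^sub>R u) f (x + s *\<^sub>R u))) (at s)" .
  have "linear (\<lambda>w. dirderiv w f (x + s *\<^sub>R u))"
    using has_derivative_bounded_linear[OF has_derivative_dirderiv[OF assms]] bounded_linear.linear by blast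
  then have "dirderiv (t *\<^sub>R u) f (x + s *\<^sub>R u) = dirderiv u f (x + s *\<^sub>R u) * t" for t
    using linear_cmul by fastforce
  with D show ?thesis by (simp add: has_field_derivative_def)
qed

text \<open>Euler's identity.\<close>

lemma dirderiv_self:
  assumes f: "real_polynomial_function f" and h: "homogeneous j f"
  shows "dirderiv x f x = real j * f x"
proof -
  have "((\<lambda>t. f (0 + t *\<^sub>R x)) has_real_derivative dirderiv x f x) (at 1)"
    using has_real_derivative_along_ray[OF f, of 0 x 1] by simp
  moreover have "((\<lambda>t. f (0 + t *\<^sub>R x)) has_real_derivative real j * f x) (at 1)"
  proof -
    have "f (0 + t *\<^sub>R x) = t ^ j * f x" for t
      using h by (simp add: homogeneous_def)
    then show ?thesis by (auto intro!: derivative_eq_intros)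
  qed
  ultimately show ?thesis by (rule DERIV_unique)
qed

text \<open>For \<open>s \<noteq> 0\<close> this is the chain rule applied to \<open>f(s x + t s u) = s\<^sup>j f(x + t u)\<close>; the value
  \<open>s = 0\<close> follows by continuity. For \<open>j = 0\<close> the function is constant, so the truncated degree
  \<open>0 - 1 = 0\<close> is correct for its zero derivative.\<close>

lemma homogeneous_dirderiv:
  assumes f: "real_polynomial_function f" and h: "homogeneous j f"
  shows "homogeneous (j - 1) (dirderiv u f)"
proof -
  have nz: "dirderiv u f (s *\<^sub>R x) = s ^ (j - 1) * dirderiv u f x" if "s \<noteq> 0" for s x
  proof -
    have "((\<lambda>t. f (s *\<^sub>R x + t *\<^sub>R (s *\<^sub>R u))) has_real_derivative dirderiv (s *\<^sub>R u) f (s *\<^sub>R x)) (at 0)"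
      using has_real_derivative_along_ray[OF f, of "s *\<^sub>R x" "s *\<^sub>R u" 0] by simp
    moreover have "((\<lambda>t. f (s *\<^sub>R x + t *\<^sub>R (s *\<^sub>R u))) has_real_derivative s ^ j * dirderiv u f x) (at 0)"
    proof -
      have "f (s *\<^sub>R x + t *\<^sub>R (s *\<^sub>R u)) = s ^ j * f (x + t *\<^sub>R u)" for t
      proof -
        have "s *\<^sub>R x + t *\<^sub>R (s *\<^sub>R u) = s *\<^sub>R (x + t *\<^sub>R u)" by (simp add: algebra_simps)
        then show ?thesis using h by (simp only: homogeneous_def)
      qed
      then show ?thesis
        using DERIV_cmult[OF has_real_derivative_along_ray[OF f, of x u 0], of "s ^ j"] by simp
    qed
    ultimately have "dirderiv (s *\<^sub>R u) f (s *\<^sub>R x) = s ^ j * dirderiv u f x" by (rule DERIV_unique)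
    moreover have "dirderiv (s *\<^sub>R u) f (s *\<^sub>R x) = s * dirderiv u f (s *\<^sub>R x)"
      using linear_cmul[OF bounded_linear.linear[OF has_derivative_bounded_linear[OF has_derivative_dirderiv[OF f]]]]
      by auto
    ultimately have *: "s * dirderiv u f (s *\<^sub>R x) = s ^ j * dirderiv u f x" by simp
    show ?thesis
    proof (cases j)
      case 0
      have "f y = f 0" for y
      proof -
        have "f (0 *\<^sub>R y) = 0 ^ j * f y" using h unfolding homogeneous_def by blast
        with 0 show ?thesis by simp
      qed
      then have "f = (\<lambda>y. f 0)" by auto
      then have "dirderiv u f y = 0" for y by (metis dirderiv_const)
      then show ?thesis by simp
    next
      case (Suc i)
      with * that show ?thesis by simp
    qed
  qed
  have cont: "continuous_on UNIV (dirderiv u f)"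
    using continuous_on_polymonial_function rpf_dirderiv[OF f] real_polynomial_function_eq by blast
  have "dirderiv u f (s *\<^sub>R x) = s ^ (j - 1) * dirderiv u f x" for s x
  proof (cases "s = 0")
    case True
    have 1: "((\<lambda>t. dirderiv u f (t *\<^sub>R x)) \<longlongrightarrow> dirderiv u f (0 *\<^sub>R x)) (at 0)"
      by (rule isCont_tendsto_compose[where g = "dirderiv u f"])
         (use cont in \<open>auto intro!: tendsto_eq_intros simp: continuous_on_eq_continuous_at\<close>)
    have 2: "((\<lambda>t. t ^ (j - 1) * dirderiv u f x) \<longlongrightarrow> 0 ^ (j - 1) * dirderiv u f x) (at 0)"
      by (intro tendsto_intros)
    have "\<forall>\<^sub>F t in at 0. dirderiv u f (t *\<^sub>R x) = t ^ (j - 1) * dirderiv u f x"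
      by (rule eventually_at_filter[THEN iffD2]) (simp add: nz)
    from tendsto_unique[OF trivial_limit_at Lim_transform_eventually[OF 1 this] 2]
    show ?thesis unfolding True .
  qed (simp add: nz)
  then show ?thesis by (auto simp: homogeneous_def)
qed

section \<open>Rotation invariance of the surface measure\<close>

lemma emeasure_ball_unit:
  "emeasure lborel (ball (0::'a::euclidean_space) 1) \<noteq> 0"
  "emeasure lborel (ball (0::'a::euclidean_space) 1) \<noteq> \<infinity>"
proof -
  have "measure lborel (ball (0::'a) 1) > 0"
    by (rule content_ball_pos) simp
  then show "emeasure lborel (ball (0::'a) 1) \<noteq> 0"
    by (auto simp: measure_def)
  show "emeasure lborel (ball (0::'a) 1) \<noteq> \<infinity>" 
    using emeasure_lborel_ball_finite[of "0::'a" 1] by auto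
qed

text \<open>The image \<open>M\<close> of Lebesgue measure \<open>\<lambda>\<close> under an orthogonal map is translation invariant. The usual
  uniqueness argument for Haar measure evaluates \<open>\<integral>\<integral> 1\<^sub>A(x) 1\<^sub>B(x + y) d\<lambda>(y) dM(x)\<close> in two
  ways and yields \<open>M(A) \<lambda>(B) = M(B) \<lambda>(A)\<close>; the unit ball \<open>B\<close> is its own preimage, so the two
  measures agree.\<close>

lemma lborel_orthogonal_transformation:
  fixes U :: "'a::euclidean_space \<Rightarrow> 'a"
  assumes U: "orthogonal_transformation U"
  shows "distr lborel borel U = lborel"
proof -
  define M where "M = distr lborel borel U"
  have linU: "linear U" by (rule orthogonal_transformation_linear[OF U])
  have [measurable]: "U \<in> borel_measurable borel"
    by (intro borel_measurable_continuous_onI linear_continuous_on linear_conv_bounded_linear[THEN iffD1] linU)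
  obtain V where V: "orthogonal_transformation V" "\<And>x. V (U x) = x" "\<And>x. U (V x) = x"
    using orthogonal_transformation_inv[OF U] orthogonal_transformation_bij[OF U]
    by (metis bij_inv_eq_iff)
  have linV: "linear V" by (rule orthogonal_transformation_linear[OF V(1)])
  have [measurable]: "V \<in> borel_measurable borel"
    by (intro borel_measurable_continuous_onI linear_continuous_on linear_conv_bounded_linear[THEN iffD1] linV)
  have sets_M [measurable_cong]: "sets M = sets borel" and space_M: "space M = UNIV"
    by (auto simp: M_def)
  have "distr M borel V = lborel"
    unfolding M_def by (subst distr_distr) (auto simp: o_def V intro!: distr_id2)
  \<comment> \<open>\<open>M\<close> has the \<open>\<sigma>\<close>-finite image \<open>lborel\<close> under the inverse map.\<close>
  then interpret M: sigma_finite_measure M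
    using sigma_finite_measure_distr[of M borel V] lborel.sigma_finite_measure_axioms by auto
  interpret P: pair_sigma_finite M lborel ..
  have shift: "distr M borel (\<lambda>x. x + c) = M" for c
  proof -
    have "distr M borel (\<lambda>x. x + c) = distr lborel borel (\<lambda>x. U (V c + x))"
      unfolding M_def by (subst distr_distr) (auto simp: o_def V linear_add[OF linU] add_ac)
    also have "\<dots> = distr (distr lborel borel ((+) (V c))) borel U"
      by (subst distr_distr) (auto simp: o_def)
    finally show ?thesis by (simp add: lborel_distr_plus M_def)
  qed
  have reflect: "emeasure lborel A = (\<integral>\<^sup>+y. indicator A (x - y) \<partial>lborel)"
    if [measurable]: "A \<in> sets borel" for A and x :: 'a
  proof -
    have "lborel = distr lborel borel (\<lambda>y. x - y)"
      using lborel_affine[of "-1" x] by (simp add: density_1)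
    then have "emeasure lborel A = emeasure (distr lborel borel (\<lambda>y. x - y)) A" by simp
    also have "\<dots> = (\<integral>\<^sup>+y. indicator A (x - y) \<partial>lborel)"
      using nn_integral_distr[of "\<lambda>y. x - y" lborel borel "indicator A"] by simp
    finally show ?thesis .
  qed
  have key: "emeasure M A * emeasure lborel B = emeasure M B * emeasure lborel A"
    if [measurable]: "A \<in> sets borel" "B \<in> sets borel" for A B
  proof -
    have "emeasure lborel B = (\<integral>\<^sup>+y. indicator B (x + y) \<partial>lborel)" for x
    proof -
      have "emeasure lborel B = emeasure (distr lborel borel ((+) x)) B"
        by (simp add: lborel_distr_plus)
      also have "\<dots> = (\<integral>\<^sup>+y. indicator B (x + y) \<partial>lborel)"
        using nn_integral_distr[of "(+) x" lborel borel "indicator B"] by simp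
      finally show ?thesis .
    qed
    then have eq: "(\<integral>\<^sup>+y. indicator B (x + y) \<partial>lborel) = emeasure lborel B" for x by simp
    have "emeasure M A * emeasure lborel B =
        (\<integral>\<^sup>+x. indicator A x * (\<integral>\<^sup>+y. indicator B (x + y) \<partial>lborel) \<partial>M)"
      unfolding eq by (subst nn_integral_multc) (simp_all add: sets_M)
    also have "\<dots> = (\<integral>\<^sup>+x. (\<integral>\<^sup>+y. indicator A x * indicator B (x + y) \<partial>lborel) \<partial>M)"
      by (intro nn_integral_cong) (simp add: nn_integral_cmult)
    also have "\<dots> = (\<integral>\<^sup>+y. (\<integral>\<^sup>+x. indicator A x * indicator B (x + y) \<partial>M) \<partial>lborel)"
      by (subst P.Fubini') (auto simp: sets_M)
    also have "\<dots> = (\<integral>\<^sup>+y. (\<integral>\<^sup>+x. indicator A (x - y) * indicator B x \<partial>M) \<partial>lborel)"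
    proof (rule nn_integral_cong)
      fix y :: 'a
      have "(\<integral>\<^sup>+x. indicator A (x - y) * indicator B x \<partial>M) =
            (\<integral>\<^sup>+x. indicator A (x - y) * indicator B x \<partial>distr M borel (\<lambda>x. x + y))"
        by (simp add: shift)
      also have "\<dots> = (\<integral>\<^sup>+x. indicator A x * indicator B (x + y) \<partial>M)"
        by (subst nn_integral_distr) (auto simp: sets_M)
      finally show "(\<integral>\<^sup>+x. indicator A x * indicator B (x + y) \<partial>M) =
        (\<integral>\<^sup>+x. indicator A (x - y) * indicator B x \<partial>M)" ..
    qed
    also have "\<dots> = (\<integral>\<^sup>+x. (\<integral>\<^sup>+y. indicator A (x - y) * indicator B x \<partial>lborel) \<partial>M)"
      by (subst P.Fubini') (auto simp: sets_M)
    also have "\<dots> = (\<integral>\<^sup>+x. indicator B x * emeasure lborel A \<partial>M)"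
    proof (rule nn_integral_cong)
      fix x :: 'a
      show "(\<integral>\<^sup>+y. indicator A (x - y) * indicator B x \<partial>lborel) = indicator B x * emeasure lborel A"
        by (subst nn_integral_multc) (simp_all add: reflect[of A x, symmetric] mult.commute)
    qed
    also have "\<dots> = emeasure M B * emeasure lborel A"
      by (subst nn_integral_multc) (auto simp: sets_M)
    finally show ?thesis .
  qed
  have ball: "emeasure M (ball 0 1) = emeasure lborel (ball (0::'a) 1)"
  proof -
    have "U -` ball 0 1 = ball 0 1"
      using orthogonal_transformation_norm[OF U] by auto
    then show ?thesis by (simp add: M_def emeasure_distr)
  qed
  have "M = lborel"
  proof (rule measure_eqI)
    fix A assume "A \<in> sets M"
    then have "emeasure lborel (ball (0::'a) 1) * emeasure M A = emeasure lborel (ball (0::'a) 1) * emeasure lborel A"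
      using key[of A "ball 0 1"] ball by (simp add: sets_M mult.commute)
    then show "emeasure M A = emeasure lborel A"
      using emeasure_ball_unit[where 'a='a] by (simp add: ennreal_mult_cancel_left)
  qed (simp add: sets_M)
  then show ?thesis by (simp add: M_def)
qed

lemma sets_sphere_measure [measurable_cong]:
  "sets (sphere_measure :: 'a::euclidean_space measure) = sets (restrict_space borel (sphere 0 1))"
  unfolding sphere_measure_def by (auto simp: sets_restrict_space)

lemma space_sphere_measure: "space (sphere_measure :: 'a::euclidean_space measure) = sphere 0 1"
  unfolding sphere_measure_def by (auto simp: space_restrict_space)

lemma prob_space_sphere_measure: "prob_space (sphere_measure :: 'a::euclidean_space measure)"
  unfolding sphere_measure_def
proof (rule prob_space_restrict_space)
  let ?u = "uniform_measure lborel (ball (0::'a) 1)"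
  interpret u: prob_space ?u
    by (rule prob_space_uniform_measure) (use emeasure_ball_unit in auto)
  have "AE x::'a in lborel. x \<noteq> 0" by (rule AE_lborel_singleton)
  then have "AE x in ?u. x \<noteq> 0"
    by (subst AE_uniform_measure) (use emeasure_ball_unit in \<open>auto simp: top.not_eq_extremum\<close>)
  then have "emeasure ?u (UNIV - {0}) = 1"
    by (subst u.emeasure_eq_1_AE) auto
  moreover have "(\<lambda>x::'a. x /\<^sub>R norm x) -` sphere 0 1 = UNIV - {0}" by auto
  ultimately show "emeasure (distr ?u borel (\<lambda>x. x /\<^sub>R norm x)) (sphere 0 1) = 1"
    by (subst emeasure_distr) auto
qed auto

text \<open>Orthogonal maps preserve the uniform measure on the ball and commute with the radial projection.\<close>

lemma distr_sphere_measure_orthogonal: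
  fixes U :: "'a::euclidean_space \<Rightarrow> 'a"
  assumes U: "orthogonal_transformation U"
  shows "distr sphere_measure sphere_measure U = sphere_measure"
proof (rule measure_eqI)
  let ?u = "uniform_measure lborel (ball (0::'a) 1)"
  let ?\<nu> = "\<lambda>x::'a. x /\<^sub>R norm x"
  have linU: "linear U" by (rule orthogonal_transformation_linear[OF U])
  have [measurable]: "U \<in> borel_measurable borel"
    by (intro borel_measurable_continuous_onI linear_continuous_on linear_conv_bounded_linear[THEN iffD1] linU)
  have nU: "norm (U x) = norm x" for x by (rule orthogonal_transformation_norm[OF U])
  have [measurable]: "U \<in> measurable sphere_measure sphere_measure"
    by (subst measurable_cong_sets[OF sets_sphere_measure sets_sphere_measure])
       (auto intro!: measurable_restrict_space3 simp: nU)
  have u: "distr ?u borel U = ?u"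
  proof (rule measure_eqI)
    fix B assume "B \<in> sets (distr ?u borel U)"
    then have [measurable]: "B \<in> sets borel" by simp
    have [measurable]: "U -` B \<in> sets borel"
      by (rule measurable_sets_borel) measurable
    have "emeasure lborel (ball 0 1 \<inter> U -` B) = emeasure lborel (U -` (ball 0 1 \<inter> B))"
      by (intro arg_cong2[where f = emeasure]) (auto simp: nU)
    also have "\<dots> = emeasure (distr lborel borel U) (ball 0 1 \<inter> B)"
      by (subst emeasure_distr) auto
    also have "\<dots> = emeasure lborel (ball 0 1 \<inter> B)"
      by (simp add: lborel_orthogonal_transformation[OF U])
    finally show "emeasure (distr ?u borel U) B = emeasure ?u B"
      by (subst emeasure_distr) auto
  qed simp
  have \<nu>U: "?\<nu> (U x) = U (?\<nu> x)" for x
    by (simp add: nU linear_cmul[OF linU])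
  have dU: "distr (distr ?u borel ?\<nu>) borel U = distr ?u borel ?\<nu>"
    by (subst (2) u[symmetric]) (simp add: distr_distr o_def \<nu>U del: u)
  fix A assume "A \<in> sets (distr sphere_measure sphere_measure U)"
  then have A: "A \<in> sets (restrict_space borel (sphere 0 1))"
    by (simp add: sets_sphere_measure)
  then have A': "A \<in> sets borel" "A \<subseteq> sphere 0 1"
    by (auto simp: sets_restrict_space)
  have UA: "U -` A \<subseteq> sphere 0 1" using A'(2) by (auto simp: nU subset_iff)
  have "emeasure (distr sphere_measure sphere_measure U) A = emeasure sphere_measure (U -` A)"
    using A UA by (subst emeasure_distr) (auto simp: space_sphere_measure sets_sphere_measure Int_absorb2)
  also have "\<dots> = emeasure (distr ?u borel ?\<nu>) (U -` A)"
    using UA A'(1) unfolding sphere_measure_def by (subst emeasure_restrict_space) auto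
  also have "\<dots> = emeasure (distr (distr ?u borel ?\<nu>) borel U) A"
    using A'(1) by (subst (2) emeasure_distr) auto
  also have "\<dots> = emeasure sphere_measure A"
    using A' unfolding dU sphere_measure_def by (subst emeasure_restrict_space) auto
  finally show "emeasure (distr sphere_measure sphere_measure U) A = emeasure sphere_measure A" .
qed simp

lemma borel_measurable_sphere_measureI:
  "f \<in> borel_measurable borel \<Longrightarrow> f \<in> borel_measurable sphere_measure"
  by (subst measurable_cong_sets[OF sets_sphere_measure refl]) (rule measurable_restrict_space1)

lemma integral_sphere_measure_orthogonal:
  fixes U :: "'a::euclidean_space \<Rightarrow> 'a" and f :: "'a \<Rightarrow> 'b::{banach, second_countable_topology}"
  assumes U: "orthogonal_transformation U" and f: "f \<in> borel_measurable sphere_measure"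
  shows "(LINT y|sphere_measure. f (U y)) = (LINT y|sphere_measure. f y)"
proof -
  have linU: "linear U" by (rule orthogonal_transformation_linear[OF U])
  have [measurable]: "U \<in> borel_measurable borel"
    by (intro borel_measurable_continuous_onI linear_continuous_on linear_conv_bounded_linear[THEN iffD1] linU)
  have [measurable]: "U \<in> measurable sphere_measure sphere_measure"
    by (subst measurable_cong_sets[OF sets_sphere_measure sets_sphere_measure])
       (auto intro!: measurable_restrict_space3 simp: orthogonal_transformation_norm[OF U])
  have "(LINT y|sphere_measure. f y) = (LINT y|distr sphere_measure sphere_measure U. f y)"
    by (simp add: distr_sphere_measure_orthogonal[OF U])
  also have "\<dots> = (LINT y|sphere_measure. f (U y))"
    by (rule integral_distr) (use f in auto)
  finally show ?thesis ..
qed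

lemma continuous_bounded_on_sphere:
  fixes f :: "'a::euclidean_space \<Rightarrow> 'b::real_normed_vector"
  assumes "continuous_on (sphere 0 1) f"
  obtains B where "B > 0" "\<And>y. y \<in> sphere 0 1 \<Longrightarrow> norm (f y) \<le> B"
proof -
  have "bounded (f ` sphere 0 1)"
    by (intro compact_imp_bounded compact_continuous_image assms compact_sphere)
  then show thesis using that by (auto simp: bounded_pos)
qed

lemma integrable_sphere_measure_continuous:
  fixes f :: "'a::euclidean_space \<Rightarrow> 'b::{banach, second_countable_topology}"
  assumes "continuous_on UNIV f"
  shows "integrable sphere_measure f"
proof -
  interpret prob_space "sphere_measure :: 'a measure" by (rule prob_space_sphere_measure)
  obtain B where "\<And>y. y \<in> sphere 0 1 \<Longrightarrow> norm (f y) \<le> B"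
    using continuous_bounded_on_sphere[OF continuous_on_subset[OF assms subset_UNIV]] by metis
  then show ?thesis
    by (intro integrable_const_bound[of f B] AE_I2)
       (auto simp: space_sphere_measure intro!: borel_measurable_sphere_measureI
         borel_measurable_continuous_onI assms)
qed

section \<open>Integration by parts on the sphere\<close>

lemma continuous_on_rpf: "real_polynomial_function f \<Longrightarrow> continuous_on S f"
  using continuous_on_polymonial_function real_polynomial_function_eq by blast

lemma integrable_sphere_rpf:
  "real_polynomial_function f \<Longrightarrow> integrable sphere_measure (f :: 'a::euclidean_space \<Rightarrow> real)"
  by (intro integrable_sphere_measure_continuous continuous_on_rpf)

lemma linear_dirderiv:
  "real_polynomial_function f \<Longrightarrow> linear (\<lambda>u. dirderiv u f x)"
  using has_derivative_bounded_linear[OF has_derivative_dirderiv] bounded_linear.linear by blast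

lemma dirderiv_eq_sum_Basis:
  assumes f: "real_polynomial_function f"
  shows "dirderiv u f y = (\<Sum>b\<in>Basis. (u \<bullet> b) * dirderiv b f y)"
proof -
  have "dirderiv (\<Sum>b\<in>Basis. (u \<bullet> b) *\<^sub>R b) f y = (\<Sum>b\<in>Basis. (u \<bullet> b) * dirderiv b f y)"
    using linear_dirderiv[OF f, of y]
    by (subst linear_sum[of "\<lambda>u. dirderiv u f y"]) (auto simp: linear_cmul[of "\<lambda>u. dirderiv u f y"])
  then show ?thesis by (simp add: euclidean_representation)
qed

lemma rpf_inner_left [intro]: "real_polynomial_function (\<lambda>y::'a::real_inner. y \<bullet> u)"
  by (intro real_polynomial_function.intros bounded_linear_inner_left)

text \<open>For orthonormal \<open>b\<close> and \<open>c\<close> this is the rotation by \<open>\<theta>\<close> in the plane that they span, the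
  identity on the orthogonal complement.\<close>

definition plane_rotation :: "'a::real_inner \<Rightarrow> 'a \<Rightarrow> real \<Rightarrow> 'a \<Rightarrow> 'a" where
  "plane_rotation b c \<theta> y = y + (cos \<theta> - 1) *\<^sub>R ((y \<bullet> b) *\<^sub>R b + (y \<bullet> c) *\<^sub>R c)
     + sin \<theta> *\<^sub>R ((y \<bullet> b) *\<^sub>R c - (y \<bullet> c) *\<^sub>R b)"

lemma
  assumes bc: "norm b = 1" "norm c = 1" "b \<bullet> c = 0"
  shows plane_rotation_inner_1: "plane_rotation b c \<theta> y \<bullet> b = cos \<theta> * (y \<bullet> b) - sin \<theta> * (y \<bullet> c)"
    and plane_rotation_inner_2: "plane_rotation b c \<theta> y \<bullet> c = cos \<theta> * (y \<bullet> c) + sin \<theta> * (y \<bullet> b)"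
proof -
  have "b \<bullet> b = 1" "c \<bullet> c = 1" "c \<bullet> b = 0"
    using bc by (auto simp: norm_eq_1 inner_commute)
  with bc(3) show "plane_rotation b c \<theta> y \<bullet> b = cos \<theta> * (y \<bullet> b) - sin \<theta> * (y \<bullet> c)"
    "plane_rotation b c \<theta> y \<bullet> c = cos \<theta> * (y \<bullet> c) + sin \<theta> * (y \<bullet> b)"
    by (simp_all add: plane_rotation_def inner_simps algebra_simps)
qed

lemma orthogonal_transformation_plane_rotation:
  assumes bc: "norm b = 1" "norm c = 1" "b \<bullet> c = 0"
  shows "orthogonal_transformation (plane_rotation b c \<theta>)"
  unfolding orthogonal_transformation_def
proof (intro conjI allI)
  show "linear (plane_rotation b c \<theta>)"
    by (rule linearI) (simp_all add: plane_rotation_def inner_simps algebra_simps)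
  fix v w
  let ?R = "plane_rotation b c \<theta>"
  have 1: "?R v \<bullet> ?R w = ?R v \<bullet> w + (cos \<theta> - 1) * ((w \<bullet> b) * (?R v \<bullet> b) + (w \<bullet> c) * (?R v \<bullet> c))
     + sin \<theta> * ((w \<bullet> b) * (?R v \<bullet> c) - (w \<bullet> c) * (?R v \<bullet> b))"
    by (subst (2) plane_rotation_def) (simp add: inner_simps algebra_simps)
  have 2: "?R v \<bullet> w = v \<bullet> w + (cos \<theta> - 1) * ((v \<bullet> b) * (w \<bullet> b) + (v \<bullet> c) * (w \<bullet> c))
     + sin \<theta> * ((v \<bullet> b) * (w \<bullet> c) - (v \<bullet> c) * (w \<bullet> b))"
    by (simp add: plane_rotation_def inner_simps inner_commute[of _ w] algebra_simps)
  show "?R v \<bullet> ?R w = v \<bullet> w"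
    unfolding 1 2 plane_rotation_inner_1[OF bc] plane_rotation_inner_2[OF bc]
    using sin_cos_squared_add[of \<theta>] by algebra
qed

lemma has_real_derivative_plane_rotation:
  assumes bc: "norm b = 1" "norm c = 1" "b \<bullet> c = 0" and f: "real_polynomial_function f"
  defines "g \<equiv> \<lambda>z. (z \<bullet> b) * dirderiv c f z - (z \<bullet> c) * dirderiv b f z"
  shows "((\<lambda>\<theta>. f (plane_rotation b c \<theta> y)) has_real_derivative g (plane_rotation b c \<theta> y)) (at \<theta>)"
proof -
  let ?z = "plane_rotation b c \<theta> y"
  have "((\<lambda>\<theta>. plane_rotation b c \<theta> y) has_derivative
      (\<lambda>t. t *\<^sub>R ((?z \<bullet> b) *\<^sub>R c - (?z \<bullet> c) *\<^sub>R b))) (at \<theta>)"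
    unfolding plane_rotation_inner_1[OF bc] plane_rotation_inner_2[OF bc]
    unfolding plane_rotation_def
    by (auto intro!: derivative_eq_intros simp: algebra_simps)
  from has_derivative_compose[OF this has_derivative_dirderiv[OF f]]
  have D: "((\<lambda>\<theta>. f (plane_rotation b c \<theta> y)) has_derivative
      (\<lambda>t. dirderiv (t *\<^sub>R ((?z \<bullet> b) *\<^sub>R c - (?z \<bullet> c) *\<^sub>R b)) f ?z)) (at \<theta>)" .
  have "dirderiv (t *\<^sub>R ((?z \<bullet> b) *\<^sub>R c - (?z \<bullet> c) *\<^sub>R b)) f ?z = g ?z * t" for t
    using linear_dirderiv[OF f, of ?z]
    by (simp add: g_def linear_cmul[of "\<lambda>u. dirderiv u f ?z"] linear_diff[of "\<lambda>u. dirderiv u f ?z"])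
  with D show ?thesis by (simp add: has_field_derivative_def)
qed

text \<open>The integrand is the derivative of \<open>f\<close> along the rotation field of the plane of \<open>b\<close> and \<open>c\<close>. Since
  \<open>\<integral> f(R\<^sub>\<theta> y) d\<sigma>(y)\<close> does not depend on \<open>\<theta>\<close>, its difference quotients vanish; they are dominated
  because, by the mean value theorem, each is a value of that bounded derivative at another point of the
  sphere.\<close>

lemma integral_sphere_rotation_derivative:
  fixes f :: "'a::euclidean_space \<Rightarrow> real"
  assumes bc: "norm b = 1" "norm c = 1" "b \<bullet> c = 0" and f: "real_polynomial_function f"
  shows "(LINT y|sphere_measure. (y \<bullet> b) * dirderiv c f y - (y \<bullet> c) * dirderiv b f y) = 0"
proof -
  interpret S: prob_space "sphere_measure :: 'a measure" by (rule prob_space_sphere_measure)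
  define g where "g = (\<lambda>z. (z \<bullet> b) * dirderiv c f z - (z \<bullet> c) * dirderiv b f z)"
  define R where "R = plane_rotation b c"
  have R: "orthogonal_transformation (R \<theta>)" for \<theta>
    unfolding R_def by (rule orthogonal_transformation_plane_rotation[OF bc])
  have R0: "R 0 y = y" for y by (simp add: R_def plane_rotation_def)
  have der: "((\<lambda>\<theta>. f (R \<theta> y)) has_real_derivative g (R \<theta> y)) (at \<theta>)" for \<theta> y
    unfolding R_def g_def by (rule has_real_derivative_plane_rotation[OF bc f])
  have g: "real_polynomial_function g"
    unfolding g_def
    by (intro real_polynomial_function_diff real_polynomial_function.intros(4) rpf_inner_left rpf_dirderiv f)
  obtain B where B: "\<And>y. y \<in> sphere 0 1 \<Longrightarrow> norm (g y) \<le> B"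
    using continuous_bounded_on_sphere[OF continuous_on_rpf[OF g]] by metis
  have cR: "continuous_on UNIV (\<lambda>y. f (R \<theta> y))" for \<theta>
    by (rule continuous_on_compose2[OF continuous_on_rpf[OF f, of UNIV]])
       (auto intro!: linear_continuous_on linear_conv_bounded_linear[THEN iffD1] orthogonal_transformation_linear R)
  have mR: "(\<lambda>y. f (R \<theta> y)) \<in> borel_measurable sphere_measure" for \<theta>
    by (intro borel_measurable_sphere_measureI borel_measurable_continuous_onI cR)
  have iR: "integrable sphere_measure (\<lambda>y. f (R \<theta> y))" for \<theta>
    by (intro integrable_sphere_measure_continuous cR)
  have inv: "(LINT y|sphere_measure. f (R \<theta> y)) = (LINT y|sphere_measure. f y)" for \<theta>
    by (intro integral_sphere_measure_orthogonal R
        borel_measurable_sphere_measureI borel_measurable_continuous_onI continuous_on_rpf f)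
  define F where "F = (\<lambda>n y. (f (R (inverse (real (Suc n))) y) - f y) / inverse (real (Suc n)))"
  have "(\<lambda>n. LINT y|sphere_measure. F n y) \<longlonglongrightarrow> (LINT y|sphere_measure. g y)"
  proof (rule integral_dominated_convergence[where w = "\<lambda>_. B"])
    show "g \<in> borel_measurable sphere_measure"
      by (intro borel_measurable_sphere_measureI borel_measurable_continuous_onI continuous_on_rpf g)
    show "F n \<in> borel_measurable sphere_measure" for n
      unfolding F_def using mR mR[of 0, unfolded R0] by measurable
    show "AE y in sphere_measure. (\<lambda>n. F n y) \<longlonglongrightarrow> g y"
    proof (rule AE_I2)
      fix y
      have "((\<lambda>h. (f (R (0 + h) y) - f (R 0 y)) / h) \<longlongrightarrow> g (R 0 y)) (at 0)"
        using der[of y 0] unfolding DERIV_def .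
      then have "((\<lambda>h. (f (R h y) - f y) / h) \<longlongrightarrow> g y) (at 0)" by (simp add: R0)
      moreover have "filterlim (\<lambda>n. inverse (real (Suc n))) (at 0) sequentially"
        using LIMSEQ_inverse_real_of_nat by (auto simp: filterlim_at)
      ultimately show "(\<lambda>n. F n y) \<longlonglongrightarrow> g y"
        unfolding F_def by (rule filterlim_compose)
    qed
    show "AE y in sphere_measure. norm (F n y) \<le> B" for n
    proof (rule AE_I2)
      fix y :: 'a assume "y \<in> space sphere_measure"
      then have y: "norm y = 1" by (simp add: space_sphere_measure)
      obtain z where "0 < z" "f (R (inverse (real (Suc n))) y) - f (R 0 y) = (inverse (real (Suc n)) - 0) * g (R z y)"
        using MVT2[of 0 "inverse (real (Suc n))" "\<lambda>\<theta>. f (R \<theta> y)" "\<lambda>\<theta>. g (R \<theta> y)"] der by auto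
      then have "F n y = g (R z y)" by (simp add: F_def R0 field_simps)
      moreover have "R z y \<in> sphere 0 1" using orthogonal_transformation_norm[OF R] y by simp
      ultimately show "norm (F n y) \<le> B" using B by metis
    qed
  qed simp
  moreover have "(LINT y|sphere_measure. F n y) = 0" for n
    unfolding F_def
    by (subst integral_divide_zero, subst Bochner_Integration.integral_diff)
       (use iR iR[of 0] inv in \<open>simp_all add: R0\<close>)
  ultimately have "(LINT y|sphere_measure. g y) = 0" by (simp add: LIMSEQ_const_iff)
  then show ?thesis by (simp add: g_def)
qed

text \<open>With \<open>d\<close> the dimension, the rotation identity is applied to \<open>(y \<bullet> b) f(y)\<close> in the plane of \<open>b\<close> and
  \<open>c\<close> and summed over the \<open>d - 1\<close> basis vectors \<open>b \<noteq> c\<close>. Euler's identity and \<open>|y| = 1\<close> turn the sum of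
  the integrands into \<open>(d - 1 + l) (y \<bullet> c) f - \<partial>\<^sub>c f\<close>.\<close>

lemma integral_sphere_by_parts_Basis:
  fixes f :: "'a::euclidean_space \<Rightarrow> real"
  assumes c: "c \<in> Basis" and f: "real_polynomial_function f" and h: "homogeneous l f"
  shows "(real DIM('a) - 1 + real l) * (LINT y|sphere_measure. (y \<bullet> c) * f y)
    = (LINT y|sphere_measure. dirderiv c f y)"
proof -
  define G where "G = (\<lambda>b y. (y \<bullet> c) * dirderiv b (\<lambda>y. (b \<bullet> y) * f y) y - (y \<bullet> b) * dirderiv c (\<lambda>y. (b \<bullet> y) * f y) y)"
  have G0: "(LINT y|sphere_measure. G b y) = 0" if "b \<in> Basis - {c}" for b
    unfolding G_def using that c
    by (intro integral_sphere_rotation_derivative) (auto simp: inner_not_same_Basis intro!: real_polynomial_function.intros(4) f)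
  have G: "real_polynomial_function (G b)" for b
    unfolding G_def
    by (intro real_polynomial_function_diff real_polynomial_function.intros(4) rpf_inner_left rpf_inner rpf_dirderiv f)
  have "(\<Sum>b\<in>Basis - {c}. G b y) = (real DIM('a) - 1 + real l) * ((y \<bullet> c) * f y) - dirderiv c f y"
    if y: "y \<in> sphere 0 1" for y
  proof -
    have Gb: "G b y = (y \<bullet> c) * f y + (y \<bullet> c) * ((y \<bullet> b) * dirderiv b f y) - (y \<bullet> b)\<^sup>2 * dirderiv c f y"
      if "b \<in> Basis - {c}" for b
      using that c unfolding G_def
      by (subst (1 2) dirderiv_mult)
         (auto simp: f inner_not_same_Basis inner_commute[of y] algebra_simps power2_eq_square)
    have euler: "(\<Sum>b\<in>Basis. (y \<bullet> b) * dirderiv b f y) = real l * f y"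
      using dirderiv_eq_sum_Basis[OF f, of y y] dirderiv_self[OF f h, of y] by simp
    have nrm: "(\<Sum>b\<in>Basis. (y \<bullet> b)\<^sup>2) = 1"
      using y euclidean_inner[of y y] by (simp add: power2_eq_square norm_eq_1)
    have "(\<Sum>b\<in>Basis - {c}. G b y) = (\<Sum>b\<in>Basis - {c}. (y \<bullet> c) * f y + (y \<bullet> c) * ((y \<bullet> b) * dirderiv b f y) - (y \<bullet> b)\<^sup>2 * dirderiv c f y)"
      by (rule sum.cong) (auto simp: Gb)
    also have "\<dots> = real (DIM('a) - 1) * ((y \<bullet> c) * f y) + (y \<bullet> c) * (\<Sum>b\<in>Basis - {c}. (y \<bullet> b) * dirderiv b f y)
        - (\<Sum>b\<in>Basis - {c}. (y \<bullet> b)\<^sup>2) * dirderiv c f y"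
      using c by (simp add: sum_subtractf sum.distrib sum_distrib_left sum_distrib_right card_Diff_singleton)
    also have "\<dots> = (real DIM('a) - 1) * ((y \<bullet> c) * f y) + (y \<bullet> c) * (real l * f y - (y \<bullet> c) * dirderiv c f y)
        - (1 - (y \<bullet> c)\<^sup>2) * dirderiv c f y"
      using c euler nrm DIM_positive[where 'a='a]
      by (simp add: sum_diff1 of_nat_diff Suc_leI)
    finally show ?thesis by (simp add: algebra_simps power2_eq_square)
  qed
  then have "(LINT y|sphere_measure. (\<Sum>b\<in>Basis - {c}. G b y)) =
     (LINT y|sphere_measure. (real DIM('a) - 1 + real l) * ((y \<bullet> c) * f y) - dirderiv c f y)"
    by (intro Bochner_Integration.integral_cong) (auto simp: space_sphere_measure)
  also have "(LINT y|sphere_measure. (\<Sum>b\<in>Basis - {c}. G b y)) = 0"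
    by (subst Bochner_Integration.integral_sum) (auto simp: G0 intro!: integrable_sphere_rpf G)
  also have "(LINT y|sphere_measure. (real DIM('a) - 1 + real l) * ((y \<bullet> c) * f y) - dirderiv c f y)
     = (real DIM('a) - 1 + real l) * (LINT y|sphere_measure. (y \<bullet> c) * f y) - (LINT y|sphere_measure. dirderiv c f y)"
    by (subst Bochner_Integration.integral_diff)
       (auto intro!: integrable_sphere_rpf rpf_cmult real_polynomial_function.intros(4) rpf_inner_left rpf_dirderiv f)
  finally show ?thesis by simp
qed

lemma integral_sphere_by_parts:
  fixes f :: "'a::euclidean_space \<Rightarrow> real"
  assumes f: "real_polynomial_function f" and h: "homogeneous l f"
  shows "(real DIM('a) - 1 + real l) * (LINT y|sphere_measure. (u \<bullet> y) * f y)
    = (LINT y|sphere_measure. dirderiv u f y)"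
proof -
  have int: "integrable sphere_measure (\<lambda>y. (y \<bullet> b) * f y)" for b
    by (intro integrable_sphere_rpf real_polynomial_function.intros(4) rpf_inner_left f)
  have int': "integrable sphere_measure (dirderiv b f)" for b
    by (intro integrable_sphere_rpf rpf_dirderiv f)
  have "(LINT y|sphere_measure. (u \<bullet> y) * f y) = (LINT y|sphere_measure. (\<Sum>b\<in>Basis. (u \<bullet> b) * ((y \<bullet> b) * f y)))"
    by (subst euclidean_inner) (simp add: sum_distrib_left sum_distrib_right mult_ac)
  also have "\<dots> = (\<Sum>b\<in>Basis. (u \<bullet> b) * (LINT y|sphere_measure. (y \<bullet> b) * f y))"
    by (subst Bochner_Integration.integral_sum) (auto intro!: integrable_mult_right int)
  finally have "(real DIM('a) - 1 + real l) * (LINT y|sphere_measure. (u \<bullet> y) * f y)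
    = (\<Sum>b\<in>Basis. (u \<bullet> b) * ((real DIM('a) - 1 + real l) * (LINT y|sphere_measure. (y \<bullet> b) * f y)))"
    by (simp add: sum_distrib_left mult_ac)
  also have "\<dots> = (\<Sum>b\<in>Basis. (u \<bullet> b) * (LINT y|sphere_measure. dirderiv b f y))"
    using integral_sphere_by_parts_Basis[OF _ f h] by simp
  also have "\<dots> = (LINT y|sphere_measure. (\<Sum>b\<in>Basis. (u \<bullet> b) * dirderiv b f y))"
    by (subst Bochner_Integration.integral_sum) (auto intro!: integrable_mult_right int')
  also have "(\<lambda>y. \<Sum>b\<in>Basis. (u \<bullet> b) * dirderiv b f y) = dirderiv u f"
    by (rule ext, rule dirderiv_eq_sum_Basis[OF f, symmetric])
  finally show ?thesis .
qed

section \<open>Spherical moments of harmonic polynomials\<close>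

definition solid_harmonic :: "nat \<Rightarrow> ('a::euclidean_space \<Rightarrow> real) \<Rightarrow> bool" where
  "solid_harmonic j P \<longleftrightarrow> real_polynomial_function P \<and> homogeneous j P
     \<and> (\<forall>y. (\<Sum>b\<in>Basis. dirderiv b (dirderiv b P) y) = 0)"

lemma solid_harmonicD:
  assumes "solid_harmonic j P"
  shows "real_polynomial_function P" "homogeneous j P" "(\<Sum>b\<in>Basis. dirderiv b (dirderiv b P) y) = 0"
  using assms by (auto simp: solid_harmonic_def)

lemma solid_harmonic_dirderiv:
  assumes "solid_harmonic j P"
  shows "solid_harmonic (j - 1) (dirderiv u P)"
  unfolding solid_harmonic_def
proof (intro conjI allI rpf_dirderiv homogeneous_dirderiv solid_harmonicD[OF assms])
  note P = solid_harmonicD[OF assms]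
  fix y
  have "dirderiv b (dirderiv b (dirderiv u P)) = dirderiv u (dirderiv b (dirderiv b P))" for b
    using dirderiv_commute[OF P(1), of b u] dirderiv_commute[OF rpf_dirderiv[OF P(1)], of b u b] by simp
  then have "(\<Sum>b\<in>Basis. dirderiv b (dirderiv b (dirderiv u P)) y)
      = dirderiv u (\<lambda>y. \<Sum>b\<in>Basis. dirderiv b (dirderiv b P) y) y"
    by (subst dirderiv_sum) (auto intro!: rpf_dirderiv P)
  then show "(\<Sum>b\<in>Basis. dirderiv b (dirderiv b (dirderiv u P)) y) = 0"
    by (simp add: P)
qed

text \<open>Euler's identity writes \<open>j P\<close> as \<open>\<Sum>\<^sub>b y\<^sub>b \<partial>\<^sub>b P\<close>, and integration by parts turns the integral of that
  sum into a multiple of the integral of the Laplacian.\<close>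

lemma integral_solid_harmonic_eq_0:
  fixes P :: "'a::euclidean_space \<Rightarrow> real"
  assumes P: "solid_harmonic j P" and j: "j > 0" and d: "DIM('a) \<ge> 2"
  shows "(LINT y|sphere_measure. P y) = 0"
proof -
  note P' = solid_harmonicD[OF P]
  have int: "integrable sphere_measure (\<lambda>y. (b \<bullet> y) * dirderiv b P y)"
    "integrable sphere_measure (dirderiv b (dirderiv b P))" for b
    by (intro integrable_sphere_rpf real_polynomial_function.intros(4) rpf_inner rpf_dirderiv P')+
  let ?c = "real DIM('a) - 1 + real (j - 1)"
  have "real j * P y = (\<Sum>b\<in>Basis. (b \<bullet> y) * dirderiv b P y)" for y
    using dirderiv_eq_sum_Basis[OF P'(1), of y y] dirderiv_self[OF P'(1,2), of y] by (simp add: inner_commute)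
  then have "?c * (real j * (LINT y|sphere_measure. P y)) = ?c * (LINT y|sphere_measure. (\<Sum>b\<in>Basis. (b \<bullet> y) * dirderiv b P y))"
    by (simp flip: integral_mult_right_zero)
  also have "\<dots> = (\<Sum>b\<in>Basis. ?c * (LINT y|sphere_measure. (b \<bullet> y) * dirderiv b P y))"
    by (subst Bochner_Integration.integral_sum) (auto simp: sum_distrib_left intro!: int)
  also have "\<dots> = (\<Sum>b\<in>Basis. (LINT y|sphere_measure. dirderiv b (dirderiv b P) y))"
    by (intro sum.cong refl integral_sphere_by_parts rpf_dirderiv homogeneous_dirderiv P')
  also have "\<dots> = (LINT y|sphere_measure. (\<Sum>b\<in>Basis. dirderiv b (dirderiv b P) y))"
    by (subst Bochner_Integration.integral_sum) (auto intro!: int)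
  finally have "?c * (real j * (LINT y|sphere_measure. P y)) = 0" by (simp add: P')
  moreover have "?c \<noteq> 0" using d by linarith
  ultimately show ?thesis using j by simp
qed

text \<open>The constants \<open>A(l,j)\<close> with \<open>\<integral> (x \<bullet> y)\<^sup>l P(y) d\<sigma>(y) = A(l,j) P(x)\<close> in dimension \<open>d\<close>. The recurrence is
  an integration by parts in the direction \<open>x\<close>. Truncated subtraction is harmless, since \<open>l - 1\<close> and
  \<open>j - 1\<close> come with the factors \<open>l\<close> and \<open>j\<close>.\<close>

fun zonal_moment :: "real \<Rightarrow> nat \<Rightarrow> nat \<Rightarrow> real" where
  "zonal_moment d 0 j = (if j = 0 then 1 else 0)"
| "zonal_moment d (Suc l) j =
     (real l * zonal_moment d (l - 1) j + real j * zonal_moment d l (j - 1)) / (d + real l + real j - 1)"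

lemma zonal_moment_eq_0: "l < j \<Longrightarrow> zonal_moment d l j = 0"
  by (induction d l j rule: zonal_moment.induct) auto

lemma zonal_moment_Suc_Suc:
  "zonal_moment d (Suc j) (Suc j) = real (Suc j) * zonal_moment d j j / (d + 2 * real j)"
  by (simp add: zonal_moment_eq_0 algebra_simps)

text \<open>Integration by parts removes one factor \<open>x \<bullet> y\<close> and differentiates \<open>(x \<bullet> y)\<^sup>k P\<close> in the direction
  \<open>x\<close>. The derivative \<open>\<partial>\<^sub>x P\<close> is again harmonic, of degree \<open>j - 1\<close>, and Euler's identity gives
  \<open>(\<partial>\<^sub>x P)(x) = j P(x)\<close>, so the induction closes with a constant independent of \<open>P\<close>.\<close>

lemma integral_inner_power_solid_harmonic:
  fixes P :: "'a::euclidean_space \<Rightarrow> real"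
  assumes "solid_harmonic j P" and d: "DIM('a) \<ge> 2" and x: "norm x = 1"
  shows "(LINT y|sphere_measure. (x \<bullet> y) ^ l * P y) = zonal_moment (real DIM('a)) l j * P x"
  using assms(1)
proof (induction l arbitrary: j P rule: less_induct)
  case (less l)
  note P = solid_harmonicD[OF less.prems]
  interpret S: prob_space "sphere_measure :: 'a measure" by (rule prob_space_sphere_measure)
  show ?case
  proof (cases l)
    case 0
    show ?thesis
    proof (cases "j = 0")
      case True
      have const: "P y = P x" for y
      proof -
        have "P (0 *\<^sub>R y) = 0 ^ j * P y" "P (0 *\<^sub>R x) = 0 ^ j * P x"
          using P(2) unfolding homogeneous_def by blast+
        with True show ?thesis by simp
      qed
      have "(LINT y|sphere_measure. P y) = (LINT y|(sphere_measure :: 'a measure). P x)"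
        by (rule Bochner_Integration.integral_cong[OF refl const])
      then have "(LINT y|sphere_measure. P y) = P x"
        using S.prob_space by simp
      with 0 True show ?thesis by simp
    next
      case False
      with 0 integral_solid_harmonic_eq_0[OF less.prems _ d] show ?thesis by simp
    qed
  next
    case (Suc k)
    let ?D = "dirderiv x P"
    define G where "G = (\<lambda>y. (x \<bullet> y) ^ k * P y)"
    have G: "real_polynomial_function G" "homogeneous (1 * k + j) G"
      unfolding G_def
      by (intro real_polynomial_function.intros(4) real_polynomial_function_power rpf_inner P
          homogeneous_mult homogeneous_power homogeneous_inner)+
    have DG: "dirderiv x G y = real k * ((x \<bullet> y) ^ (k - 1) * P y) + (x \<bullet> y) ^ k * ?D y" for y
      unfolding G_def using x
      by (subst dirderiv_mult) (auto intro!: real_polynomial_function_power rpf_inner P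
          simp: dirderiv_power[OF rpf_inner] norm_eq_1)
    have int: "integrable sphere_measure (\<lambda>y. (x \<bullet> y) ^ (k - 1) * P y)"
       "integrable sphere_measure (\<lambda>y. (x \<bullet> y) ^ k * ?D y)"
      by (intro integrable_sphere_rpf real_polynomial_function.intros(4) real_polynomial_function_power rpf_inner rpf_dirderiv P)+
    have "(real DIM('a) - 1 + real (1 * k + j)) * (LINT y|sphere_measure. (x \<bullet> y) * G y) = (LINT y|sphere_measure. dirderiv x G y)"
      by (rule integral_sphere_by_parts[OF G])
    also have "\<dots> = real k * (LINT y|sphere_measure. (x \<bullet> y) ^ (k - 1) * P y) + (LINT y|sphere_measure. (x \<bullet> y) ^ k * ?D y)"
      unfolding DG using int by simp
    also have "(LINT y|sphere_measure. (x \<bullet> y) ^ (k - 1) * P y) = zonal_moment (real DIM('a)) (k - 1) j * P x"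
      by (rule less.IH) (use Suc less.prems in auto)
    also have "(LINT y|sphere_measure. (x \<bullet> y) ^ k * ?D y) = zonal_moment (real DIM('a)) k (j - 1) * ?D x"
      by (rule less.IH) (use Suc less.prems solid_harmonic_dirderiv in auto)
    also have "?D x = real j * P x" by (rule dirderiv_self[OF P(1,2)])
    also have "(LINT y|sphere_measure. (x \<bullet> y) * G y) = (LINT y|sphere_measure. (x \<bullet> y) ^ l * P y)"
      by (simp add: G_def Suc mult.assoc)
    finally show ?thesis using d by (simp add: Suc field_simps)
  qed
qed

text \<open>Powers of \<open>x \<bullet> y\<close> below the degree of \<open>P\<close> integrate to zero against \<open>P\<close>, so only the leading term of
  \<open>((x \<bullet> y)\<^sup>2 - 1)\<^sup>s (x \<bullet> y)\<^sup>l\<close> counts.\<close>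

lemma integral_zonal_product:
  fixes P :: "'a::euclidean_space \<Rightarrow> real"
  assumes P: "solid_harmonic j P" and d: "DIM('a) \<ge> 2" and x: "norm x = 1"
  shows "2 * s + l \<le> j \<Longrightarrow> (LINT y|sphere_measure. ((x \<bullet> y)\<^sup>2 - 1) ^ s * (x \<bullet> y) ^ l * P y)
     = zonal_moment (real DIM('a)) (2 * s + l) j * P x"
proof (induction s arbitrary: l)
  case 0
  show ?case using integral_inner_power_solid_harmonic[OF P d x, of l] by simp
next
  case (Suc s)
  have int: "integrable sphere_measure (\<lambda>y. ((x \<bullet> y)\<^sup>2 - 1) ^ s * (x \<bullet> y) ^ l * P y)" for l
    by (intro integrable_sphere_rpf real_polynomial_function.intros(4) real_polynomial_function_power
      real_polynomial_function_diff rpf_inner real_polynomial_function.intros(2) solid_harmonicD[OF P])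
  have le: "2 * s + (l + 2) \<le> j" "2 * s + l \<le> j" using Suc.prems by auto
  have "(LINT y|sphere_measure. ((x \<bullet> y)\<^sup>2 - 1) ^ Suc s * (x \<bullet> y) ^ l * P y)
     = (LINT y|sphere_measure. ((x \<bullet> y)\<^sup>2 - 1) ^ s * (x \<bullet> y) ^ (l + 2) * P y - ((x \<bullet> y)\<^sup>2 - 1) ^ s * (x \<bullet> y) ^ l * P y)"
    by (intro Bochner_Integration.integral_cong) (auto simp: algebra_simps power2_eq_square)
  also have "\<dots> = (LINT y|sphere_measure. ((x \<bullet> y)\<^sup>2 - 1) ^ s * (x \<bullet> y) ^ (l + 2) * P y)
      - (LINT y|sphere_measure. ((x \<bullet> y)\<^sup>2 - 1) ^ s * (x \<bullet> y) ^ l * P y)"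
    by (intro Bochner_Integration.integral_diff int)
  also have "\<dots> = zonal_moment (real DIM('a)) (2 * s + (l + 2)) j * P x - zonal_moment (real DIM('a)) (2 * s + l) j * P x"
    by (simp only: Suc.IH[OF le(1)] Suc.IH[OF le(2)])
  also have "zonal_moment (real DIM('a)) (2 * s + l) j = 0"
    using Suc.prems by (intro zonal_moment_eq_0) auto
  finally show ?case
    by (simp only: mult_Suc_right add_ac mult_zero_left diff_zero)
qed

section \<open>Harmonic polynomials of Jacobi type\<close>

text \<open>The homogenization of the Jacobi polynomial of argument \<open>t\<close>, with \<open>p\<close> and \<open>q\<close> in place of
  \<open>(1 + t)/2\<close> and \<open>(1 - t)/2\<close>.\<close>

definition jacobi_form :: "real \<Rightarrow> real \<Rightarrow> nat \<Rightarrow> real \<Rightarrow> real \<Rightarrow> real" where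
  "jacobi_form \<alpha> \<beta> M p q =
     (\<Sum>s\<le>M. ((real M + \<alpha>) gchoose (M - s)) * ((real M + \<beta>) gchoose s) * (- q) ^ s * p ^ (M - s))"

lemma jacobi_eq_jacobi_form: "jacobi \<alpha> \<beta> M (2 * p - 1) = jacobi_form \<alpha> \<beta> M p (1 - p)"
  by (simp add: jacobi_def jacobi_form_def diff_divide_distrib add_divide_distrib)

lemma gbinomial_Suc_mult: "real (Suc k) * (a gchoose Suc k) = (a - real k) * (a gchoose k)"
  unfolding gbinomial_prod_rev fact_Suc prod.atLeast0_lessThan_Suc by (simp del: of_nat_Suc)

text \<open>The hypotheses hold for the squared norms \<open>p\<close> and \<open>q\<close> of the projections to two orthogonal
  complementary subspaces of dimensions \<open>m\<close> and \<open>k\<close>. The Laplacian then acts on \<open>q\<^sup>c p\<^sup>a\<close> as the sum of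
  the two radial Laplacians.\<close>

lemma laplace_power_product:
  fixes p q :: "'a::euclidean_space \<Rightarrow> real"
  assumes p: "real_polynomial_function p" and q: "real_polynomial_function q"
    and lp: "\<And>y. (\<Sum>b\<in>Basis. dirderiv b (dirderiv b p) y) = 2 * m"
    and lq: "\<And>y. (\<Sum>b\<in>Basis. dirderiv b (dirderiv b q) y) = 2 * k"
    and gp: "\<And>y. (\<Sum>b\<in>Basis. (dirderiv b p y)\<^sup>2) = 4 * p y"
    and gq: "\<And>y. (\<Sum>b\<in>Basis. (dirderiv b q y)\<^sup>2) = 4 * q y"
    and gpq: "\<And>y. (\<Sum>b\<in>Basis. dirderiv b p y * dirderiv b q y) = 0"
  shows "(\<Sum>b\<in>Basis. dirderiv b (dirderiv b (\<lambda>y. q y ^ c * p y ^ a)) y) =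
     4 * real a * (m / 2 + real a - 1) * q y ^ c * p y ^ (a - 1) + 4 * real c * (k / 2 + real c - 1) * q y ^ (c - 1) * p y ^ a"
proof -
  note rpf = real_polynomial_function.intros(2-4) real_polynomial_function_power rpf_dirderiv p q
  have 1: "dirderiv b (\<lambda>y. q y ^ c * p y ^ a) = (\<lambda>y. q y ^ c * (real a * p y ^ (a - 1) * dirderiv b p y)
       + (real c * q y ^ (c - 1) * dirderiv b q y) * p y ^ a)" for b
    by (rule ext, subst dirderiv_mult) (auto intro!: rpf simp: dirderiv_power p q)
  have 2: "dirderiv b (dirderiv b (\<lambda>y. q y ^ c * p y ^ a)) y =
      q y ^ c * real a * p y ^ (a - 1) * dirderiv b (dirderiv b p) y
    + q y ^ c * real a * real (a - 1) * p y ^ (a - 2) * (dirderiv b p y)\<^sup>2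
    + 2 * real a * real c * q y ^ (c - 1) * p y ^ (a - 1) * (dirderiv b p y * dirderiv b q y)
    + p y ^ a * real c * q y ^ (c - 1) * dirderiv b (dirderiv b q) y
    + p y ^ a * real c * real (c - 1) * q y ^ (c - 2) * (dirderiv b q y)\<^sup>2" for b
  proof -
    have "dirderiv b (\<lambda>y. real a * p y ^ (a - 1) * dirderiv b p y) y
       = real a * p y ^ (a - 1) * dirderiv b (dirderiv b p) y + real a * (real (a - 1) * p y ^ (a - 2) * dirderiv b p y) * dirderiv b p y"
      by (subst dirderiv_mult) (auto intro!: rpf simp: dirderiv_power[OF p] dirderiv_power[OF q]
          dirderiv_cmult[OF real_polynomial_function_power[OF p]] dirderiv_cmult[OF real_polynomial_function_power[OF q]] numeral_2_eq_2)
    moreover have "dirderiv b (\<lambda>y. real c * q y ^ (c - 1) * dirderiv b q y) y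
       = real c * q y ^ (c - 1) * dirderiv b (dirderiv b q) y + real c * (real (c - 1) * q y ^ (c - 2) * dirderiv b q y) * dirderiv b q y"
      by (subst dirderiv_mult) (auto intro!: rpf simp: dirderiv_power[OF p] dirderiv_power[OF q]
          dirderiv_cmult[OF real_polynomial_function_power[OF p]] dirderiv_cmult[OF real_polynomial_function_power[OF q]] numeral_2_eq_2)
    ultimately show ?thesis
      unfolding 1
      by (subst dirderiv_add)
         (auto intro!: rpf simp: dirderiv_mult dirderiv_power rpf power2_eq_square algebra_simps simp del: of_nat_diff)
  qed
  \<comment> \<open>The case distinction absorbs the truncated exponents for \<open>a = 0\<close> and \<open>a = 1\<close>.\<close>
  have red: "real a * real (a - 1) * t ^ (a - 2) * (4 * t) = 4 * real a * (real a - 1) * t ^ (a - 1)" for a and t :: real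
    by (cases a; cases "a - 1") (auto simp: numeral_2_eq_2)
  have "(\<Sum>b\<in>Basis. dirderiv b (dirderiv b (\<lambda>y. q y ^ c * p y ^ a)) y) =
      q y ^ c * real a * p y ^ (a - 1) * (2 * m)
    + q y ^ c * real a * real (a - 1) * p y ^ (a - 2) * (4 * p y)
    + 2 * real a * real c * q y ^ (c - 1) * p y ^ (a - 1) * 0
    + p y ^ a * real c * q y ^ (c - 1) * (2 * k)
    + p y ^ a * real c * real (c - 1) * q y ^ (c - 2) * (4 * q y)"
    unfolding 2 sum.distrib sum_distrib_left[symmetric] lp lq gp gq gpq ..
  also have "q y ^ c * real a * real (a - 1) * p y ^ (a - 2) * (4 * p y) = q y ^ c * (4 * real a * (real a - 1) * p y ^ (a - 1))"
    by (subst red[symmetric]) (simp only: mult_ac)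
  also have "p y ^ a * real c * real (c - 1) * q y ^ (c - 2) * (4 * q y) = p y ^ a * (4 * real c * (real c - 1) * q y ^ (c - 1))"
    by (subst red[symmetric]) (simp only: mult_ac)
  finally show ?thesis by (simp add: algebra_simps)
qed

text \<open>By the preceding formula harmonicity is a two-term recurrence for the coefficients of \<open>q\<^sup>s p\<^sup>M\<^sup>-\<^sup>s\<close>.
  The products of binomial coefficients in the Jacobi polynomial with parameters \<open>k/2 - 1\<close> and
  \<open>m/2 - 1\<close> satisfy it.\<close>

lemma solid_harmonic_jacobi_form:
  fixes p q :: "'a::euclidean_space \<Rightarrow> real"
  assumes p: "real_polynomial_function p" and q: "real_polynomial_function q"
    and hp: "homogeneous 2 p" and hq: "homogeneous 2 q"
    and lp: "\<And>y. (\<Sum>b\<in>Basis. dirderiv b (dirderiv b p) y) = 2 * m"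
    and lq: "\<And>y. (\<Sum>b\<in>Basis. dirderiv b (dirderiv b q) y) = 2 * k"
    and gp: "\<And>y. (\<Sum>b\<in>Basis. (dirderiv b p y)\<^sup>2) = 4 * p y"
    and gq: "\<And>y. (\<Sum>b\<in>Basis. (dirderiv b q y)\<^sup>2) = 4 * q y"
    and gpq: "\<And>y. (\<Sum>b\<in>Basis. dirderiv b p y * dirderiv b q y) = 0"
  shows "solid_harmonic (2 * M) (\<lambda>y. jacobi_form (k / 2 - 1) (m / 2 - 1) M (p y) (q y))"
proof -
  define \<alpha> where "\<alpha> = k / 2 - 1"
  define \<beta> where "\<beta> = m / 2 - 1"
  define c where "c = (\<lambda>s. ((real M + \<alpha>) gchoose (M - s)) * ((real M + \<beta>) gchoose s))"
  define H where "H = (\<lambda>y. \<Sum>s\<le>M. (-1) ^ s * c s * (q y ^ s * p y ^ (M - s)))"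
  have H: "jacobi_form (k / 2 - 1) (m / 2 - 1) M (p y) (q y) = H y" for y
    unfolding H_def jacobi_form_def c_def \<alpha>_def[symmetric] \<beta>_def[symmetric]
    by (intro sum.cong refl, subst power_minus) (simp add: mult_ac)
  note rpf = real_polynomial_function_power real_polynomial_function.intros(4) p q
  have rH: "real_polynomial_function H"
    unfolding H_def by (intro real_polynomial_function_sum rpf_cmult rpf) auto
  have hH: "homogeneous (2 * M) H"
    unfolding H_def
  proof (intro homogeneous_sum homogeneous_cmult)
    fix s assume "s \<in> {..M}"
    then have "2 * M = 2 * s + 2 * (M - s)" by auto
    then show "homogeneous (2 * M) (\<lambda>y. q y ^ s * p y ^ (M - s))"
      using homogeneous_mult[OF homogeneous_power[OF hq] homogeneous_power[OF hp]] by metis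
  qed
  have "(\<Sum>b\<in>Basis. dirderiv b (dirderiv b H) y) = 0" for y
  proof -
    have "dirderiv b (dirderiv b H) y = (\<Sum>s\<le>M. (-1) ^ s * c s * dirderiv b (dirderiv b (\<lambda>y. q y ^ s * p y ^ (M - s))) y)" for b
    proof -
      have "dirderiv b H = (\<lambda>y. \<Sum>s\<le>M. (-1) ^ s * c s * dirderiv b (\<lambda>y. q y ^ s * p y ^ (M - s)) y)"
        unfolding H_def by (rule ext, subst dirderiv_sum) (auto simp: dirderiv_cmult rpf intro!: rpf_cmult rpf)
      then show ?thesis
        by (simp only:, subst dirderiv_sum) (auto simp: dirderiv_cmult rpf rpf_dirderiv intro!: rpf_cmult rpf_dirderiv rpf)
    qed
    then have "(\<Sum>b\<in>Basis. dirderiv b (dirderiv b H) y) =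
       (\<Sum>s\<le>M. (-1) ^ s * c s * (\<Sum>b\<in>Basis. dirderiv b (dirderiv b (\<lambda>y. q y ^ s * p y ^ (M - s))) y))"
      by (simp add: sum_distrib_left) (rule sum.swap)
    also have "\<dots> = (\<Sum>s\<le>M. (-1) ^ s * c s * (4 * real (M - s) * (real (M - s) + \<beta>) * q y ^ s * p y ^ (M - s - 1)))
       + (\<Sum>s\<le>M. (-1) ^ s * c s * (4 * real s * (real s + \<alpha>) * q y ^ (s - 1) * p y ^ (M - s)))"
      unfolding laplace_power_product[OF p q lp lq gp gq gpq] \<alpha>_def \<beta>_def
      by (simp add: sum.distrib[symmetric] algebra_simps del: of_nat_diff)
    also have "(\<Sum>s\<le>M. (-1) ^ s * c s * (4 * real (M - s) * (real (M - s) + \<beta>) * q y ^ s * p y ^ (M - s - 1)))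
       = (\<Sum>s<M. (-1) ^ s * c s * (4 * real (M - s) * (real (M - s) + \<beta>) * q y ^ s * p y ^ (M - s - 1)))"
      by (simp add: lessThan_Suc_atMost[symmetric])
    also have "(\<Sum>s\<le>M. (-1) ^ s * c s * (4 * real s * (real s + \<alpha>) * q y ^ (s - 1) * p y ^ (M - s)))
       = (\<Sum>s<M. (-1) ^ Suc s * c (Suc s) * (4 * real (Suc s) * (real (Suc s) + \<alpha>) * q y ^ s * p y ^ (M - Suc s)))"
      by (subst sum.atMost_shift) simp
    also have "\<dots> = (\<Sum>s<M. - ((-1) ^ s * c s * (4 * real (M - s) * (real (M - s) + \<beta>) * q y ^ s * p y ^ (M - s - 1))))"
    proof (intro sum.cong refl)
      fix s assume "s \<in> {..<M}"
      then obtain r where M: "M = Suc (s + r)" by (auto dest: less_imp_Suc_add)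
      \<comment> \<open>The recurrence of the coefficients, from \<open>(k + 1) (a choose k + 1) = (a - k) (a choose k)\<close> in both factors.\<close>
      have "c s * real (M - s) * (real (M - s) + \<beta>)
         = (real (Suc r) * ((real M + \<alpha>) gchoose Suc r)) * ((real M + \<beta> - real s) * ((real M + \<beta>) gchoose s))"
        by (simp add: c_def M algebra_simps)
      also have "\<dots> = (real M + \<alpha> - real r) * ((real M + \<alpha>) gchoose r) * (real (Suc s) * ((real M + \<beta>) gchoose Suc s))"
        by (simp only: gbinomial_Suc_mult)
      also have "\<dots> = c (Suc s) * real (Suc s) * (real (Suc s) + \<alpha>)"
        by (simp add: c_def M algebra_simps)
      finally have *: "c (Suc s) * real (Suc s) * (real (Suc s) + \<alpha>) = c s * real (M - s) * (real (M - s) + \<beta>)" ..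
      have "(-1) ^ Suc s * c (Suc s) * (4 * real (Suc s) * (real (Suc s) + \<alpha>) * q y ^ s * p y ^ (M - Suc s))
        = - ((-1) ^ s * 4 * q y ^ s * p y ^ (M - Suc s) * (c (Suc s) * real (Suc s) * (real (Suc s) + \<alpha>)))"
        by simp
      also have "\<dots> = - ((-1) ^ s * c s * (4 * real (M - s) * (real (M - s) + \<beta>) * q y ^ s * p y ^ (M - s - 1)))"
        unfolding * by (simp only: mult_ac diff_diff_left Suc_eq_plus1)
      finally show "(-1) ^ Suc s * c (Suc s) * (4 * real (Suc s) * (real (Suc s) + \<alpha>) * q y ^ s * p y ^ (M - Suc s)) = \<dots>" .
    qed
    finally show ?thesis by (simp add: sum_negf)
  qed
  with rH hH show ?thesis unfolding solid_harmonic_def H by simp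
qed

text \<open>Frames are indexed families because they are used for the columns of a matrix; a single unit vector is
  the other instance.\<close>

definition orthonormal_on :: "'c set \<Rightarrow> ('c \<Rightarrow> 'a::euclidean_space) \<Rightarrow> bool" where
  "orthonormal_on I w \<longleftrightarrow> finite I \<and> (\<forall>c\<in>I. \<forall>c'\<in>I. w c \<bullet> w c' = (if c = c' then 1 else 0))"

text \<open>For an orthonormal family this is the squared norm of the orthogonal projection to its span.\<close>

definition sq_proj :: "'c set \<Rightarrow> ('c \<Rightarrow> 'a::euclidean_space) \<Rightarrow> 'a \<Rightarrow> real" where
  "sq_proj I w y = (\<Sum>c\<in>I. (w c \<bullet> y)\<^sup>2)"

lemma rpf_sq_proj: "finite I \<Longrightarrow> real_polynomial_function (sq_proj I w)"
  unfolding sq_proj_def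
  by (intro real_polynomial_function_sum real_polynomial_function_power rpf_inner)

lemma homogeneous_sq_proj: "homogeneous 2 (sq_proj I w)"
  unfolding sq_proj_def using homogeneous_power[OF homogeneous_inner, of 2]
  by (intro homogeneous_sum) simp

lemma rpf_inner_self: "real_polynomial_function (\<lambda>y::'a::euclidean_space. y \<bullet> y)"
  by (subst euclidean_inner)
     (intro real_polynomial_function_sum real_polynomial_function.intros(4) rpf_inner_left finite_Basis)

lemma homogeneous_inner_self: "homogeneous 2 (\<lambda>y::'a::real_inner. y \<bullet> y)"
  by (simp add: homogeneous_def power2_eq_square)

lemma dirderiv_inner_self: "dirderiv u (\<lambda>y::'a::euclidean_space. y \<bullet> y) y = 2 * (y \<bullet> u)"
  by (rule dirderiv_eq[of _ "\<lambda>u. 2 * (y \<bullet> u)"]) (auto intro!: derivative_eq_intros simp: inner_commute)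

lemma sum_Basis_square: "(\<Sum>b\<in>Basis. (z \<bullet> b)\<^sup>2) = z \<bullet> (z::'a::euclidean_space)"
  by (subst euclidean_inner) (simp add: power2_eq_square)

lemma dirderiv_sq_proj:
  assumes "finite I"
  shows "dirderiv u (sq_proj I w) y = 2 * ((\<Sum>c\<in>I. (w c \<bullet> y) *\<^sub>R w c) \<bullet> u)"
  unfolding sq_proj_def using assms
  by (subst dirderiv_sum)
     (auto simp: dirderiv_power[OF rpf_inner] inner_sum_left sum_distrib_left mult_ac
       intro!: real_polynomial_function_power rpf_inner)

lemma dirderiv2_sq_proj:
  assumes "finite I"
  shows "dirderiv u (dirderiv u (sq_proj I w)) y = 2 * (\<Sum>c\<in>I. (w c \<bullet> u)\<^sup>2)"
proof -
  have "dirderiv u (sq_proj I w) = (\<lambda>y. \<Sum>c\<in>I. 2 * (w c \<bullet> u) * (w c \<bullet> y))"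
    unfolding dirderiv_sq_proj[OF assms] by (rule ext) (simp add: inner_sum_left sum_distrib_left mult_ac)
  then have "dirderiv u (dirderiv u (sq_proj I w)) y = dirderiv u (\<lambda>y. \<Sum>c\<in>I. 2 * (w c \<bullet> u) * (w c \<bullet> y)) y"
    by (simp only:)
  also have "\<dots> = (\<Sum>c\<in>I. dirderiv u (\<lambda>y. 2 * (w c \<bullet> u) * (w c \<bullet> y)) y)"
    by (intro dirderiv_sum rpf_cmult rpf_inner)
  also have "\<dots> = (\<Sum>c\<in>I. 2 * (w c \<bullet> u) * (w c \<bullet> u))"
    by (simp only: dirderiv_cmult[OF rpf_inner] dirderiv_inner)
  finally show ?thesis by (simp add: sum_distrib_left power2_eq_square mult_ac)
qed

context
  fixes I :: "'c set" and w :: "'c \<Rightarrow> 'a::euclidean_space"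
  assumes on: "orthonormal_on I w"
begin

lemma orthonormal_on_finite: "finite I"
  using on by (simp add: orthonormal_on_def)

lemma inner_orthonormal_combination:
  "(\<Sum>c\<in>I. (w c \<bullet> y) *\<^sub>R w c) \<bullet> (\<Sum>c\<in>I. (w c \<bullet> y) *\<^sub>R w c) = sq_proj I w y"
proof -
  have "w c \<bullet> (\<Sum>c\<in>I. (w c \<bullet> y) *\<^sub>R w c) = w c \<bullet> y" if "c \<in> I" for c
  proof -
    have "w c \<bullet> (\<Sum>c\<in>I. (w c \<bullet> y) *\<^sub>R w c) = (\<Sum>c'\<in>I. if c' = c then w c' \<bullet> y else 0)"
      unfolding inner_sum_right using on that
      by (intro sum.cong) (auto simp: orthonormal_on_def)
    with orthonormal_on_finite that show ?thesis by simp
  qed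
  then show ?thesis by (subst inner_sum_left) (simp add: sq_proj_def power2_eq_square)
qed

lemma laplace_sq_proj: "(\<Sum>b\<in>Basis. dirderiv b (dirderiv b (sq_proj I w)) y) = 2 * real (card I)"
proof -
  have "(\<Sum>b\<in>Basis. dirderiv b (dirderiv b (sq_proj I w)) y) = 2 * (\<Sum>c\<in>I. \<Sum>b\<in>Basis. (w c \<bullet> b)\<^sup>2)"
    by (subst sum.swap) (simp add: dirderiv2_sq_proj[OF orthonormal_on_finite] sum_distrib_left)
  also have "(\<Sum>c\<in>I. \<Sum>b\<in>Basis. (w c \<bullet> b)\<^sup>2) = (\<Sum>c\<in>I. 1)"
    unfolding sum_Basis_square using on by (intro sum.cong) (auto simp: orthonormal_on_def)
  finally show ?thesis by simp
qed

lemma gradient_sq_proj: "(\<Sum>b\<in>Basis. (dirderiv b (sq_proj I w) y)\<^sup>2) = 4 * sq_proj I w y"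
  unfolding dirderiv_sq_proj[OF orthonormal_on_finite] power_mult_distrib sum_distrib_left[symmetric]
    sum_Basis_square inner_orthonormal_combination
  by simp

text \<open>The two subspaces are the span of the family and its orthogonal complement. For the columns of a
  Stiefel matrix \<open>v\<close>, the resulting polynomial restricts on the sphere to a multiple of \<open>R\<^sub>v\<close>.\<close>

lemma solid_harmonic_subspace:
  "solid_harmonic (2 * M) (\<lambda>y. jacobi_form ((real DIM('a) - real (card I)) / 2 - 1) (real (card I) / 2 - 1) M
     (sq_proj I w y) (y \<bullet> y - sq_proj I w y))"
proof (rule solid_harmonic_jacobi_form)
  note fin = orthonormal_on_finite
  show rp: "real_polynomial_function (sq_proj I w)" by (rule rpf_sq_proj[OF fin])
  show "real_polynomial_function (\<lambda>y. y \<bullet> y - sq_proj I w y)"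
    by (intro real_polynomial_function_diff rpf_inner_self rp)
  show "homogeneous 2 (sq_proj I w)" by (rule homogeneous_sq_proj)
  then show "homogeneous 2 (\<lambda>y. y \<bullet> y - sq_proj I w y)"
    using homogeneous_inner_self[where 'a='a] by (simp add: homogeneous_def algebra_simps)
  let ?z = "\<lambda>y. \<Sum>c\<in>I. (w c \<bullet> y) *\<^sub>R w c"
  have Dq: "dirderiv u (\<lambda>y. y \<bullet> y - sq_proj I w y) = (\<lambda>y. 2 * (u \<bullet> y) - dirderiv u (sq_proj I w) y)" for u
    by (rule ext, subst dirderiv_diff) (auto intro!: rpf_inner_self rp simp: dirderiv_inner_self inner_commute)
  have zy: "?z y \<bullet> y = sq_proj I w y" for y
    by (simp add: inner_sum_left sq_proj_def power2_eq_square)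
  fix y
  show "(\<Sum>b\<in>Basis. dirderiv b (dirderiv b (sq_proj I w)) y) = 2 * real (card I)"
    by (rule laplace_sq_proj)
  show "(\<Sum>b\<in>Basis. (dirderiv b (sq_proj I w) y)\<^sup>2) = 4 * sq_proj I w y"
    by (rule gradient_sq_proj)
  have "dirderiv b (dirderiv b (\<lambda>y. y \<bullet> y - sq_proj I w y)) y = 2 * (b \<bullet> b) - dirderiv b (dirderiv b (sq_proj I w)) y" for b
    unfolding Dq by (subst dirderiv_diff) (auto intro!: rpf_cmult rpf_inner rpf_dirderiv rp simp: dirderiv_cmult[OF rpf_inner])
  then have "(\<Sum>b\<in>Basis. dirderiv b (dirderiv b (\<lambda>y. y \<bullet> y - sq_proj I w y)) y) =
     (\<Sum>b\<in>(Basis::'a set). 2 * (b \<bullet> b)) - 2 * real (card I)"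
    by (simp only: sum_subtractf laplace_sq_proj)
  also have "(\<Sum>b\<in>(Basis::'a set). 2 * (b \<bullet> b)) = (\<Sum>b\<in>(Basis::'a set). 2)"
    by (intro sum.cong) (auto simp: inner_same_Basis)
  finally show "(\<Sum>b\<in>Basis. dirderiv b (dirderiv b (\<lambda>y. y \<bullet> y - sq_proj I w y)) y) = 2 * (real DIM('a) - real (card I))"
    by simp
  have Dq': "dirderiv u (\<lambda>y. y \<bullet> y - sq_proj I w y) y = 2 * ((y - ?z y) \<bullet> u)" for u
    unfolding Dq dirderiv_sq_proj[OF fin] by (simp only: inner_diff_left inner_commute[of u y] right_diff_distrib)
  have "(\<Sum>b\<in>Basis. (dirderiv b (\<lambda>y. y \<bullet> y - sq_proj I w y) y)\<^sup>2) = 4 * ((y - ?z y) \<bullet> (y - ?z y))"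
    unfolding Dq' power_mult_distrib sum_distrib_left[symmetric] sum_Basis_square by simp
  also have "(y - ?z y) \<bullet> (y - ?z y) = y \<bullet> y - 2 * (?z y \<bullet> y) + ?z y \<bullet> ?z y"
    by (simp only: inner_diff_left inner_diff_right inner_commute[of y "?z y"])
  also have "\<dots> = y \<bullet> y - sq_proj I w y"
    unfolding zy inner_orthonormal_combination by simp
  finally show "(\<Sum>b\<in>Basis. (dirderiv b (\<lambda>y. y \<bullet> y - sq_proj I w y) y)\<^sup>2) = 4 * (y \<bullet> y - sq_proj I w y)" .
  have "(\<Sum>b\<in>Basis. dirderiv b (sq_proj I w) y * dirderiv b (\<lambda>y. y \<bullet> y - sq_proj I w y) y)
     = 4 * (\<Sum>b\<in>Basis. (?z y \<bullet> b) * ((y - ?z y) \<bullet> b))"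
    unfolding Dq' dirderiv_sq_proj[OF fin] by (simp add: sum_distrib_left mult_ac)
  also have "\<dots> = 4 * (?z y \<bullet> (y - ?z y))"
    by (subst (3) euclidean_inner) (rule refl)
  also have "?z y \<bullet> (y - ?z y) = 0"
    unfolding inner_diff_right zy inner_orthonormal_combination by simp
  finally show "(\<Sum>b\<in>Basis. dirderiv b (sq_proj I w) y * dirderiv b (\<lambda>y. y \<bullet> y - sq_proj I w y) y) = 0"
    by simp
qed

end

section \<open>Zonal harmonics and their normalization\<close>

text \<open>The case of a one-dimensional subspace, spanned by \<open>x\<close>. On the sphere this is a multiple of the Gegenbauer
  polynomial of degree \<open>2M\<close> in \<open>x \<bullet> y\<close>, by the quadratic transformation to Jacobi polynomials.\<close>

definition zonal_harmonic :: "'a::euclidean_space \<Rightarrow> nat \<Rightarrow> 'a \<Rightarrow> real" where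
  "zonal_harmonic x M y =
     jacobi_form ((real DIM('a) - 1) / 2 - 1) (- 1 / 2) M ((x \<bullet> y)\<^sup>2) (y \<bullet> y - (x \<bullet> y)\<^sup>2)"

lemma solid_harmonic_zonal_harmonic:
  assumes "norm x = 1"
  shows "solid_harmonic (2 * M) (zonal_harmonic x M)"
proof -
  have "orthonormal_on {()} (\<lambda>_. x)" using assms by (simp add: orthonormal_on_def norm_eq_1)
  from solid_harmonic_subspace[OF this, of M] show ?thesis
    unfolding zonal_harmonic_def sq_proj_def by simp
qed

lemma zonal_harmonic_self:
  fixes x :: "'a::euclidean_space"
  assumes "norm x = 1"
  shows "zonal_harmonic x M x = (real M + ((real DIM('a) - 1) / 2 - 1)) gchoose M"
proof -
  have "x \<bullet> x = 1" using assms by (simp add: norm_eq_1)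
  then show ?thesis
    unfolding zonal_harmonic_def jacobi_form_def
    by (subst sum.remove[of _ 0]) (auto intro!: sum.neutral)
qed

text \<open>On the sphere \<open>zonal_harmonic x M\<close> is a combination of the products
  \<open>((x \<bullet> y)\<^sup>2 - 1)^s (x \<bullet> y)^(2(M - s))\<close>, all of degree \<open>2M\<close>. Each pairs with \<open>P\<close> as \<open>(x \<bullet> y)^(2M)\<close> does, so the coefficients simply add up, by Vandermonde's convolution.\<close>

lemma integral_zonal_harmonic:
  fixes P :: "'a::euclidean_space \<Rightarrow> real"
  assumes P: "solid_harmonic (2 * M) P" and d: "DIM('a) \<ge> 2" and x: "norm x = 1"
  shows "(LINT y|sphere_measure. P y * zonal_harmonic x M y) =
    ((2 * real M + (real DIM('a) - 4) / 2) gchoose M) * zonal_moment (real DIM('a)) (2 * M) (2 * M) * P x"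
proof -
  define \<alpha> where "\<alpha> = (real DIM('a) - 1) / 2 - 1"
  define \<beta> :: real where "\<beta> = - 1 / 2"
  define c where "c = (\<lambda>s. ((real M + \<alpha>) gchoose (M - s)) * ((real M + \<beta>) gchoose s))"
  have int: "integrable sphere_measure (\<lambda>y. ((x \<bullet> y)\<^sup>2 - 1) ^ s * (x \<bullet> y) ^ l * P y)" for s l
    by (intro integrable_sphere_rpf real_polynomial_function.intros(4) real_polynomial_function_power
      real_polynomial_function_diff rpf_inner real_polynomial_function.intros(2) solid_harmonicD[OF P])
  have "P y * zonal_harmonic x M y = (\<Sum>s\<le>M. c s * (((x \<bullet> y)\<^sup>2 - 1) ^ s * (x \<bullet> y) ^ (2 * (M - s)) * P y))"
    if "y \<in> sphere 0 1" for y
  proof -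
    have "y \<bullet> y = 1" using that by (simp add: norm_eq_1)
    then show ?thesis
      unfolding zonal_harmonic_def jacobi_form_def \<alpha>_def[symmetric] \<beta>_def[symmetric] sum_distrib_left power_mult
      by (intro sum.cong) (auto simp: c_def mult_ac)
  qed
  then have "(LINT y|sphere_measure. P y * zonal_harmonic x M y) =
      (LINT y|sphere_measure. (\<Sum>s\<le>M. c s * (((x \<bullet> y)\<^sup>2 - 1) ^ s * (x \<bullet> y) ^ (2 * (M - s)) * P y)))"
    by (intro Bochner_Integration.integral_cong) (auto simp: space_sphere_measure)
  also have "\<dots> = (\<Sum>s\<le>M. c s * (LINT y|sphere_measure. ((x \<bullet> y)\<^sup>2 - 1) ^ s * (x \<bullet> y) ^ (2 * (M - s)) * P y))"
    by (subst Bochner_Integration.integral_sum) (auto intro!: integrable_mult_right int)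
  also have "\<dots> = (\<Sum>s\<le>M. c s * (zonal_moment (real DIM('a)) (2 * M) (2 * M) * P x))"
  proof (intro sum.cong refl)
    fix s assume "s \<in> {..M}"
    then have "2 * s + 2 * (M - s) = 2 * M" by auto
    then show "c s * (LINT y|sphere_measure. ((x \<bullet> y)\<^sup>2 - 1) ^ s * (x \<bullet> y) ^ (2 * (M - s)) * P y)
        = c s * (zonal_moment (real DIM('a)) (2 * M) (2 * M) * P x)"
      using integral_zonal_product[OF P d x, of s "2 * (M - s)"] by simp
  qed
  also have "\<dots> = (\<Sum>s\<le>M. c s) * (zonal_moment (real DIM('a)) (2 * M) (2 * M) * P x)"
    by (simp add: sum_distrib_right)
  also have "(\<Sum>s\<le>M. c s) = (real M + \<beta> + (real M + \<alpha>)) gchoose M"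
    using gbinomial_Vandermonde[of "real M + \<beta>" "real M + \<alpha>" M]
    by (simp add: c_def atMost_atLeast0 mult.commute)
  also have "real M + \<beta> + (real M + \<alpha>) = 2 * real M + (real DIM('a) - 4) / 2"
    by (simp add: \<alpha>_def \<beta>_def field_simps)
  finally show ?thesis by simp
qed

text \<open>The next three lemmas are the recurrences of the two binomial coefficients and of the dimension in
  \<open>zonal_normalization\<close>.\<close>

lemma gbinomial_double_step:
  fixes e :: real
  assumes "real M + e + 1 \<noteq> 0"
  shows "real (Suc M) * (real M + e + 1) * ((2 * real (Suc M) + e) gchoose Suc M)
     = (2 * real M + e + 1) * (2 * real M + e + 2) * ((2 * real M + e) gchoose M)"
proof -
  define z where "z = real M + e + 1"
  have 1: "(2 * real M + e) gchoose M = pochhammer z M / fact M"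
    by (simp add: gbinomial_pochhammer' z_def)
  have 2: "(2 * real (Suc M) + e) gchoose Suc M = pochhammer (z + 1) (Suc M) / fact (Suc M)"
    by (simp add: gbinomial_pochhammer' z_def algebra_simps)
  have "z * pochhammer (z + 1) (Suc M) = pochhammer z (Suc (Suc M))"
    by (simp only: pochhammer_rec)
  also have "\<dots> = pochhammer z M * ((z + real M) * (z + real M + 1))"
    by (simp add: pochhammer_Suc add_ac mult_ac)
  finally have *: "z * pochhammer (z + 1) (Suc M) = pochhammer z M * ((z + real M) * (z + real M + 1))" .
  have eq: "(z + real M) * (z + real M + 1) = (2 * real M + e + 1) * (2 * real M + e + 2)"
    by (simp add: z_def algebra_simps)
  have "real (Suc M) * z * ((2 * real (Suc M) + e) gchoose Suc M) = (z * pochhammer (z + 1) (Suc M)) / fact M"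
    unfolding 2 fact_Suc by (simp del: of_nat_Suc pochhammer_Suc)
  also have "\<dots> = (2 * real M + e + 1) * (2 * real M + e + 2) * ((2 * real M + e) gchoose M)"
    unfolding * eq 1 by (simp only: times_divide_eq_right times_divide_eq_left mult_ac)
  finally show ?thesis by (simp add: z_def)
qed

lemma gbinomial_step:
  fixes a :: real
  shows "real (Suc M) * ((real (Suc M) + a) gchoose Suc M) = (real (Suc M) + a) * ((real M + a) gchoose M)"
proof -
  have "real (Suc M) + a - 1 = real M + a" by simp
  then show ?thesis
    using gbinomial_absorption[of M "real (Suc M) + a"] by (simp only:)
qed

lemma harmonic_dim_step:
  assumes n: "n \<ge> 2"
  shows "(real n + 2 * real j - 1) * (real j + 2) * (real j + 1) * harmonic_dim n (j + 2)
     = (real n + 2 * real j + 3) * (real n + real j) * (real n + real j - 1) * harmonic_dim n j"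
proof -
  let ?g = "Gamma (real n + real j - 1)"
  have g0: "real n + real j - 1 > 0" using n by linarith
  have nonpos: "real n + real j - 1 \<notin> \<int>\<^sub>\<le>\<^sub>0" using g0 by (auto elim!: nonpos_Ints_cases)
  have Ga: "Gamma (real n + real j) = (real n + real j - 1) * ?g"
    using Gamma_plus1[of "real n + real j - 1"] nonpos by simp
  have "Gamma (real n + real j + 1) = (real n + real j) * Gamma (real n + real j)"
    by (rule Gamma_plus1) (use g0 in \<open>auto elim!: nonpos_Ints_cases\<close>)
  moreover have "real n + real (j + 2) - 1 = real n + real j + 1" by simp
  ultimately have G1: "Gamma (real n + real (j + 2) - 1) = (real n + real j) * ((real n + real j - 1) * ?g)"
    unfolding Ga by (simp only:)
  have G2: "Gamma (real (j + 2) + 1) = (real j + 2) * (real j + 1) * Gamma (real j + 1)"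
    using Gamma_fact[of "j + 2", where 'a = real] Gamma_fact[of j, where 'a = real]
    by (simp add: algebra_simps)
  have num: "real n + 2 * real (j + 2) - 1 = real n + 2 * real j + 3" by simp
  define G H p1 p2 p3 p4 p5 p6
    where "G = Gamma (real j + 1)" and "H = Gamma (real n)" and "p1 = real n + 2 * real j - 1"
    and "p2 = real j + 2" and "p3 = real j + 1" and "p4 = real n + 2 * real j + 3"
    and "p5 = real n + real j" and "p6 = real n + real j - 1"
  note defs = this
  have "G \<noteq> 0" "H \<noteq> 0" "p2 \<noteq> 0" "p3 \<noteq> 0"
    using n by (auto simp: defs Gamma_eq_zero_iff elim!: nonpos_Ints_cases)
  then show ?thesis
    unfolding harmonic_dim_def G1 G2 num defs[symmetric]
    by (simp add: divide_simps)
qed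

text \<open>In dimension \<open>n + 1\<close> this says that the constant of \<open>integral_zonal_harmonic\<close>, multiplied by
  \<open>harmonic_dim n (2 * M)\<close>, is the value of the zonal harmonic at its pole. It is the classical fact that the zonal
  harmonic with value one at the pole has squared norm one over the dimension. Both sides satisfy the same
  first-order recurrence in \<open>M\<close>.\<close>

lemma zonal_normalization:
  assumes n: "n \<ge> 2"
  shows "((2 * real M + (real n - 3) / 2) gchoose M) * zonal_moment (real n + 1) (2 * M) (2 * M) * harmonic_dim n (2 * M)
     = (real M + (real n / 2 - 1)) gchoose M"
proof (induction M)
  case 0
  have "real n - 1 \<notin> \<int>\<^sub>\<le>\<^sub>0" using n by (auto elim!: nonpos_Ints_cases)
  then have "Gamma (real n) = (real n - 1) * Gamma (real n - 1)"
    using Gamma_plus1[of "real n - 1"] by simp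
  moreover have "real n - 1 > 0" using n by linarith
  then have "Gamma (real n - 1) \<noteq> 0" by (metis Gamma_real_pos less_irrefl)
  ultimately have "harmonic_dim n 0 = 1"
    using n by (simp add: harmonic_dim_def)
  then show ?case by simp
next
  case (Suc M)
  define e where "e = (real n - 3) / 2"
  define C where "C = ((2 * real M + e) gchoose M)"
  define C' where "C' = ((2 * real (Suc M) + e) gchoose Suc M)"
  define B where "B = ((real M + (real n / 2 - 1)) gchoose M)"
  define B' where "B' = ((real (Suc M) + (real n / 2 - 1)) gchoose Suc M)"
  define A where "A = zonal_moment (real n + 1) (2 * M) (2 * M)"
  define A' where "A' = zonal_moment (real n + 1) (2 * Suc M) (2 * Suc M)"
  define D where "D = harmonic_dim n (2 * M)"
  define D' where "D' = harmonic_dim n (2 * Suc M)"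
  define r where "r = real M"
  define s where "s = real n"
  have s: "s \<ge> 2" and r: "r \<ge> 0" using n by (auto simp: s_def r_def)
  have "real M + e + 1 > 0" using s r unfolding e_def s_def r_def by (simp add: field_simps)
  then have nz: "real M + e + 1 \<noteq> 0" by simp
  have c: "(r + 1) * (r + e + 1) * C' = (2 * r + e + 1) * (2 * r + e + 2) * C"
    using gbinomial_double_step[OF nz] unfolding C_def C'_def e_def s_def r_def by (simp add: add_ac)
  have b: "(r + 1) * B' = (r + s / 2) * B"
    using gbinomial_step[of M "real n / 2 - 1"] unfolding B_def B'_def s_def r_def by (simp add: algebra_simps)
  have a: "A' = (2 * r + 2) * ((2 * r + 1) * A / (s + 1 + 4 * r)) / (s + 3 + 4 * r)"
  proof -
    have "2 * Suc M = Suc (Suc (2 * M))" by simp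
    then show ?thesis
      unfolding A'_def A_def by (simp only: zonal_moment_Suc_Suc) (simp add: r_def s_def algebra_simps)
  qed
  have d: "(s + 4 * r - 1) * (2 * r + 2) * (2 * r + 1) * D' = (s + 4 * r + 3) * (s + 2 * r) * (s + 2 * r - 1) * D"
    using harmonic_dim_step[OF n, of "2 * M"] unfolding D_def D'_def s_def r_def by (simp add: algebra_simps)
  have IH: "C * A * D = B" using Suc.IH unfolding C_def A_def D_def B_def e_def .
  \<comment> \<open>The linear factors are abbreviated so that all cancellations are monomial.\<close>
  define p1 p2 p3 p4 p5 p6 p7 where "p1 = r + 1" and "p2 = s + 2 * r - 1" and "p3 = s + 4 * r - 1"
    and "p4 = s + 4 * r + 1" and "p5 = s + 4 * r + 3" and "p6 = 2 * r + 1" and "p7 = s + 2 * r"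
  note defs = this
  have pos: "p1 > 0" "p2 > 0" "p3 > 0" "p4 > 0" "p5 > 0" "p6 > 0"
    using s r by (auto simp: defs)
  have e: "r + e + 1 = p2 / 2" "2 * r + e + 1 = p3 / 2" "2 * r + e + 2 = p4 / 2"
    by (simp_all add: e_def defs s_def[symmetric] field_simps)
  have C: "C' = p3 * p4 * C / (2 * p1 * p2)"
    using c pos unfolding e by (simp add: defs(1)[symmetric] divide_simps mult_ac)
  have "s + 1 + 4 * r = p4" "s + 3 + 4 * r = p5" "2 * r + 2 = 2 * p1" "2 * r + 1 = p6"
    by (simp_all add: defs)
  then have A: "A' = 2 * p1 * (p6 * A / p4) / p5"
    using a by (simp only:)
  have "s + 4 * r - 1 = p3" "2 * r + 2 = 2 * p1" "2 * r + 1 = p6" "s + 4 * r + 3 = p5" "s + 2 * r = p7" "s + 2 * r - 1 = p2"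
    by (simp_all add: defs)
  then have "p3 * (2 * p1) * p6 * D' = p5 * p7 * p2 * D"
    using d by (simp only:)
  then have D: "D' = p5 * p7 * p2 * D / (p3 * (2 * p1) * p6)"
    using pos by (simp add: divide_simps mult_ac)
  have "r + s / 2 = p7 / 2" by (simp add: defs)
  then have B: "B' = p7 / (2 * p1) * B"
    using b pos by (simp add: defs(1)[symmetric] divide_simps mult_ac)
  have "C' * A' * D' = p7 / (2 * p1) * (C * A * D)"
    unfolding A C D using pos by simp
  also have "\<dots> = B'"
    unfolding IH B ..
  finally show ?case unfolding C'_def A'_def D'_def B'_def e_def .
qed

section \<open>Pairing with functions of one inner product\<close>

text \<open>By Weierstrass, \<open>k\<close> is a uniform limit of polynomials on \<open>[-1,1]\<close>.\<close>

lemma integral_zonal_kernel_eq_0: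
  fixes q :: "'a::euclidean_space \<Rightarrow> real"
  assumes q: "continuous_on UNIV q" and x: "norm x = 1"
    and mom: "\<And>l. (LINT y|sphere_measure. q y * (x \<bullet> y) ^ l) = 0"
    and k: "continuous_on {-1..1} k"
  shows "(LINT y|sphere_measure. q y * k (x \<bullet> y)) = (0::real)"
proof -
  interpret S: prob_space "sphere_measure :: 'a measure" by (rule prob_space_sphere_measure)
  obtain B' where B': "B' > 0" "\<And>y. y \<in> sphere 0 1 \<Longrightarrow> \<bar>q y\<bar> \<le> B'"
    using continuous_bounded_on_sphere[OF continuous_on_subset[OF q subset_UNIV]] real_norm_def by metis
  have rng: "x \<bullet> y \<in> {-1..1}" if "y \<in> sphere 0 1" for y
    using Cauchy_Schwarz_ineq2[of x y] that x by auto
  have ck: "continuous_on (sphere 0 1) (\<lambda>y. k (x \<bullet> y))"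
    by (rule continuous_on_compose2[OF k]) (use rng in \<open>auto intro!: continuous_intros\<close>)
  have mk: "(\<lambda>y. k (x \<bullet> y)) \<in> borel_measurable sphere_measure"
    by (subst measurable_cong_sets[OF sets_sphere_measure refl])
       (rule borel_measurable_continuous_on_restrict[OF ck])
  have mq: "q \<in> borel_measurable sphere_measure"
    by (intro borel_measurable_sphere_measureI borel_measurable_continuous_onI q)
  obtain Bk where Bk: "\<And>y. y \<in> sphere 0 1 \<Longrightarrow> norm (k (x \<bullet> y)) \<le> Bk"
    using continuous_bounded_on_sphere[OF ck] by metis
  have intk: "integrable sphere_measure (\<lambda>y. q y * k (x \<bullet> y))"
  proof (rule S.integrable_const_bound[of _ "B' * Bk"])
    show "AE y in sphere_measure. norm (q y * k (x \<bullet> y)) \<le> B' * Bk"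
      using B' Bk by (intro AE_I2) (auto simp: space_sphere_measure abs_mult intro!: mult_mono)
  qed (use mk mq in measurable)
  have "\<bar>LINT y|sphere_measure. q y * k (x \<bullet> y)\<bar> \<le> B' * e" if e: "e > 0" for e
  proof -
    obtain g where g: "real_polynomial_function g" "\<And>t. t \<in> {-1..1} \<Longrightarrow> \<bar>k t - g t\<bar> < e"
      using Stone_Weierstrass_real_polynomial_function[OF compact_Icc k e] by blast
    obtain c N where gs: "g = (\<lambda>t. \<Sum>i\<le>N. c i * t ^ i)"
      using g(1) by (auto simp: real_polynomial_function_iff_sum)
    have inti: "integrable sphere_measure (\<lambda>y. q y * (x \<bullet> y) ^ i)" for i
      by (intro integrable_sphere_measure_continuous continuous_intros q)
    have g_eq: "q y * g (x \<bullet> y) = (\<Sum>i\<le>N. c i * (q y * (x \<bullet> y) ^ i))" for y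
      by (simp add: gs sum_distrib_left mult_ac)
    have intg: "integrable sphere_measure (\<lambda>y. q y * g (x \<bullet> y))"
      unfolding g_eq by (intro Bochner_Integration.integrable_sum integrable_mult_right inti)
    have "(LINT y|sphere_measure. q y * g (x \<bullet> y)) = 0"
      unfolding g_eq by (subst Bochner_Integration.integral_sum) (auto intro!: integrable_mult_right inti simp: mom)
    then have "(LINT y|sphere_measure. q y * k (x \<bullet> y)) = (LINT y|sphere_measure. q y * k (x \<bullet> y) - q y * g (x \<bullet> y))"
      by (subst Bochner_Integration.integral_diff[OF intk intg]) simp
    also have "\<bar>\<dots>\<bar> \<le> (LINT y|sphere_measure. \<bar>q y * k (x \<bullet> y) - q y * g (x \<bullet> y)\<bar>)"
      by (rule integral_abs_bound)
    also have "\<dots> \<le> (LINT y|(sphere_measure :: 'a measure). B' * e)"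
    proof (rule integral_mono)
      show "integrable sphere_measure (\<lambda>y. \<bar>q y * k (x \<bullet> y) - q y * g (x \<bullet> y)\<bar>)"
        by (intro integrable_abs Bochner_Integration.integrable_diff intk intg)
      fix y :: 'a assume "y \<in> space sphere_measure"
      then have y: "y \<in> sphere 0 1" by (simp add: space_sphere_measure)
      have "\<bar>q y * k (x \<bullet> y) - q y * g (x \<bullet> y)\<bar> = \<bar>q y\<bar> * \<bar>k (x \<bullet> y) - g (x \<bullet> y)\<bar>"
        by (simp add: abs_mult[symmetric] right_diff_distrib)
      also have "\<dots> \<le> B' * e"
        using B'(2)[OF y] g(2)[OF rng[OF y]] B'(1) by (intro mult_mono) auto
      finally show "\<bar>q y * k (x \<bullet> y) - q y * g (x \<bullet> y)\<bar> \<le> B' * e" .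
    qed simp
    also have "\<dots> = B' * e" using S.prob_space by simp
    finally show ?thesis .
  qed
  \<comment> \<open>With this \<open>e\<close> the bound says that the integral is at most half of itself in absolute value.\<close>
  from this[of "\<bar>LINT y|sphere_measure. q y * k (x \<bullet> y)\<bar> / (2 * B')"] B'(1)
  show ?thesis by (cases "(LINT y|sphere_measure. q y * k (x \<bullet> y)) = 0") (auto simp: field_simps)
qed

section \<open>The law of the norm of a row vector\<close>

lemma orthonormal_on_columns:
  fixes v :: "real ^ 'm ^ 'd"
  assumes "v \<in> stiefel"
  shows "orthonormal_on UNIV (\<lambda>c. column c v)"
proof -
  have "column c v \<bullet> column c' v = (transpose v ** v) $ c $ c'" for c c'
    by (simp add: matrix_matrix_mult_def transpose_def column_def inner_vec_def)
  then show ?thesis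
    using assms by (auto simp: orthonormal_on_def stiefel_def mat_def)
qed

lemma norm_vector_matrix_sq:
  fixes v :: "real ^ 'm ^ 'd"
  shows "(norm (y v* v))\<^sup>2 = sq_proj UNIV (\<lambda>c. column c v) y"
  unfolding power2_norm_eq_inner inner_vec_def sq_proj_def vector_matrix_mult_def column_def
  by (simp add: power2_eq_square mult.commute)

text \<open>Bessel's inequality.\<close>

lemma sq_proj_le:
  assumes "orthonormal_on I w"
  shows "sq_proj I w y \<le> y \<bullet> y"
proof -
  let ?z = "\<Sum>c\<in>I. (w c \<bullet> y) *\<^sub>R w c"
  have "?z \<bullet> y = sq_proj I w y"
    by (simp add: inner_sum_left sq_proj_def power2_eq_square)
  moreover have "?z \<bullet> ?z = sq_proj I w y" by (rule inner_orthonormal_combination[OF assms])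
  moreover have "0 \<le> (y - ?z) \<bullet> (y - ?z)" by (rule inner_ge_zero)
  moreover have "(y - ?z) \<bullet> (y - ?z) = y \<bullet> y - 2 * (?z \<bullet> y) + ?z \<bullet> ?z"
    by (simp only: inner_diff_left inner_diff_right inner_commute[of y ?z])
  ultimately show ?thesis by linarith
qed

lemma norm_vector_matrix_le:
  fixes v :: "real ^ 'm ^ 'd"
  assumes "v \<in> stiefel"
  shows "norm (y v* v) \<le> norm y"
proof (rule power2_le_imp_le)
  show "(norm (y v* v))\<^sup>2 \<le> (norm y)\<^sup>2"
    unfolding norm_vector_matrix_sq power2_norm_eq_inner[of y]
    by (rule sq_proj_le[OF orthonormal_on_columns[OF assms]])
qed simp

text \<open>With \<open>p = sq_proj I w\<close>, integration by parts is applied to \<open>2 p\<^sup>i\<^sup>+\<^sup>1 = \<Sum>\<^sub>b y\<^sub>b (\<partial>\<^sub>b p) p\<^sup>i\<close>; it uses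
  \<open>\<Delta>p = 2 card I\<close> and \<open>|\<nabla>p|\<^sup>2 = 4 p\<close>.\<close>

lemma integral_sq_proj_power_Suc:
  fixes w :: "'c \<Rightarrow> 'a::euclidean_space"
  assumes on: "orthonormal_on I w"
  shows "(real DIM('a) + 2 * real i) * (LINT y|sphere_measure. sq_proj I w y ^ Suc i)
     = (real (card I) + 2 * real i) * (LINT y|sphere_measure. sq_proj I w y ^ i)"
proof -
  let ?p = "sq_proj I w"
  have rp: "real_polynomial_function ?p" by (rule rpf_sq_proj[OF orthonormal_on_finite[OF on]])
  define F where "F = (\<lambda>b y. dirderiv b ?p y * ?p y ^ i)"
  have F: "real_polynomial_function (F b)" for b
    unfolding F_def by (intro real_polynomial_function.intros(4) real_polynomial_function_power rpf_dirderiv rp)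
  have hF: "homogeneous (1 + 2 * i) (F b)" for b
    unfolding F_def
    using homogeneous_dirderiv[OF rp homogeneous_sq_proj, of b]
    by (intro homogeneous_mult homogeneous_power homogeneous_sq_proj) simp
  have int1: "integrable sphere_measure (\<lambda>y. (b \<bullet> y) * F b y)" and int2: "integrable sphere_measure (dirderiv b (F b))" for b
    by (intro integrable_sphere_rpf real_polynomial_function.intros(4) rpf_inner rpf_dirderiv F)+
  have e1: "(\<Sum>b\<in>Basis. (b \<bullet> y) * F b y) = 2 * ?p y ^ Suc i" for y
  proof -
    have "(\<Sum>b\<in>Basis. (b \<bullet> y) * F b y) = (\<Sum>b\<in>Basis. (y \<bullet> b) * dirderiv b ?p y) * ?p y ^ i"
      by (simp add: F_def sum_distrib_right sum_distrib_left inner_commute mult_ac)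
    also have "\<dots> = 2 * ?p y ^ Suc i"
      using dirderiv_eq_sum_Basis[OF rp, of y y] dirderiv_self[OF rp homogeneous_sq_proj, of y] by simp
    finally show ?thesis .
  qed
  have e2: "(\<Sum>b\<in>Basis. dirderiv b (F b) y) = (2 * real (card I) + 4 * real i) * ?p y ^ i" for y
  proof -
    have "dirderiv b (F b) y = ?p y ^ i * dirderiv b (dirderiv b ?p) y + real i * ?p y ^ (i - 1) * (dirderiv b ?p y)\<^sup>2" for b
      unfolding F_def
      by (subst dirderiv_mult)
         (auto intro!: real_polynomial_function_power rpf_dirderiv rp simp: dirderiv_power[OF rp] power2_eq_square)
    then have "(\<Sum>b\<in>Basis. dirderiv b (F b) y) = ?p y ^ i * (2 * real (card I)) + real i * ?p y ^ (i - 1) * (4 * ?p y)"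
      by (simp only: sum.distrib sum_distrib_left[symmetric] laplace_sq_proj[OF on] gradient_sq_proj[OF on])
    also have "real i * ?p y ^ (i - 1) * (4 * ?p y) = 4 * real i * ?p y ^ i"
      by (cases i) auto
    finally show ?thesis by (simp add: algebra_simps)
  qed
  have "(real DIM('a) - 1 + real (1 + 2 * i)) * (LINT y|sphere_measure. (\<Sum>b\<in>Basis. (b \<bullet> y) * F b y))
      = (\<Sum>b\<in>Basis. (real DIM('a) - 1 + real (1 + 2 * i)) * (LINT y|sphere_measure. (b \<bullet> y) * F b y))"
    by (subst Bochner_Integration.integral_sum) (auto simp: sum_distrib_left intro!: int1)
  also have "\<dots> = (\<Sum>b\<in>Basis. (LINT y|sphere_measure. dirderiv b (F b) y))"
    by (intro sum.cong refl integral_sphere_by_parts F hF)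
  also have "\<dots> = (LINT y|sphere_measure. (\<Sum>b\<in>Basis. dirderiv b (F b) y))"
    by (subst Bochner_Integration.integral_sum) (auto intro!: int2)
  finally show ?thesis
    unfolding e1 e2 integral_mult_right_zero by (simp add: algebra_simps del: power_Suc)
qed

lemma Beta_pos: "0 < a \<Longrightarrow> 0 < b \<Longrightarrow> 0 < Beta a (b::real)"
  by (auto simp: Beta_def intro!: divide_pos_pos mult_pos_pos Gamma_real_pos add_pos_pos)

lemma integral_sq_proj_power:
  fixes w :: "'c \<Rightarrow> 'a::euclidean_space"
  assumes on: "orthonormal_on I w" and m: "0 < card I" "card I < DIM('a)"
  shows "(LINT y|sphere_measure. sq_proj I w y ^ i)
    = Beta (real (card I) / 2 + real i) ((real DIM('a) - real (card I)) / 2)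
      / Beta (real (card I) / 2) ((real DIM('a) - real (card I)) / 2)"
proof (induction i)
  case 0
  interpret S: prob_space "sphere_measure :: 'a measure" by (rule prob_space_sphere_measure)
  have "Beta (real (card I) / 2) ((real DIM('a) - real (card I)) / 2) > 0"
    using m by (intro Beta_pos) auto
  then show ?case using S.prob_space by simp
next
  case (Suc i)
  let ?a = "real (card I) / 2" and ?b = "(real DIM('a) - real (card I)) / 2"
  have "?a + real i > 0" using m by simp
  then have "?a + real i \<notin> \<int>\<^sub>\<le>\<^sub>0" by (auto elim!: nonpos_Ints_cases)
  from Beta_plus1_left[OF this, of ?b]
  have B: "(?a + real i + ?b) * Beta (?a + real (Suc i)) ?b = (?a + real i) * Beta (?a + real i) ?b"
    by (simp add: add_ac)
  have d: "real DIM('a) + 2 * real i \<noteq> 0" using m by simp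
  have "(real DIM('a) + 2 * real i) * (LINT y|sphere_measure. sq_proj I w y ^ Suc i)
      = (real (card I) + 2 * real i) * (Beta (?a + real i) ?b / Beta ?a ?b)"
    unfolding integral_sq_proj_power_Suc[OF on] Suc.IH ..
  also have "real (card I) + 2 * real i = 2 * (?a + real i)" by simp
  also have "2 * (?a + real i) * (Beta (?a + real i) ?b / Beta ?a ?b) = 2 * ((?a + real i) * Beta (?a + real i) ?b) / Beta ?a ?b"
    by (simp only: mult.assoc times_divide_eq_right)
  also have "\<dots> = (real DIM('a) + 2 * real i) * (Beta (?a + real (Suc i)) ?b / Beta ?a ?b)"
  proof -
    have "real DIM('a) + 2 * real i = 2 * (?a + real i + ?b)" by (simp add: field_simps)
    then show ?thesis unfolding B[symmetric] by (simp only: mult.assoc times_divide_eq_right)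
  qed
  finally show ?case using d by (simp only: mult_cancel_left simp_thms)
qed

lemma space_stiefel_measure:
  "stiefel_measure \<mu> \<Longrightarrow> space \<mu> = (stiefel :: (real ^ 'm ^ 'd) set)"
  using sets_eq_imp_space_eq[of \<mu> "restrict_space borel stiefel"]
  by (simp add: stiefel_measure_def space_restrict_space)

lemma borel_measurable_stiefel_measureI:
  fixes \<mu> :: "(real ^ 'm ^ 'd) measure"
  assumes "stiefel_measure \<mu>" "f \<in> measurable borel N"
  shows "f \<in> measurable \<mu> N"
proof -
  have "sets \<mu> = sets (restrict_space borel stiefel)" using assms(1) by (simp add: stiefel_measure_def)
  then show ?thesis
    using measurable_restrict_space1[OF assms(2)] by (subst measurable_cong_sets[OF _ refl])
qed

lemma continuous_on_vector_matrix_norm: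
  "continuous_on UNIV (\<lambda>p::(real ^ 'd) \<times> (real ^ 'm ^ 'd). norm (fst p v* snd p))"
  unfolding norm_vec_def L2_set_def vector_matrix_mult_def
  by (simp, intro continuous_intros)

lemma measurable_vector_matrix_norm:
  fixes \<mu> :: "(real ^ 'm ^ 'd) measure"
  assumes \<mu>: "stiefel_measure \<mu>"
  shows "(\<lambda>p. norm (fst p v* snd p)) \<in> borel_measurable (sphere_measure \<Otimes>\<^sub>M \<mu>)"
proof -
  have id\<mu>: "(\<lambda>v. v) \<in> measurable \<mu> borel"
    by (rule borel_measurable_stiefel_measureI[OF \<mu>]) simp
  have id\<sigma>: "(\<lambda>y::real^'d. y) \<in> measurable sphere_measure borel"
    by (rule borel_measurable_sphere_measureI) simp
  have "(\<lambda>p. (fst p, snd p)) \<in> measurable (sphere_measure \<Otimes>\<^sub>M \<mu>) ((borel :: (real ^ 'd) measure) \<Otimes>\<^sub>M (borel :: (real ^ 'm ^ 'd) measure))"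
    using measurable_compose[OF measurable_fst id\<sigma>, of \<mu>] measurable_compose[OF measurable_snd id\<mu>, of "sphere_measure :: (real ^ 'd) measure"]
    by (intro measurable_Pair) simp_all
  then have "(\<lambda>p. (fst p, snd p)) \<in> measurable (sphere_measure \<Otimes>\<^sub>M \<mu>) (borel :: ((real ^ 'd) \<times> (real ^ 'm ^ 'd)) measure)"
    by (simp add: borel_prod)
  from measurable_compose[OF this borel_measurable_continuous_onI[OF continuous_on_vector_matrix_norm]]
  show ?thesis by simp
qed

lemma measurable_vector_matrix_norm_right:
  fixes \<mu> :: "(real ^ 'm ^ 'd) measure"
  assumes \<mu>: "stiefel_measure \<mu>"
  shows "(\<lambda>v. norm (y v* v)) \<in> borel_measurable \<mu>"
proof (intro borel_measurable_stiefel_measureI[OF \<mu>] borel_measurable_continuous_onI)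
  show "continuous_on UNIV (\<lambda>v::real ^ 'm ^ 'd. norm (y v* v))"
    using continuous_on_compose2[OF continuous_on_vector_matrix_norm, of UNIV "\<lambda>v. (y, v)"]
    by (simp add: continuous_on_Pair)
qed

lemma stiefel_mult_orthogonal:
  fixes v :: "real ^ 'm ^ 'd"
  assumes "v \<in> stiefel" "orthogonal_matrix A"
  shows "A ** v \<in> stiefel"
proof -
  have "transpose (A ** v) ** (A ** v) = transpose v ** ((transpose A ** A) ** v)"
    by (simp add: matrix_transpose_mul matrix_mul_assoc)
  then show ?thesis
    using assms by (simp add: stiefel_def orthogonal_matrix)
qed

lemma integral_stiefel_orthogonal:
  fixes \<mu> :: "(real ^ 'm ^ 'd) measure" and f :: "real ^ 'm ^ 'd \<Rightarrow> 'b::{banach, second_countable_topology}"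
  assumes \<mu>: "stiefel_measure \<mu>" and A: "orthogonal_matrix A" and f: "f \<in> borel_measurable \<mu>"
  shows "(LINT v|\<mu>. f (A ** v)) = (LINT v|\<mu>. f v)"
proof -
  have sets: "sets \<mu> = sets (restrict_space borel stiefel)" and inv: "distr \<mu> \<mu> (\<lambda>v. A ** v) = \<mu>"
    using \<mu> A by (auto simp: stiefel_measure_def)
  have "continuous_on UNIV (\<lambda>v::real ^ 'm ^ 'd. A ** v)"
    unfolding matrix_matrix_mult_def by (intro continuous_intros)
  then have "(\<lambda>v. A ** v) \<in> measurable \<mu> \<mu>"
    by (subst measurable_cong_sets[OF sets sets])
       (auto intro!: measurable_restrict_space3 borel_measurable_continuous_onI stiefel_mult_orthogonal A)
  then have "(LINT v|distr \<mu> \<mu> (\<lambda>v. A ** v). f v) = (LINT v|\<mu>. f (A ** v))"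
    using f by (intro integral_distr)
  then show ?thesis unfolding inv ..
qed

text \<open>Since \<open>(U x)\<^sup>T v = x\<^sup>T (U\<^sup>T v)\<close>, this is left invariance.\<close>

lemma integral_stiefel_norm_rotate:
  fixes \<mu> :: "(real ^ 'm ^ 'd) measure" and f :: "real \<Rightarrow> real \<Rightarrow> 'b::{banach, second_countable_topology}"
  assumes \<mu>: "stiefel_measure \<mu>" and U: "orthogonal_transformation U"
    and f: "(\<lambda>v. f (norm (x v* v)) (norm (y v* v))) \<in> borel_measurable \<mu>"
  shows "(LINT v|\<mu>. f (norm (U x v* v)) (norm (U y v* v))) = (LINT v|\<mu>. f (norm (x v* v)) (norm (y v* v)))"
proof -
  define A where "A = transpose (matrix U)"
  have A: "orthogonal_matrix A"
    using U by (simp add: A_def orthogonal_transformation_matrix)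
  have "U z v* v = z v* (A ** v)" for z and v :: "real ^ 'm ^ 'd"
  proof -
    have "U z = matrix U *v z"
      using orthogonal_transformation_linear[OF U] by (simp add: matrix_works)
    also have "\<dots> = z v* A" by (simp add: A_def)
    finally show ?thesis by (simp add: vector_matrix_mul_assoc)
  qed
  then show ?thesis using integral_stiefel_orthogonal[OF \<mu> A f] by simp
qed

text \<open>By invariance the integral over \<open>v\<close> does not depend on the unit vector \<open>x\<close>, so it may be averaged over
  the sphere. After exchanging the integrals, the inner one is a moment of \<open>sq_proj\<close> for the columns of
  \<open>v\<close>, and that value is the same for every \<open>v\<close>.\<close>

lemma integral_stiefel_norm_power:
  fixes \<mu> :: "(real ^ 'm ^ 'd) measure" and x :: "real ^ 'd"
  assumes \<mu>: "stiefel_measure \<mu>" and m: "CARD('m) < CARD('d)" and x: "norm x = 1"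
  shows "(LINT v|\<mu>. ((norm (x v* v))\<^sup>2) ^ i) = Beta (real CARD('m) / 2 + real i) ((real CARD('d) - real CARD('m)) / 2)
      / Beta (real CARD('m) / 2) ((real CARD('d) - real CARD('m)) / 2)" (is "_ = ?B")
proof -
  interpret S: prob_space "sphere_measure :: (real ^ 'd) measure" by (rule prob_space_sphere_measure)
  interpret M: prob_space \<mu> using \<mu> by (simp add: stiefel_measure_def)
  interpret P: pair_prob_space "sphere_measure :: (real ^ 'd) measure" \<mu> ..
  let ?f = "\<lambda>y v. ((norm (y v* v))\<^sup>2) ^ i"
  have bound: "?f y v \<le> 1" if "y \<in> sphere 0 1" "v \<in> stiefel" for y :: "real ^ 'd" and v :: "real ^ 'm ^ 'd"
    using norm_vector_matrix_le[OF that(2), of y] that(1) by (intro power_le_one) (auto simp: power_le_one)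
  have "(\<lambda>p. ?f (fst p) (snd p)) \<in> borel_measurable (sphere_measure \<Otimes>\<^sub>M \<mu>)"
    using measurable_vector_matrix_norm[OF \<mu>] by measurable
  then have int: "integrable (sphere_measure \<Otimes>\<^sub>M \<mu>) (case_prod ?f)"
    using bound
    by (intro P.integrable_const_bound[where B = 1] AE_I2)
       (auto simp: space_pair_measure space_sphere_measure space_stiefel_measure[OF \<mu>] case_prod_unfold)
  have "(LINT v|\<mu>. ?f x v) = (LINT y|(sphere_measure :: (real ^ 'd) measure). (LINT v|\<mu>. ?f x v))"
    using S.prob_space by simp
  also have "\<dots> = (LINT y|sphere_measure. (LINT v|\<mu>. ?f y v))"
  proof (rule Bochner_Integration.integral_cong[OF refl])
    fix y :: "real ^ 'd" assume "y \<in> space sphere_measure"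
    then have "norm x = norm y" using x by (simp add: space_sphere_measure)
    then obtain U where U: "orthogonal_transformation U" "U x = y" by (rule orthogonal_transformation_exists)
    show "(LINT v|\<mu>. ?f x v) = (LINT v|\<mu>. ?f y v)"
      using integral_stiefel_norm_rotate[OF \<mu> U(1), of "\<lambda>s t. (s\<^sup>2) ^ i" x x] measurable_vector_matrix_norm_right[OF \<mu>, of x]
      by (simp add: U(2))
  qed
  also have "\<dots> = (LINT v|\<mu>. (LINT y|sphere_measure. ?f y v))"
    by (rule P.Fubini_integral[OF int, symmetric])
  also have "\<dots> = (LINT v|\<mu>. ?B)"
  proof (rule Bochner_Integration.integral_cong[OF refl])
    fix v assume "v \<in> space \<mu>"
    then have "v \<in> stiefel" by (simp add: space_stiefel_measure[OF \<mu>])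
    from integral_sq_proj_power[OF orthonormal_on_columns[OF this], of i] m
    show "(LINT y|sphere_measure. ?f y v) = ?B"
      by (simp add: norm_vector_matrix_sq)
  qed
  also have "\<dots> = ?B" using M.prob_space by simp
  finally show ?thesis .
qed

text \<open>The characteristic functions agree: each is approximated by the same partial sum of moments with an
  error at most \<open>2 |t|\<^sup>n / n!\<close>.\<close>

lemma real_distribution_eqI_moments:
  assumes M: "real_distribution M" and N: "real_distribution N"
    and bM: "AE x in M. \<bar>x\<bar> \<le> 1" and bN: "AE x in N. \<bar>x\<bar> \<le> 1"
    and eq: "\<And>k. (LINT x|M. x ^ k) = (LINT x|N. x ^ k)"
  shows "M = N"
proof (rule Levy_uniqueness[OF M N], rule ext)
  fix t :: real
  have approx: "cmod (char L t - (\<Sum>k\<le>n. ((\<i> * t) ^ k / fact k) * (LINT x|L. x ^ k))) \<le> 2 * (\<bar>t\<bar> ^ n / fact n)"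
    if L: "real_distribution L" and b: "AE x in L. \<bar>x\<bar> \<le> 1" for L n
  proof -
    interpret L: real_distribution L by (rule L)
    have bk: "AE x in L. norm (x ^ k) \<le> 1" for k
      using b by eventually_elim (auto simp: power_abs intro: power_le_one)
    have int: "integrable L (\<lambda>x. x ^ k)" for k
      by (rule L.integrable_const_bound[OF bk]) simp
    have "(LINT x|L. \<bar>x\<bar> ^ n) \<le> (LINT x|L. 1)"
      using bk[of n] integrable_abs[OF int[of n]] by (intro integral_mono_AE) (auto simp: power_abs)
    then have "(LINT x|L. \<bar>x\<bar> ^ n) \<le> 1" using L.prob_space by simp
    then have "(2 * \<bar>t\<bar> ^ n / fact n) * (LINT x|L. \<bar>x\<bar> ^ n) \<le> (2 * \<bar>t\<bar> ^ n / fact n) * 1"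
      by (intro mult_left_mono) auto
    with L.char_approx1[of n t, OF int] show ?thesis by simp
  qed
  have "cmod (char M t - char N t) \<le> 4 * (\<bar>t\<bar> ^ n / fact n)" for n
  proof -
    let ?s = "\<Sum>k\<le>n. ((\<i> * t) ^ k / fact k) * (LINT x|N. x ^ k)"
    have "cmod (char M t - char N t) = cmod ((char M t - ?s) - (char N t - ?s))" by simp
    also have "\<dots> \<le> cmod (char M t - ?s) + cmod (char N t - ?s)" by (rule norm_triangle_ineq4)
    also have "\<dots> \<le> 2 * (\<bar>t\<bar> ^ n / fact n) + 2 * (\<bar>t\<bar> ^ n / fact n)"
      using approx[OF M bM, of n] approx[OF N bN, of n] unfolding eq by (rule add_mono)
    finally show ?thesis by simp
  qed
  moreover have "(\<lambda>n. 4 * (\<bar>t\<bar> ^ n / fact n)) \<longlonglongrightarrow> 4 * 0"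
    using summable_LIMSEQ_zero[OF summable_exp[of "\<bar>t\<bar>"]]
    by (intro tendsto_intros) (simp add: field_simps)
  ultimately have "cmod (char M t - char N t) \<le> 4 * 0"
    by (intro LIMSEQ_le_const) auto
  then show "char M t = char N t" by simp
qed

text \<open>The density of \<open>|x\<^sup>T v|\<close>: the square of a variable with this density is Beta distributed with parameters
  \<open>(n - k)/2\<close> and \<open>(k + 1)/2\<close>.\<close>

definition radial_density :: "nat \<Rightarrow> nat \<Rightarrow> real \<Rightarrow> real" where
  "radial_density n k \<tau> = 2 / Beta ((real n - real k) / 2) ((real k + 1) / 2) * stiefel_weight n k \<tau> * indicator {0..1} \<tau>"

lemma stiefel_weight_nonneg: "\<tau> \<in> {0..1} \<Longrightarrow> 0 \<le> stiefel_weight n k \<tau>"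
  by (simp add: stiefel_weight_def)

lemma borel_measurable_stiefel_weight [measurable]: "stiefel_weight n k \<in> borel_measurable borel"
  unfolding stiefel_weight_def by measurable

lemma borel_measurable_radial_density [measurable]: "radial_density n k \<in> borel_measurable borel"
  unfolding radial_density_def by measurable

lemma radial_density_nonneg: "k < n \<Longrightarrow> 0 \<le> radial_density n k \<tau>"
  unfolding radial_density_def
  by (auto simp: indicator_def stiefel_weight_nonneg intro!: mult_nonneg_nonneg divide_nonneg_nonneg less_imp_le[OF Beta_pos])

text \<open>The substitution \<open>t = \<tau>\<^sup>2\<close> in the Beta integral. The two integrands may differ at \<open>\<tau> = 0\<close>, where
  \<open>0 powr a = 0\<close> but \<open>0 ^ 0 = 1\<close>.\<close>

lemma nn_integral_radial_density_power:
  assumes kn: "k < n"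
  shows "(\<integral>\<^sup>+\<tau>. ennreal (radial_density n k \<tau> * (\<tau>\<^sup>2) ^ i) \<partial>lborel)
     = ennreal (Beta ((real n - real k) / 2 + real i) ((real k + 1) / 2) / Beta ((real n - real k) / 2) ((real k + 1) / 2))"
proof -
  define a where "a = (real n - real k) / 2 + real i"
  define b where "b = (real k + 1) / 2"
  define C where "C = 1 / Beta ((real n - real k) / 2) ((real k + 1) / 2)"
  have a: "a > 0" and b: "b > 0" using kn by (auto simp: a_def b_def add_pos_nonneg)
  have C: "C > 0" using kn by (auto simp: C_def intro!: Beta_pos)
  let ?f = "\<lambda>t. t powr (a - 1) * (1 - t) powr (b - 1)"
  have "(?f has_integral Beta a b) {0..1}" by (rule has_integral_Beta_real[OF a b])
  from nn_integral_has_integral_lebesgue[OF _ this] have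
    "ennreal (Beta a b) = (\<integral>\<^sup>+t. ennreal (?f t * indicator {0\<^sup>2..1\<^sup>2} t) \<partial>lborel)"
    by (simp add: mult_ac ennreal_mult' ennreal_indicator)
  also have "\<dots> = (\<integral>\<^sup>+\<tau>. ennreal (?f (\<tau>\<^sup>2) * (2 * \<tau>) * indicator {0..1} \<tau>) \<partial>lborel)"
    by (subst nn_integral_substitution[where g = "\<lambda>x. x ^ 2" and g' = "\<lambda>x. 2 * x"])
       (auto intro!: derivative_eq_intros continuous_intros simp: set_borel_measurable_def)
  finally have "ennreal C * ennreal (Beta a b) = ennreal C * \<dots>" by (simp only:)
  also have "\<dots> = (\<integral>\<^sup>+\<tau>. ennreal C * ennreal (?f (\<tau>\<^sup>2) * (2 * \<tau>) * indicator {0..1} \<tau>) \<partial>lborel)"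
    by (subst nn_integral_cmult) auto
  also have "\<dots> = (\<integral>\<^sup>+\<tau>. ennreal (radial_density n k \<tau> * (\<tau>\<^sup>2) ^ i) \<partial>lborel)"
  proof (intro nn_integral_cong_AE AE_I[of _ _ "{0}"])
    have "ennreal C * ennreal (?f (\<tau>\<^sup>2) * (2 * \<tau>) * indicator {0..1} \<tau>) = ennreal (radial_density n k \<tau> * (\<tau>\<^sup>2) ^ i)"
      if "\<tau> \<noteq> 0" for \<tau> :: real
    proof (cases "\<tau> \<in> {0..1}")
      case True
      with that have \<tau>: "\<tau> > 0" by simp
      obtain r where "n = Suc (k + r)" using kn by (auto dest: less_imp_Suc_add)
      then have expo: "2 * (a - 1) + 1 = real (n - k - 1 + 2 * i)" by (simp add: a_def field_simps)
      have "\<tau>\<^sup>2 powr (a - 1) * \<tau> = \<tau> powr (2 * (a - 1)) * \<tau> powr 1"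
        using \<tau> powr_powr[of \<tau> 2 "a - 1"] by (simp add: powr_numeral)
      also have "\<dots> = \<tau> powr real (n - k - 1 + 2 * i)"
        by (simp only: powr_add[symmetric] expo)
      also have "\<dots> = \<tau> ^ (n - k - 1 + 2 * i)" using \<tau> by (rule powr_realpow)
      also have "\<dots> = \<tau> ^ (n - k - 1) * (\<tau>\<^sup>2) ^ i" by (simp add: power_add power_mult)
      finally have p: "\<tau>\<^sup>2 powr (a - 1) * \<tau> = \<tau> ^ (n - k - 1) * (\<tau>\<^sup>2) ^ i" .
      have "b - 1 = (real k - 1) / 2" by (simp add: b_def field_simps)
      then have "?f (\<tau>\<^sup>2) = \<tau>\<^sup>2 powr (a - 1) * (1 - \<tau>\<^sup>2) powr ((real k - 1) / 2)" by (simp only:)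
      then have "C * (?f (\<tau>\<^sup>2) * (2 * \<tau>) * indicator {0..1} \<tau>) = 2 * C * (1 - \<tau>\<^sup>2) powr ((real k - 1) / 2) * (\<tau>\<^sup>2 powr (a - 1) * \<tau>)"
        using True by simp
      also have "\<dots> = radial_density n k \<tau> * (\<tau>\<^sup>2) ^ i"
        unfolding p using True by (simp add: radial_density_def stiefel_weight_def C_def mult_ac)
      finally show ?thesis using C by (simp add: ennreal_mult'[symmetric])
    qed (simp add: radial_density_def)
    then show "{\<tau> \<in> space lborel. ennreal C * ennreal (?f (\<tau>\<^sup>2) * (2 * \<tau>) * indicator {0..1} \<tau>) \<noteq> ennreal (radial_density n k \<tau> * (\<tau>\<^sup>2) ^ i)} \<subseteq> {0}"
      by auto
  qed auto
  finally show ?thesis using C unfolding a_def[symmetric] b_def[symmetric]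
    by (simp add: ennreal_mult'[symmetric] C_def b_def)
qed

text \<open>Only the even moments of \<open>|x\<^sup>T v|\<close> are available, so the moment criterion is applied to the squares;
  taking square roots afterwards loses nothing on \<open>[0,1]\<close>.\<close>

lemma distr_stiefel_norm:
  fixes \<mu> :: "(real ^ 'm ^ 'd) measure" and x :: "real ^ 'd"
  assumes \<mu>: "stiefel_measure \<mu>" and d: "CARD('d) = n + 1" and m: "CARD('m) = n - k" and kn: "k < n"
    and x: "norm x = 1"
  shows "distr \<mu> borel (\<lambda>v. norm (x v* v)) = density lborel (\<lambda>\<tau>. ennreal (radial_density n k \<tau>))"
proof -
  let ?L = "density lborel (\<lambda>\<tau>. ennreal (radial_density n k \<tau>))"
  let ?N = "\<lambda>v::real ^ 'm ^ 'd. norm (x v* v)"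
  interpret M: prob_space \<mu> using \<mu> by (simp add: stiefel_measure_def)
  note mN [measurable] = measurable_vector_matrix_norm_right[OF \<mu>, of x]
  have a: "real CARD('m) / 2 = (real n - real k) / 2" "(real CARD('d) - real CARD('m)) / 2 = (real k + 1) / 2"
    using kn d m by (auto simp: of_nat_diff)
  have "emeasure ?L UNIV = 1"
    using nn_integral_radial_density_power[OF kn, of 0] Beta_pos[of "(real n - real k) / 2" "(real k + 1) / 2"] kn
    by (subst emeasure_density) auto
  then interpret L: prob_space ?L by (intro prob_spaceI) simp
  have suppL: "AE \<tau> in ?L. \<tau> \<in> {0..1}"
    by (subst AE_density) (auto simp: radial_density_def indicator_def)
  have sq: "distr \<mu> borel (\<lambda>v. (?N v)\<^sup>2) = distr ?L borel (\<lambda>\<tau>. \<tau>\<^sup>2)"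
  proof (rule real_distribution_eqI_moments)
    show "real_distribution (distr \<mu> borel (\<lambda>v. (?N v)\<^sup>2))" by (rule M.real_distribution_distr) measurable
    show "real_distribution (distr ?L borel (\<lambda>\<tau>. \<tau>\<^sup>2))" by (rule L.real_distribution_distr) measurable
    show "AE t in distr \<mu> borel (\<lambda>v. (?N v)\<^sup>2). \<bar>t\<bar> \<le> 1"
      using norm_vector_matrix_le[of _ x] x
      by (subst AE_distr_iff) (auto simp: space_stiefel_measure[OF \<mu>] intro!: AE_I2 power_le_one)
    show "AE t in distr ?L borel (\<lambda>\<tau>. \<tau>\<^sup>2). \<bar>t\<bar> \<le> 1"
      using suppL by (subst AE_distr_iff) (auto simp: power_le_one elim: eventually_mono)
    fix i
    have "(LINT t|distr \<mu> borel (\<lambda>v. (?N v)\<^sup>2). t ^ i) = (LINT v|\<mu>. ((?N v)\<^sup>2) ^ i)"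
      by (subst integral_distr) auto
    also have "\<dots> = Beta ((real n - real k) / 2 + real i) ((real k + 1) / 2) / Beta ((real n - real k) / 2) ((real k + 1) / 2)"
      using integral_stiefel_norm_power[OF \<mu> _ x, of i] d m kn unfolding a by simp
    also have "\<dots> = (LINT \<tau>|lborel. radial_density n k \<tau> * (\<tau>\<^sup>2) ^ i)"
    proof -
      have "0 \<le> Beta ((real n - real k) / 2 + real i) ((real k + 1) / 2) / Beta ((real n - real k) / 2) ((real k + 1) / 2)"
        using kn by (intro divide_nonneg_nonneg less_imp_le[OF Beta_pos]) (auto simp: add_pos_nonneg)
      then show ?thesis
        by (subst integral_eq_nn_integral)
           (auto simp: nn_integral_radial_density_power[OF kn] radial_density_nonneg[OF kn])
    qed
    also have "\<dots> = (LINT \<tau>|?L. (\<tau>\<^sup>2) ^ i)"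
      using radial_density_nonneg[OF kn] by (subst integral_density) auto
    also have "\<dots> = (LINT t|distr ?L borel (\<lambda>\<tau>. \<tau>\<^sup>2). t ^ i)"
      by (subst integral_distr) auto
    finally show "(LINT t|distr \<mu> borel (\<lambda>v. (?N v)\<^sup>2). t ^ i) = (LINT t|distr ?L borel (\<lambda>\<tau>. \<tau>\<^sup>2). t ^ i)" .
  qed
  have "distr \<mu> borel ?N = distr (distr \<mu> borel (\<lambda>v. (?N v)\<^sup>2)) borel sqrt"
    by (subst distr_distr) (auto simp: o_def)
  also have "\<dots> = distr ?L borel (\<lambda>\<tau>. sqrt (\<tau>\<^sup>2))"
    unfolding sq by (subst distr_distr) (auto simp: o_def)
  also have "\<dots> = distr ?L borel (\<lambda>\<tau>. \<tau>)"
    using suppL by (intro distr_cong_AE) (auto elim: eventually_mono)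
  also have "\<dots> = ?L" by (rule distr_id2) simp
  finally show ?thesis .
qed

section \<open>Lebesgue measurable profiles\<close>

lemma borel_measurable_completion_AE:
  fixes f g :: "'a \<Rightarrow> 'b::topological_space"
  assumes f: "f \<in> borel_measurable (completion M)" and eq: "AE x in completion M. f x = g x"
  shows "g \<in> borel_measurable (completion M)"
proof (rule measurableI)
  fix A :: "'b set" assume A: "A \<in> sets borel"
  show "g -` A \<inter> space (completion M) \<in> sets (completion M)"
  proof (rule completion.in_sets_AE)
    show "AE x in completion M. x \<in> f -` A \<inter> space (completion M) \<longleftrightarrow> x \<in> g -` A \<inter> space (completion M)"
      using eq by eventually_elim auto
    show "f -` A \<inter> space (completion M) \<in> sets (completion M)"
      using f A by (rule measurable_sets)
  qed auto
qed auto

lemma borel_version_on_unit_interval: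
  fixes a :: "real \<Rightarrow> complex"
  assumes a: "a \<in> borel_measurable (lebesgue_on {0..1})"
  obtains a' where "a' \<in> borel_measurable borel" "AE \<tau> in lborel. \<tau> \<in> {0..1} \<longrightarrow> a \<tau> = a' \<tau>"
proof -
  have m: "(\<lambda>\<tau>. indicator {0..1} \<tau> *\<^sub>R a \<tau>) \<in> borel_measurable lebesgue"
    using a by (subst (asm) borel_measurable_restrict_space_iff) auto
  have "(\<lambda>\<tau>. Re (indicator {0..1} \<tau> *\<^sub>R a \<tau>)) \<in> borel_measurable (completion lborel)"
    "(\<lambda>\<tau>. Im (indicator {0..1} \<tau> *\<^sub>R a \<tau>)) \<in> borel_measurable (completion lborel)"
    using m by measurable
  from this[THEN completion_ex_borel_measurable_real] obtain r i
    where r: "r \<in> borel_measurable lborel" "AE \<tau> in lborel. Re (indicator {0..1} \<tau> *\<^sub>R a \<tau>) = r \<tau>"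
      and i: "i \<in> borel_measurable lborel" "AE \<tau> in lborel. Im (indicator {0..1} \<tau> *\<^sub>R a \<tau>) = i \<tau>"
    by auto
  show thesis
  proof
    show "(\<lambda>\<tau>. of_real (r \<tau>) + \<i> * of_real (i \<tau>)) \<in> borel_measurable borel"
      using r(1) i(1) by simp
    show "AE \<tau> in lborel. \<tau> \<in> {0..1} \<longrightarrow> a \<tau> = of_real (r \<tau>) + \<i> * of_real (i \<tau>)"
      using r(2) i(2) by eventually_elim (auto simp: complex_eq_iff)
  qed
qed

section \<open>Harmonics on the sphere and on the Stiefel manifold\<close>

lemma dirderiv_Complex:
  assumes f: "real_polynomial_function f" and g: "real_polynomial_function g"
  shows "dirderiv u (\<lambda>y. Complex (f y) (g y)) = (\<lambda>y. Complex (dirderiv u f y) (dirderiv u g y))"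
proof
  fix y
  have "((\<lambda>y. of_real (f y) + \<i> * of_real (g y)) has_derivative
      (\<lambda>u. of_real (dirderiv u f y) + \<i> * of_real (dirderiv u g y))) (at y)"
    by (intro has_derivative_add has_derivative_mult_right has_derivative_of_real has_derivative_dirderiv f g)
  from dirderiv_eq[OF this, of u]
  show "dirderiv u (\<lambda>y. Complex (f y) (g y)) y = Complex (dirderiv u f y) (dirderiv u g y)"
    by (simp only: Complex_eq)
qed

lemma spherical_harmonic_Re_Im:
  fixes Y :: "'a::euclidean_space \<Rightarrow> complex"
  assumes "spherical_harmonic j Y"
  obtains P Q where "solid_harmonic j P" "solid_harmonic j Q"
    "\<And>y. y \<in> sphere 0 1 \<Longrightarrow> Y y = Complex (P y) (Q y)"
proof -
  obtain p where p: "polynomial_function p" "\<And>t x. p (t *\<^sub>R x) = t ^ j *\<^sub>R p x"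
    "\<And>x. laplacian p x = 0" "\<And>y. y \<in> sphere 0 1 \<Longrightarrow> Y y = p y"
    using assms by (auto simp: spherical_harmonic_def)
  define P where "P = (\<lambda>y. Re (p y))"
  define Q where "Q = (\<lambda>y. Im (p y))"
  have rP: "real_polynomial_function P" and rQ: "real_polynomial_function Q"
    using p(1) bounded_linear_Re bounded_linear_Im by (auto simp: polynomial_function_def P_def Q_def o_def)
  have pPQ: "p = (\<lambda>y. Complex (P y) (Q y))" by (simp add: P_def Q_def)
  have pd: "partial_deriv b f = dirderiv b f" for b :: 'a and f :: "'a \<Rightarrow> complex"
    by (simp add: partial_deriv_def dirderiv_def fun_eq_iff)
  have "partial_deriv b (partial_deriv b p) y = Complex (dirderiv b (dirderiv b P) y) (dirderiv b (dirderiv b Q) y)" for b y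
    unfolding pd pPQ by (simp add: dirderiv_Complex rP rQ rpf_dirderiv)
  then have "laplacian p y = Complex (\<Sum>b\<in>Basis. dirderiv b (dirderiv b P) y) (\<Sum>b\<in>Basis. dirderiv b (dirderiv b Q) y)" for y
    by (simp add: laplacian_def complex_eq_iff Re_sum Im_sum)
  with p(3) have "(\<Sum>b\<in>Basis. dirderiv b (dirderiv b P) y) = 0" "(\<Sum>b\<in>Basis. dirderiv b (dirderiv b Q) y) = 0" for y
    by (simp_all add: complex_eq_iff)
  moreover have "homogeneous j P" "homogeneous j Q"
    using p(2) by (auto simp: homogeneous_def P_def Q_def)
  ultimately have "solid_harmonic j P" "solid_harmonic j Q"
    using rP rQ by (auto simp: solid_harmonic_def)
  moreover have "Y y = Complex (P y) (Q y)" if "y \<in> sphere 0 1" for y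
    using p(4)[OF that] by (simp add: P_def Q_def)
  ultimately show thesis by (rule that)
qed

lemma stiefel_R_eq:
  fixes v :: "real ^ 'm ^ 'd"
  assumes v: "v \<in> stiefel" and y: "norm y = 1" and d: "CARD('d) = n + 1" and m: "CARD('m) = n - k" and kn: "k < n"
  shows "stiefel_R n k j (norm (y v* v)) =
    jacobi_form ((real DIM(real ^ 'd) - real CARD('m)) / 2 - 1) (real CARD('m) / 2 - 1) (j div 2)
      (sq_proj UNIV (\<lambda>c. column c v) y) (y \<bullet> y - sq_proj UNIV (\<lambda>c. column c v) y)
    / jacobi ((real k - 1) / 2) ((real n - real k) / 2 - 1) (j div 2) 1"
proof -
  have yy: "y \<bullet> y = 1" using y by (simp add: norm_eq_1)
  have par: "(real DIM(real ^ 'd) - real CARD('m)) / 2 - 1 = (real k - 1) / 2"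
    "real CARD('m) / 2 - 1 = (real n - real k) / 2 - 1"
    using d m kn by (auto simp: of_nat_diff field_simps)
  show ?thesis
    unfolding par yy stiefel_R_def jacobi_R_def norm_vector_matrix_sq jacobi_eq_jacobi_form ..
qed

lemma continuous_on_stiefel_R: "continuous_on S (stiefel_R n k j)"
  unfolding stiefel_R_def jacobi_R_def jacobi_def divide_inverse by (intro continuous_intros)

lemma harmonic_dim_pos: "n \<ge> 2 \<Longrightarrow> harmonic_dim n j > 0"
  unfolding harmonic_dim_def by (intro divide_pos_pos mult_pos_pos Gamma_real_pos) auto

lemma zonal_harmonic_self_pos:
  fixes x :: "'a::euclidean_space"
  assumes "norm x = 1" "DIM('a) \<ge> 2"
  shows "zonal_harmonic x M x > 0"
proof -
  have "real DIM('a) \<ge> 2" using assms(2) by simp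
  then have "pochhammer ((real DIM('a) - 1) / 2) M > 0" by (intro pochhammer_pos) simp
  then show ?thesis unfolding zonal_harmonic_self[OF assms(1)] gbinomial_pochhammer' by simp
qed

lemma sphere_area_quotient:
  assumes "k < n"
  shows "sphere_area (n - k - 1) * sphere_area k / sphere_area n = 2 / Beta ((real n - real k) / 2) ((real k + 1) / 2)"
proof -
  have e: "(real (n - k - 1) + 1) / 2 = (real n - real k) / 2" using assms by (simp add: of_nat_diff)
  have s: "(real n - real k) / 2 + (real k + 1) / 2 = (real n + 1) / 2" by (simp add: field_simps)
  have p: "pi powr ((real n - real k) / 2) * pi powr ((real k + 1) / 2) = pi powr ((real n + 1) / 2)"
    by (simp only: powr_add[symmetric] s)
  have "Gamma ((real n - real k) / 2) \<noteq> 0" "Gamma ((real k + 1) / 2) \<noteq> 0" "Gamma ((real n + 1) / 2) \<noteq> 0"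
    using assms by (auto intro!: less_imp_neq[OF Gamma_real_pos, symmetric])
  then show ?thesis
    unfolding sphere_area_def e Beta_def s p[symmetric] by (simp add: field_simps)
qed

text \<open>The pairing \<open>\<langle>Z,R\<^sub>v\<rangle> = Z(x) R\<^sub>v(x) / D\<close>: on the sphere \<open>R\<^sub>v\<close> is a multiple of a harmonic polynomial, so
  the reproducing property of the zonal harmonic applies.\<close>

lemma integral_stiefel_R_zonal_harmonic:
  fixes v :: "real ^ 'm ^ 'd" and x :: "real ^ 'd"
  assumes n: "n \<ge> 2" and v: "v \<in> stiefel" and x: "norm x = 1" and d: "CARD('d) = n + 1" and m: "CARD('m) = n - k"
    and kn: "k < n" and j: "even j"
  shows "(LINT y|sphere_measure. zonal_harmonic x (j div 2) y * stiefel_R n k j (norm (y v* v)))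
    = zonal_harmonic x (j div 2) x / harmonic_dim n j * stiefel_R n k j (norm (x v* v))"
proof -
  define M where "M = j div 2"
  have jM: "j = 2 * M" using j by (simp add: M_def)
  define N where "N = jacobi ((real k - 1) / 2) ((real n - real k) / 2 - 1) M 1"
  define H where "H = (\<lambda>y. jacobi_form ((real DIM(real ^ 'd) - real CARD('m)) / 2 - 1) (real CARD('m) / 2 - 1) M
      (sq_proj UNIV (\<lambda>c. column c v) y) (y \<bullet> y - sq_proj UNIV (\<lambda>c. column c v) y))"
  have R: "stiefel_R n k j (norm (y v* v)) = H y / N" if "norm y = 1" for y
    using stiefel_R_eq[OF v that d m kn, of j] by (simp add: H_def N_def M_def)
  have H: "solid_harmonic (2 * M) H"
    using solid_harmonic_subspace[OF orthonormal_on_columns[OF v], of M] by (simp add: H_def)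
  have dim: "DIM(real ^ 'd) \<ge> 2" using d n by simp
  have d': "real DIM(real ^ 'd) = real n + 1" using d by simp
  have arith: "(real n + 1 - 4) / 2 = (real n - 3) / 2" "(real n + 1 - 1) / 2 - 1 = real n / 2 - 1" by simp_all
  have "(LINT y|sphere_measure. zonal_harmonic x M y * stiefel_R n k j (norm (y v* v)))
     = (LINT y|sphere_measure. H y * zonal_harmonic x M y / N)"
    by (intro Bochner_Integration.integral_cong refl) (simp add: space_sphere_measure R)
  also have "\<dots> = (LINT y|sphere_measure. H y * zonal_harmonic x M y) / N" by simp
  also have "\<dots> = ((2 * real M + (real n - 3) / 2) gchoose M) * zonal_moment (real n + 1) (2 * M) (2 * M) * H x / N"
    unfolding integral_zonal_harmonic[OF H dim x] d' arith ..
  also have "\<dots> = zonal_harmonic x M x / harmonic_dim n j * (H x / N)"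
    using harmonic_dim_pos[OF n, of j]
    unfolding zonal_harmonic_self[OF x] d' arith zonal_normalization[OF n, symmetric] jM by simp
  finally show ?thesis using R[OF x] by (simp add: M_def)
qed

section \<open>The averaged kernel\<close>

text \<open>The reflection in the hyperplane orthogonal to \<open>y - y'\<close> swaps \<open>y\<close> and \<open>y'\<close>; it fixes \<open>x\<close>, which lies in
  that hyperplane.\<close>

lemma orthogonal_transformation_fixing:
  fixes x y y' :: "'a::euclidean_space"
  assumes "norm y = norm y'" "x \<bullet> y = x \<bullet> y'"
  obtains U where "orthogonal_transformation U" "U x = x" "U y = y'"
proof (cases "y = y'")
  case True
  then show ?thesis using that[of "\<lambda>z. z"] by (simp add: orthogonal_transformation_id)
next
  case False
  define w where "w = y - y'"
  have w: "w \<bullet> w \<noteq> 0" using False by (simp add: w_def)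
  define U where "U = (\<lambda>z. z - (2 * (z \<bullet> w) / (w \<bullet> w)) *\<^sub>R w)"
  show ?thesis
  proof
    show "orthogonal_transformation U"
      unfolding orthogonal_transformation_def
    proof (intro conjI allI)
      show "linear U"
        by (rule linearI) (simp_all add: U_def inner_simps algebra_simps add_divide_distrib)
      show "U u \<bullet> U v = u \<bullet> v" for u v
      proof -
        define c where "c = (\<lambda>z. 2 * (z \<bullet> w) / (w \<bullet> w))"
        have U: "U z = z - c z *\<^sub>R w" for z by (simp add: U_def c_def)
        have cw: "c v * (w \<bullet> w) = 2 * (v \<bullet> w)" using w by (simp add: c_def)
        have "U u \<bullet> U v = u \<bullet> v - c v * (u \<bullet> w) - c u * (v \<bullet> w) + c u * (c v * (w \<bullet> w))"
          unfolding U inner_diff_left inner_diff_right inner_scaleR_left inner_scaleR_right inner_commute[of w v]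
          by (simp add: right_diff_distrib)
        also have "c v * (u \<bullet> w) = c u * (v \<bullet> w)" by (simp add: c_def)
        finally show ?thesis unfolding cw by simp
      qed
    qed
    show "U x = x" using assms(2) by (simp add: U_def w_def inner_diff_right)
    have "y' \<bullet> y' = y \<bullet> y" using assms(1) by (simp add: norm_eq)
    then have "2 * (y \<bullet> w) = w \<bullet> w"
      by (simp add: w_def inner_diff_left inner_diff_right inner_commute[of y' y])
    then show "U y = y'" using w by (simp add: U_def w_def)
  qed
qed

text \<open>The kernel \<open>K\<close> of the composed operator, for an arbitrary continuous radial profile \<open>r\<close> in place of
  the Jacobi factor.\<close>

definition stiefel_kernel ::
    "(real ^ 'm ^ 'd) measure \<Rightarrow> (real \<Rightarrow> complex) \<Rightarrow> (real \<Rightarrow> real) \<Rightarrow> real ^ 'd \<Rightarrow> real ^ 'd \<Rightarrow> complex" where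
  "stiefel_kernel \<mu> A r x y = (LINT v|\<mu>. A (norm (x v* v)) * of_real (r (norm (y v* v))))"

context
  fixes \<mu> :: "(real ^ 'm ^ 'd) measure" and x :: "real ^ 'd" and A :: "real \<Rightarrow> complex" and r :: "real \<Rightarrow> real"
  assumes \<mu>: "stiefel_measure \<mu>" and x: "norm x = 1"
    and A: "A \<in> borel_measurable borel" and int: "integrable \<mu> (\<lambda>v. A (norm (x v* v)))"
    and r: "continuous_on UNIV r"
begin

lemma profile_bounded: "\<exists>B\<ge>0. \<forall>t\<in>{0..1}. \<bar>r t\<bar> \<le> B"
proof -
  have "compact (r ` {0..1})"
    by (intro compact_continuous_image continuous_on_subset[OF r]) auto
  then obtain B where "\<And>t. t \<in> {0..1} \<Longrightarrow> norm (r t) \<le> B"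
    using compact_imp_bounded bounded_iff by (metis imageI)
  then show ?thesis by (intro exI[of _ "\<bar>B\<bar>"]) force
qed

lemma norm_row_in_unit_interval: "v \<in> space \<mu> \<Longrightarrow> norm y = 1 \<Longrightarrow> norm (y v* v) \<in> {0..1}"
  using norm_vector_matrix_le[of v y] by (simp add: space_stiefel_measure[OF \<mu>])

lemma measurable_r: "r \<in> borel_measurable borel"
  by (rule borel_measurable_continuous_onI[OF r])

lemma measurable_kernel_integrand:
  "(\<lambda>v. A (norm (x v* v)) * of_real (r (norm (y v* v)))) \<in> borel_measurable \<mu>"
  using measurable_compose[OF measurable_vector_matrix_norm_right[OF \<mu>, of x] A]
    measurable_compose[OF measurable_vector_matrix_norm_right[OF \<mu>, of y] measurable_r]
  by measurable

lemma stiefel_kernel_rotate: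
  assumes U: "orthogonal_transformation U" "U x = x"
  shows "stiefel_kernel \<mu> A r x (U y) = stiefel_kernel \<mu> A r x y"
  using integral_stiefel_norm_rotate[OF \<mu> U(1), of "\<lambda>s t. A s * of_real (r t)" x y] measurable_kernel_integrand[of y] U(2)
  by (simp add: stiefel_kernel_def)

lemma continuous_on_stiefel_kernel: "continuous_on (sphere 0 1) (stiefel_kernel \<mu> A r x)"
proof (rule continuous_on_sequentiallyI)
  fix u :: "nat \<Rightarrow> real ^ 'd" and y
  assume u: "\<forall>i. u i \<in> sphere 0 1" "u \<longlonglongrightarrow> y" and y: "y \<in> sphere 0 1"
  obtain B where B: "B \<ge> 0" "\<And>t. t \<in> {0..1} \<Longrightarrow> \<bar>r t\<bar> \<le> B" using profile_bounded by blast
  have "(\<lambda>i. LINT v|\<mu>. A (norm (x v* v)) * of_real (r (norm (u i v* v)))) \<longlonglongrightarrow>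
    (LINT v|\<mu>. A (norm (x v* v)) * of_real (r (norm (y v* v))))"
  proof (rule integral_dominated_convergence[where w = "\<lambda>v. cmod (A (norm (x v* v))) * B"])
    show "integrable \<mu> (\<lambda>v. cmod (A (norm (x v* v))) * B)"
      using int by (intro integrable_mult_left integrable_norm)
    show "AE v in \<mu>. (\<lambda>i. A (norm (x v* v)) * of_real (r (norm (u i v* v)))) \<longlonglongrightarrow> A (norm (x v* v)) * of_real (r (norm (y v* v)))"
    proof (rule AE_I2)
      fix v :: "real ^ 'm ^ 'd"
      have "continuous_on UNIV (\<lambda>y. norm (y v* v))"
        using continuous_on_compose2[OF continuous_on_vector_matrix_norm, of UNIV "\<lambda>y. (y, v)"]
        by (simp add: continuous_on_Pair)
      then have "continuous_on UNIV (\<lambda>y. r (norm (y v* v)))"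
        by (rule continuous_on_compose2[OF r]) auto
      then have "(\<lambda>i. r (norm (u i v* v))) \<longlonglongrightarrow> r (norm (y v* v))"
        using u(2) by (auto simp: continuous_on_eq_continuous_at intro: isCont_tendsto_compose)
      then show "(\<lambda>i. A (norm (x v* v)) * of_real (r (norm (u i v* v)))) \<longlonglongrightarrow> A (norm (x v* v)) * of_real (r (norm (y v* v)))"
        by (intro tendsto_intros)
    qed
    show "AE v in \<mu>. norm (A (norm (x v* v)) * of_real (r (norm (u i v* v)))) \<le> cmod (A (norm (x v* v))) * B" for i
      using u(1) B norm_row_in_unit_interval[of _ "u i"] by (intro AE_I2) (auto simp: norm_mult intro!: mult_left_mono)
  qed (rule measurable_kernel_integrand)+
  then show "(\<lambda>i. stiefel_kernel \<mu> A r x (u i)) \<longlonglongrightarrow> stiefel_kernel \<mu> A r x y"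
    by (simp add: stiefel_kernel_def)
qed

text \<open>The exchange of the two integrals is legitimate because \<open>Q\<close> and \<open>r\<close> are bounded where they are evaluated and
  \<open>a(|x\<^sup>T v|)\<close> is integrable.\<close>

lemma
  fixes Q :: "real ^ 'd \<Rightarrow> complex"
  assumes Q: "continuous_on UNIV Q"
  shows integrable_stiefel_kernel: "integrable sphere_measure (\<lambda>y. Q y * stiefel_kernel \<mu> A r x y)"
    and integrable_stiefel_transform:
      "integrable \<mu> (\<lambda>v. A (norm (x v* v)) * (LINT y|sphere_measure. Q y * of_real (r (norm (y v* v)))))"
    and integral_stiefel_transform:
      "(LINT v|\<mu>. A (norm (x v* v)) * (LINT y|sphere_measure. Q y * of_real (r (norm (y v* v)))))
        = (LINT y|sphere_measure. Q y * stiefel_kernel \<mu> A r x y)"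
proof -
  interpret S: prob_space "sphere_measure :: (real ^ 'd) measure" by (rule prob_space_sphere_measure)
  interpret M: prob_space \<mu> using \<mu> by (simp add: stiefel_measure_def)
  interpret P: pair_prob_space "sphere_measure :: (real ^ 'd) measure" \<mu> ..
  obtain B where B: "B \<ge> 0" "\<And>t. t \<in> {0..1} \<Longrightarrow> \<bar>r t\<bar> \<le> B" using profile_bounded by blast
  obtain C where C: "\<And>y. y \<in> sphere 0 1 \<Longrightarrow> norm (Q y) \<le> C"
    using continuous_bounded_on_sphere[OF continuous_on_subset[OF Q subset_UNIV]] by metis
  let ?f = "\<lambda>y v. Q y * (A (norm (x v* v)) * of_real (r (norm (y v* v))))"
  have m1: "(\<lambda>p. Q (fst p)) \<in> borel_measurable (sphere_measure \<Otimes>\<^sub>M \<mu>)"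
    by (rule measurable_compose[OF measurable_fst borel_measurable_sphere_measureI[OF borel_measurable_continuous_onI[OF Q]]])
  have m2: "(\<lambda>p. A (norm (x v* snd p))) \<in> borel_measurable ((sphere_measure :: (real ^ 'd) measure) \<Otimes>\<^sub>M \<mu>)"
    by (rule measurable_compose[OF measurable_snd measurable_compose[OF measurable_vector_matrix_norm_right[OF \<mu>, of x] A]])
  have m3: "(\<lambda>p. r (norm (fst p v* snd p))) \<in> borel_measurable (sphere_measure \<Otimes>\<^sub>M \<mu>)"
    by (rule measurable_compose[OF measurable_vector_matrix_norm[OF \<mu>] measurable_r])
  have mf: "(\<lambda>p. ?f (fst p) (snd p)) \<in> borel_measurable (sphere_measure \<Otimes>\<^sub>M \<mu>)"
    using m1 m2 m3 by measurable
  have bound: "norm (?f y v) \<le> C * B * cmod (A (norm (x v* v)))" if "y \<in> sphere 0 1" "v \<in> space \<mu>" for y v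
  proof -
    have "\<bar>r (norm (y v* v))\<bar> \<le> B" using B(2) norm_row_in_unit_interval[OF that(2), of y] that(1) by simp
    then have "cmod (Q y) * \<bar>r (norm (y v* v))\<bar> \<le> C * B"
      using C[OF that(1)] B(1) order_trans[OF norm_ge_zero C[OF that(1)]] by (intro mult_mono) auto
    then have "(cmod (Q y) * \<bar>r (norm (y v* v))\<bar>) * cmod (A (norm (x v* v))) \<le> C * B * cmod (A (norm (x v* v)))"
      by (rule mult_right_mono) simp
    then show ?thesis by (simp add: norm_mult mult_ac)
  qed
  have intB: "integrable \<mu> (\<lambda>v. C * B * cmod (A (norm (x v* v))))"
    using int by (intro integrable_mult_right integrable_norm)
  have inty: "integrable \<mu> (?f y)" if "y \<in> sphere 0 1" for y
  proof (rule Bochner_Integration.integrable_bound[OF intB])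
    show "?f y \<in> borel_measurable \<mu>" using measurable_kernel_integrand[of y] by measurable
    show "AE v in \<mu>. norm (?f y v) \<le> norm (C * B * cmod (A (norm (x v* v))))"
      by (intro AE_I2 order_trans[OF bound[OF that]]) (simp_all only: real_norm_def abs_ge_self)
  qed
  have intf: "integrable (sphere_measure \<Otimes>\<^sub>M \<mu>) (case_prod ?f)"
  proof (rule P.Fubini_integrable)
    show mf': "case_prod ?f \<in> borel_measurable (sphere_measure \<Otimes>\<^sub>M \<mu>)" using mf by (simp add: case_prod_unfold)
    show "AE y in sphere_measure. integrable \<mu> (\<lambda>v. case_prod ?f (y, v))"
      using inty by (intro AE_I2) (simp add: space_sphere_measure)
    show "integrable sphere_measure (\<lambda>y. LINT v|\<mu>. norm (case_prod ?f (y, v)))"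
    proof (rule S.integrable_const_bound[where B = "LINT v|\<mu>. C * B * cmod (A (norm (x v* v)))"])
      show "(\<lambda>y. LINT v|\<mu>. norm (case_prod ?f (y, v))) \<in> borel_measurable sphere_measure"
        using mf by (intro M.borel_measurable_lebesgue_integral) (simp add: case_prod_unfold)
      show "AE y in sphere_measure. norm (LINT v|\<mu>. norm (case_prod ?f (y, v))) \<le> (LINT v|\<mu>. C * B * cmod (A (norm (x v* v))))"
      proof (rule AE_I2)
        fix y :: "real ^ 'd" assume "y \<in> space sphere_measure"
        then have y: "y \<in> sphere 0 1" by (simp add: space_sphere_measure)
        have "(LINT v|\<mu>. norm (?f y v)) \<le> (LINT v|\<mu>. C * B * cmod (A (norm (x v* v))))"
          using bound[OF y] by (intro integral_mono integrable_norm inty[OF y] intB)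
        moreover have "0 \<le> (LINT v|\<mu>. norm (?f y v))" by (intro integral_nonneg_AE AE_I2) simp
        ultimately show "norm (LINT v|\<mu>. norm (case_prod ?f (y, v))) \<le> (LINT v|\<mu>. C * B * cmod (A (norm (x v* v))))"
          by simp
      qed
    qed
  qed
  have iy: "(LINT v|\<mu>. ?f y v) = Q y * stiefel_kernel \<mu> A r x y" for y
    by (simp add: stiefel_kernel_def)
  have iv: "(LINT y|sphere_measure. ?f y v) = A (norm (x v* v)) * (LINT y|sphere_measure. Q y * of_real (r (norm (y v* v))))" for v
  proof -
    have "(LINT y|sphere_measure. ?f y v) = (LINT y|sphere_measure. A (norm (x v* v)) * (Q y * of_real (r (norm (y v* v)))))"
      by (intro Bochner_Integration.integral_cong refl) (simp add: mult_ac)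
    then show ?thesis by simp
  qed
  show "integrable sphere_measure (\<lambda>y. Q y * stiefel_kernel \<mu> A r x y)"
    using P.integrable_fst[OF intf] unfolding iy .
  show "integrable \<mu> (\<lambda>v. A (norm (x v* v)) * (LINT y|sphere_measure. Q y * of_real (r (norm (y v* v)))))"
    using P.integrable_snd[OF intf] unfolding iv .
  show "(LINT v|\<mu>. A (norm (x v* v)) * (LINT y|sphere_measure. Q y * of_real (r (norm (y v* v)))))
        = (LINT y|sphere_measure. Q y * stiefel_kernel \<mu> A r x y)"
    using P.Fubini_integral[OF intf] unfolding iy iv .
qed

text \<open>The kernel is invariant under the orthogonal maps fixing \<open>x\<close>, and these act transitively on each
  parallel \<open>x \<bullet> y = s\<close> of the sphere. Hence its values on one meridian, parametrized by \<open>point\<close>, determine it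
  as a continuous function of \<open>x \<bullet> y\<close>, to which the Weierstrass argument applies.\<close>

lemma integral_stiefel_kernel_eq_0:
  fixes q :: "real ^ 'd \<Rightarrow> real"
  assumes d: "2 \<le> CARD('d)" and q: "continuous_on UNIV q"
    and mom: "\<And>l. (LINT y|sphere_measure. q y * (x \<bullet> y) ^ l) = 0"
  shows "(LINT y|sphere_measure. of_real (q y) * stiefel_kernel \<mu> A r x y) = 0"
proof -
  let ?K = "stiefel_kernel \<mu> A r x"
  have "2 \<le> DIM(real ^ 'd)" using d by simp
  then obtain e' where "e' \<noteq> 0" "orthogonal x e'" by (rule orthogonal_to_vector_exists)
  then obtain e where e: "norm e = 1" "x \<bullet> e = 0"
    by (intro that[of "e' /\<^sub>R norm e'"]) (auto simp: orthogonal_def)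
  \<comment> \<open>A meridian through \<open>x\<close>.\<close>
  define point where "point = (\<lambda>s. s *\<^sub>R x + sqrt (1 - s\<^sup>2) *\<^sub>R e)"
  have xx: "x \<bullet> x = 1" and ee: "e \<bullet> e = 1" and ex: "e \<bullet> x = 0"
    using x e by (auto simp: norm_eq_1 inner_commute)
  have point: "norm (point s) = 1" "x \<bullet> point s = s" if "s \<in> {-1..1}" for s
  proof -
    have "s\<^sup>2 \<le> 1" using that by (auto simp: abs_square_le_1 abs_le_iff)
    then have "point s \<bullet> point s = 1"
      by (simp add: point_def inner_add_left inner_add_right xx ee ex e(2) power2_eq_square[symmetric])
    then show "norm (point s) = 1" by (simp add: norm_eq_1)
    show "x \<bullet> point s = s" by (simp add: point_def inner_add_right xx e(2))
  qed
  define \<kappa> where "\<kappa> = (\<lambda>s. ?K (point s))"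
  have c\<kappa>: "continuous_on {-1..1} \<kappa>"
    unfolding \<kappa>_def
  proof (rule continuous_on_compose2[OF continuous_on_stiefel_kernel])
    show "continuous_on {-1..1} point" unfolding point_def by (intro continuous_intros)
  qed (auto simp: point)
  have rng: "x \<bullet> y \<in> {-1..1}" if "y \<in> sphere 0 1" for y
    using Cauchy_Schwarz_ineq2[of x y] that x by auto
  have K: "?K y = \<kappa> (x \<bullet> y)" if y: "y \<in> sphere 0 1" for y
  proof -
    have "norm y = norm (point (x \<bullet> y))" "x \<bullet> y = x \<bullet> point (x \<bullet> y)"
      using y point[OF rng[OF y]] by auto
    then obtain U where U: "orthogonal_transformation U" "U x = x" "U y = point (x \<bullet> y)"
      by (rule orthogonal_transformation_fixing)
    from stiefel_kernel_rotate[OF U(1,2), of y] show ?thesis by (simp add: \<kappa>_def U(3))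
  qed
  have I: "integrable sphere_measure (\<lambda>y. of_real (q y) * ?K y)"
    by (intro integrable_stiefel_kernel continuous_intros q)
  have "Re (LINT y|sphere_measure. of_real (q y) * ?K y) = (LINT y|sphere_measure. q y * Re (\<kappa> (x \<bullet> y)))"
    by (subst integral_Re[OF I, symmetric], intro Bochner_Integration.integral_cong)
       (auto simp: space_sphere_measure K)
  also have "\<dots> = 0"
    by (intro integral_zonal_kernel_eq_0[OF q x mom] continuous_intros c\<kappa>)
  finally have 1: "Re (LINT y|sphere_measure. of_real (q y) * ?K y) = 0" .
  have "Im (LINT y|sphere_measure. of_real (q y) * ?K y) = (LINT y|sphere_measure. q y * Im (\<kappa> (x \<bullet> y)))"
    by (subst integral_Im[OF I, symmetric], intro Bochner_Integration.integral_cong)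
       (auto simp: space_sphere_measure K)
  also have "\<dots> = 0"
    by (intro integral_zonal_kernel_eq_0[OF q x mom] continuous_intros c\<kappa>)
  finally show ?thesis using 1 by (simp add: complex_eq_iff)
qed

text \<open>The combination \<open>Z(x) P - P(x) Z\<close> of two harmonics of the same degree vanishes at \<open>x\<close>, so all its moments
  against powers of \<open>x \<bullet> y\<close> vanish.\<close>

lemma integral_solid_harmonic_stiefel_kernel:
  assumes P: "solid_harmonic (2 * M) P" and d: "2 \<le> CARD('d)"
  shows "of_real (zonal_harmonic x M x) * (LINT y|sphere_measure. of_real (P y) * stiefel_kernel \<mu> A r x y)
     = of_real (P x) * (LINT y|sphere_measure. of_real (zonal_harmonic x M y) * stiefel_kernel \<mu> A r x y)"
proof -
  let ?K = "stiefel_kernel \<mu> A r x" and ?Z = "zonal_harmonic x M"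
  have Z: "solid_harmonic (2 * M) ?Z" by (rule solid_harmonic_zonal_harmonic[OF x])
  have cP: "continuous_on UNIV P" and cZ: "continuous_on UNIV ?Z"
    using P Z by (auto intro: continuous_on_rpf dest: solid_harmonicD)
  define q where "q = (\<lambda>y. ?Z x * P y - P x * ?Z y)"
  have dim: "2 \<le> DIM(real ^ 'd)" using d by simp
  have "(LINT y|sphere_measure. of_real (q y) * ?K y) = 0"
  proof (rule integral_stiefel_kernel_eq_0[OF d])
    show "continuous_on UNIV q" unfolding q_def by (intro continuous_intros cP cZ)
    fix l
    have i: "integrable sphere_measure (\<lambda>y. (x \<bullet> y) ^ l * F y)" if "continuous_on UNIV F" for F :: "real ^ 'd \<Rightarrow> real"
      by (intro integrable_sphere_measure_continuous continuous_intros that)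
    have "(LINT y|sphere_measure. q y * (x \<bullet> y) ^ l)
       = (LINT y|sphere_measure. ?Z x * ((x \<bullet> y) ^ l * P y) - P x * ((x \<bullet> y) ^ l * ?Z y))"
      by (intro Bochner_Integration.integral_cong) (auto simp: q_def algebra_simps)
    also have "\<dots> = ?Z x * (LINT y|sphere_measure. (x \<bullet> y) ^ l * P y) - P x * (LINT y|sphere_measure. (x \<bullet> y) ^ l * ?Z y)"
      using i[OF cP] i[OF cZ] by simp
    also have "\<dots> = 0"
      unfolding integral_inner_power_solid_harmonic[OF P dim x] integral_inner_power_solid_harmonic[OF Z dim x] by simp
    finally show "(LINT y|sphere_measure. q y * (x \<bullet> y) ^ l) = 0" .
  qed
  moreover have "(LINT y|sphere_measure. of_real (q y) * ?K y)
     = (LINT y|sphere_measure. of_real (?Z x) * (of_real (P y) * ?K y) - of_real (P x) * (of_real (?Z y) * ?K y))"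
    by (intro Bochner_Integration.integral_cong) (auto simp: q_def algebra_simps)
  moreover have "\<dots> = of_real (?Z x) * (LINT y|sphere_measure. of_real (P y) * ?K y)
      - of_real (P x) * (LINT y|sphere_measure. of_real (?Z y) * ?K y)"
    using integrable_stiefel_kernel[of "\<lambda>y. of_real (P y)"] integrable_stiefel_kernel[of "\<lambda>y. of_real (?Z y)"] cP cZ
    by (simp add: continuous_on_of_real)
  ultimately show ?thesis by simp
qed

end

text \<open>For the Jacobi factor the remaining pairing of the kernel with the zonal harmonic is computed by
  exchanging the integrals once more and evaluating \<open>\<langle>Z,R\<^sub>v\<rangle>\<close>.\<close>

lemma integral_solid_harmonic_stiefel_R_kernel:
  fixes \<mu> :: "(real ^ 'm ^ 'd) measure" and x :: "real ^ 'd" and A :: "real \<Rightarrow> complex"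
  assumes \<mu>: "stiefel_measure \<mu>" and x: "norm x = 1"
    and A: "A \<in> borel_measurable borel" and int: "integrable \<mu> (\<lambda>v. A (norm (x v* v)))"
    and n: "n \<ge> 2" and d: "CARD('d) = n + 1" and m: "CARD('m) = n - k" and kn: "k < n"
    and j: "even j" and P: "solid_harmonic j P"
  shows "(LINT y|sphere_measure. of_real (P y) * stiefel_kernel \<mu> A (stiefel_R n k j) x y)
    = of_real (P x / harmonic_dim n j) * (LINT v|\<mu>. A (norm (x v* v)) * of_real (stiefel_R n k j (norm (x v* v))))"
proof -
  define M where "M = j div 2"
  have jM: "j = 2 * M" using j by (simp add: M_def)
  let ?r = "stiefel_R n k j" and ?Z = "zonal_harmonic x M"
  note ctxt = \<mu> x A int continuous_on_stiefel_R[of UNIV n k j]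
  have d2: "2 \<le> CARD('d)" using d n by simp
  have cZ: "continuous_on UNIV (\<lambda>y. complex_of_real (?Z y))"
    by (intro continuous_on_of_real continuous_on_rpf solid_harmonicD(1)[OF solid_harmonic_zonal_harmonic[OF x]])
  have "(LINT y|sphere_measure. of_real (?Z y) * stiefel_kernel \<mu> A ?r x y)
     = (LINT v|\<mu>. A (norm (x v* v)) * (LINT y|sphere_measure. of_real (?Z y) * of_real (?r (norm (y v* v)))))"
    by (rule integral_stiefel_transform[OF ctxt cZ, symmetric])
  also have "\<dots> = (LINT v|\<mu>. of_real (?Z x / harmonic_dim n j) * (A (norm (x v* v)) * of_real (?r (norm (x v* v)))))"
  proof (rule Bochner_Integration.integral_cong[OF refl])
    fix v assume "v \<in> space \<mu>"
    then have v: "v \<in> stiefel" by (simp add: space_stiefel_measure[OF \<mu>])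
    have "(LINT y|sphere_measure. complex_of_real (?Z y) * of_real (?r (norm (y v* v))))
       = of_real (LINT y|sphere_measure. ?Z y * ?r (norm (y v* v)))"
      by (subst integral_complex_of_real[symmetric]) simp
    then show "A (norm (x v* v)) * (LINT y|sphere_measure. of_real (?Z y) * of_real (?r (norm (y v* v))))
       = of_real (?Z x / harmonic_dim n j) * (A (norm (x v* v)) * of_real (?r (norm (x v* v))))"
      using integral_stiefel_R_zonal_harmonic[OF n v x d m kn j] by (simp add: M_def mult_ac)
  qed
  also have "\<dots> = of_real (?Z x / harmonic_dim n j) * (LINT v|\<mu>. A (norm (x v* v)) * of_real (?r (norm (x v* v))))"
    by simp
  finally have Z: "(LINT y|sphere_measure. of_real (?Z y) * stiefel_kernel \<mu> A ?r x y) = \<dots>" .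
  have "?Z x \<noteq> 0" using zonal_harmonic_self_pos[OF x, of M] d2 by simp
  moreover have "of_real (?Z x) * (LINT y|sphere_measure. of_real (P y) * stiefel_kernel \<mu> A ?r x y)
     = of_real (?Z x) * (of_real (P x / harmonic_dim n j) * (LINT v|\<mu>. A (norm (x v* v)) * of_real (?r (norm (x v* v)))))"
    unfolding integral_solid_harmonic_stiefel_kernel[OF ctxt P[unfolded jM] d2] Z by (simp add: mult_ac)
  ultimately show ?thesis
    by (simp only: mult_cancel_left of_real_eq_0_iff simp_thms)
qed

section \<open>The multiplier theorem\<close>

theorem theorem3p10:
  fixes n k j :: nat
    and a :: "real \<Rightarrow> complex"
    and Y :: "real ^ 'd \<Rightarrow> complex"
    and \<mu> :: "(real ^ 'm ^ 'd) measure"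
    and x :: "real ^ 'd"
  assumes "n \<ge> 2" and "1 \<le> k" and "k \<le> n - 1"
    and "CARD('d) = n + 1" and "CARD('m) = n - k"
    and "stiefel_measure \<mu>"
    and "a \<in> borel_measurable (lebesgue_on {0..1})"
    and "set_integrable lebesgue {0..1} (\<lambda>\<tau>. cmod (a \<tau>) * stiefel_weight n k \<tau>)"
    and "even j" and "spherical_harmonic j Y"
    and "x \<in> sphere 0 1"
  shows "has_bochner_integral (completion \<mu>)
           (\<lambda>v. a (norm (x v* v)) * stiefel_harmonic n k j Y v)
           (multiplier n k a j * Y x)"
proof -
  note n = assms(1) and d = assms(4) and m = assms(5) and \<mu> = assms(6) and j = assms(9)
  have kn: "k < n" using assms(1,3) by linarith
  have x: "norm x = 1" using assms(11) by simp
  let ?r = "stiefel_R n k j" and ?w = "stiefel_weight n k" and ?N = "\<lambda>v::real ^ 'm ^ 'd. norm (x v* v)"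
  let ?dens = "radial_density n k" and ?D = "harmonic_dim n j"
  define B where "B = 2 / Beta ((real n - real k) / 2) ((real k + 1) / 2)"
  have dens: "?dens \<tau> = B * (indicator {0..1} \<tau> * ?w \<tau>)" for \<tau>
    by (simp add: radial_density_def B_def)
  \<comment> \<open>The law of \<open>|x\<^sup>T v|\<close> transfers integrability and integrals of functions of \<open>|x\<^sup>T v|\<close> to \<open>[0,1]\<close>.\<close>
  note law = distr_stiefel_norm[OF \<mu> d m kn x]
  note mN = measurable_vector_matrix_norm_right[OF \<mu>, of x]
  \<comment> \<open>Fubini and transport need a Borel function \<open>A\<close>; \<open>a\<close> itself is recovered at the end,
     because the law of \<open>|x\<^sup>T v|\<close> has a density and so does not see null sets.\<close>
  obtain A where A: "A \<in> borel_measurable borel" "AE \<tau> in lborel. \<tau> \<in> {0..1} \<longrightarrow> a \<tau> = A \<tau>"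
    using borel_version_on_unit_interval[OF assms(7)] .
  note A(1) [measurable]
  have [measurable]: "?r \<in> borel_measurable borel"
    by (rule borel_measurable_continuous_onI[OF continuous_on_stiefel_R])
  have push: "integrable \<mu> (\<lambda>v. F (?N v)) \<longleftrightarrow> integrable lborel (\<lambda>\<tau>. ?dens \<tau> *\<^sub>R F \<tau>)"
    "(LINT v|\<mu>. F (?N v)) = (LINT \<tau>|lborel. ?dens \<tau> *\<^sub>R F \<tau>)"
    if [measurable]: "F \<in> borel_measurable borel" for F :: "real \<Rightarrow> complex"
  proof -
    have "integrable \<mu> (\<lambda>v. F (?N v)) \<longleftrightarrow> integrable (distr \<mu> borel ?N) F"
      by (rule integrable_distr_eq[OF mN that, symmetric])
    also have "\<dots> \<longleftrightarrow> integrable lborel (\<lambda>\<tau>. ?dens \<tau> *\<^sub>R F \<tau>)"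
      unfolding law by (rule integrable_density) (auto simp: radial_density_nonneg[OF kn])
    finally show "integrable \<mu> (\<lambda>v. F (?N v)) \<longleftrightarrow> integrable lborel (\<lambda>\<tau>. ?dens \<tau> *\<^sub>R F \<tau>)" .
    have "(LINT v|\<mu>. F (?N v)) = (LINT \<tau>|distr \<mu> borel ?N. F \<tau>)"
      by (rule integral_distr[OF mN that, symmetric])
    also have "\<dots> = (LINT \<tau>|lborel. ?dens \<tau> *\<^sub>R F \<tau>)"
      unfolding law by (rule integral_density) (auto simp: radial_density_nonneg[OF kn])
    finally show "(LINT v|\<mu>. F (?N v)) = (LINT \<tau>|lborel. ?dens \<tau> *\<^sub>R F \<tau>)" .
  qed
  have int: "integrable \<mu> (\<lambda>v. A (?N v))"
  proof -
    have "integrable lebesgue (\<lambda>\<tau>. indicator {0..1} \<tau> * (cmod (A \<tau>) * ?w \<tau>))"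
    proof (rule integrable_cong_AE_imp)
      show "integrable lebesgue (\<lambda>\<tau>. indicator {0..1} \<tau> *\<^sub>R (cmod (a \<tau>) * ?w \<tau>))"
        using assms(8) by (simp only: set_integrable_def)
      have "(\<lambda>\<tau>. indicator {0..1} \<tau> * (cmod (A \<tau>) * ?w \<tau>)) \<in> borel_measurable lborel" by measurable
      then show "(\<lambda>\<tau>. indicator {0..1} \<tau> * (cmod (A \<tau>) * ?w \<tau>)) \<in> borel_measurable lebesgue"
        by (rule measurable_completion)
      show "AE \<tau> in lebesgue. indicator {0..1} \<tau> *\<^sub>R (cmod (a \<tau>) * ?w \<tau>) = indicator {0..1} \<tau> * (cmod (A \<tau>) * ?w \<tau>)"
        using AE_completion[OF A(2)] by eventually_elim (auto simp: indicator_def)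
    qed
    then have "integrable lborel (\<lambda>\<tau>. indicator {0..1} \<tau> * (cmod (A \<tau>) * ?w \<tau>))"
      by (subst (asm) integrable_completion) auto
    then have "integrable lborel (\<lambda>\<tau>. B * (indicator {0..1} \<tau> * (cmod (A \<tau>) * ?w \<tau>)))"
      by (rule integrable_mult_right)
    then have "integrable lborel (\<lambda>\<tau>. ?dens \<tau> *\<^sub>R A \<tau>)"
    proof (rule Bochner_Integration.integrable_bound)
      show "AE \<tau> in lborel. norm (?dens \<tau> *\<^sub>R A \<tau>) \<le> norm (B * (indicator {0..1} \<tau> * (cmod (A \<tau>) * ?w \<tau>)))"
        by (auto simp: dens abs_mult mult_ac)
    qed measurable
    then show ?thesis by (simp only: push(1)[OF A(1)])
  qed
  define I where "I = (LINT v|\<mu>. A (?N v) * of_real (?r (?N v)))"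
  have I: "I = of_real B * (LINT \<tau>:{0..1}|lebesgue. of_real (?r \<tau>) * a \<tau> * of_real (?w \<tau>))"
  proof -
    have "I = (LINT \<tau>|lborel. ?dens \<tau> *\<^sub>R (A \<tau> * of_real (?r \<tau>)))"
      unfolding I_def by (rule push(2)) measurable
    also have "\<dots> = (LINT \<tau>|lborel. of_real B * (indicator {0..1} \<tau> *\<^sub>R (of_real (?r \<tau>) * A \<tau> * of_real (?w \<tau>))))"
      by (intro Bochner_Integration.integral_cong) (auto simp: dens scaleR_conv_of_real mult_ac)
    also have "\<dots> = of_real B * (LINT \<tau>|lborel. indicator {0..1} \<tau> *\<^sub>R (of_real (?r \<tau>) * A \<tau> * of_real (?w \<tau>)))"
      by (rule integral_mult_right_zero)
    also have "(LINT \<tau>|lborel. indicator {0..1} \<tau> *\<^sub>R (of_real (?r \<tau>) * A \<tau> * of_real (?w \<tau>)))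
       = (LINT \<tau>|lebesgue. indicator {0..1} \<tau> *\<^sub>R (of_real (?r \<tau>) * A \<tau> * of_real (?w \<tau>)))"
      by (rule integral_completion[symmetric]) measurable
    also have "\<dots> = (LINT \<tau>|lebesgue. indicator {0..1} \<tau> *\<^sub>R (of_real (?r \<tau>) * a \<tau> * of_real (?w \<tau>)))"
    proof (rule integral_cong_AE)
      have "(\<lambda>\<tau>. indicator {0..1} \<tau> *\<^sub>R (complex_of_real (?r \<tau>) * A \<tau> * of_real (?w \<tau>))) \<in> borel_measurable lborel"
        by measurable
      then show mA: "(\<lambda>\<tau>. indicator {0..1} \<tau> *\<^sub>R (complex_of_real (?r \<tau>) * A \<tau> * of_real (?w \<tau>))) \<in> borel_measurable lebesgue"
        by (rule measurable_completion)
      show ae: "AE \<tau> in lebesgue. indicator {0..1} \<tau> *\<^sub>R (of_real (?r \<tau>) * A \<tau> * of_real (?w \<tau>)) =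
          indicator {0..1} \<tau> *\<^sub>R (of_real (?r \<tau>) * a \<tau> * of_real (?w \<tau>))"
        using AE_completion[OF A(2)] by eventually_elim (auto simp: indicator_def)
      show "(\<lambda>\<tau>. indicator {0..1} \<tau> *\<^sub>R (complex_of_real (?r \<tau>) * a \<tau> * of_real (?w \<tau>))) \<in> borel_measurable lebesgue"
        by (rule borel_measurable_completion_AE[OF mA ae])
    qed
    finally show ?thesis by (simp only: set_lebesgue_integral_def)
  qed
  obtain P Q where P: "solid_harmonic j P" and Q: "solid_harmonic j Q"
    and PQ: "\<And>y. y \<in> sphere 0 1 \<Longrightarrow> Y y = Complex (P y) (Q y)"
    using spherical_harmonic_Re_Im[OF assms(10)] by blast
  note ctxt = \<mu> x A(1) int continuous_on_stiefel_R[of UNIV n k j]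
  define p where "p = (\<lambda>y. complex_of_real (P y) + \<i> * of_real (Q y))"
  have cP: "continuous_on UNIV (\<lambda>y. complex_of_real (P y))" and cQ: "continuous_on UNIV (\<lambda>y. complex_of_real (Q y))"
    using solid_harmonicD(1)[OF P] solid_harmonicD(1)[OF Q]
    by (intro continuous_on_of_real continuous_on_rpf; simp)+
  have cp: "continuous_on UNIV p" unfolding p_def by (intro continuous_intros cP cQ)
  define c where "c = varkappa n k j * sqrt ?D"
  have Yhat: "stiefel_harmonic n k j Y v = of_real c * (LINT y|sphere_measure. p y * of_real (?r (norm (y v* v))))" for v :: "real ^ 'm ^ 'd"
    unfolding stiefel_harmonic_def c_def[symmetric]
    by (intro arg_cong2[where f = "(*)"] refl Bochner_Integration.integral_cong)
       (auto simp: space_sphere_measure PQ p_def Complex_eq)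
  let ?K = "stiefel_kernel \<mu> A ?r x"
  have "(LINT v|\<mu>. A (?N v) * (LINT y|sphere_measure. p y * of_real (?r (norm (y v* v))))) = (LINT y|sphere_measure. p y * ?K y)"
    by (rule integral_stiefel_transform[OF ctxt cp])
  also have "\<dots> = (LINT y|sphere_measure. of_real (P y) * ?K y + \<i> * (of_real (Q y) * ?K y))"
    by (intro Bochner_Integration.integral_cong) (auto simp: p_def algebra_simps)
  also have "\<dots> = (LINT y|sphere_measure. of_real (P y) * ?K y) + \<i> * (LINT y|sphere_measure. of_real (Q y) * ?K y)"
    using integrable_stiefel_kernel[OF ctxt cP] integrable_stiefel_kernel[OF ctxt cQ] by simp
  also have "\<dots> = of_real (P x / ?D) * I + \<i> * (of_real (Q x / ?D) * I)"
    unfolding integral_solid_harmonic_stiefel_R_kernel[OF \<mu> x A(1) int n d m kn j P]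
      integral_solid_harmonic_stiefel_R_kernel[OF \<mu> x A(1) int n d m kn j Q] I_def ..
  also have "\<dots> = p x / of_real ?D * I"
    by (simp add: p_def add_divide_distrib algebra_simps)
  finally have E: "(LINT v|\<mu>. A (?N v) * (LINT y|sphere_measure. p y * of_real (?r (norm (y v* v))))) = p x / of_real ?D * I" .
  have "has_bochner_integral \<mu> (\<lambda>v. A (?N v) * (LINT y|sphere_measure. p y * of_real (?r (norm (y v* v))))) (p x / of_real ?D * I)"
    using integrable_stiefel_transform[OF ctxt cp] E by (simp add: has_bochner_integral_iff)
  then have "has_bochner_integral \<mu> (\<lambda>v. of_real c * (A (?N v) * (LINT y|sphere_measure. p y * of_real (?r (norm (y v* v)))))) (of_real c * (p x / of_real ?D * I))"
    by (rule has_bochner_integral_mult_right)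
  moreover have "of_real c * (A (?N v) * (LINT y|sphere_measure. p y * of_real (?r (norm (y v* v))))) = A (?N v) * stiefel_harmonic n k j Y v" for v
    unfolding Yhat by (simp only: mult_ac)
  moreover have "of_real c * (p x / of_real ?D * I) = multiplier n k a j * Y x"
  proof -
    have D: "?D > 0" by (rule harmonic_dim_pos[OF n])
    have "c / ?D * B = varkappa n k j * sphere_area (n - k - 1) * sphere_area k / (sphere_area n * sqrt ?D)"
    proof -
      have *: "sqrt ?D / ?D = 1 / sqrt ?D" using D by (simp add: real_div_sqrt field_simps)
      have "c / ?D * B = varkappa n k j * (sqrt ?D / ?D) * B" by (simp add: c_def)
      also have "\<dots> = varkappa n k j * B / sqrt ?D" unfolding * by simp
      also have "\<dots> = varkappa n k j * (sphere_area (n - k - 1) * sphere_area k / sphere_area n) / sqrt ?D"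
        by (simp only: B_def sphere_area_quotient[OF kn])
      also have "\<dots> = varkappa n k j * sphere_area (n - k - 1) * sphere_area k / (sphere_area n * sqrt ?D)"
        by simp
      finally show ?thesis .
    qed
    then have "multiplier n k a j = of_real (c / ?D * B) * (LINT \<tau>:{0..1}|lebesgue. of_real (?r \<tau>) * a \<tau> * of_real (?w \<tau>))"
      by (simp only: multiplier_def)
    moreover have "Y x = p x" using PQ[OF assms(11)] by (simp add: p_def Complex_eq)
    ultimately show ?thesis unfolding I by simp
  qed
  ultimately have H: "has_bochner_integral \<mu> (\<lambda>v. A (?N v) * stiefel_harmonic n k j Y v) (multiplier n k a j * Y x)"
    by (simp only:)
  then have m\<mu>: "(\<lambda>v. A (?N v) * stiefel_harmonic n k j Y v) \<in> borel_measurable \<mu>"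
    by (rule borel_measurable_has_bochner_integral)
  have Hc: "has_bochner_integral (completion \<mu>) (\<lambda>v. A (?N v) * stiefel_harmonic n k j Y v) (multiplier n k a j * Y x)"
    using H by (simp add: has_bochner_integral_iff integrable_completion[OF m\<mu>] integral_completion[OF m\<mu>])
  \<comment> \<open>Return from \<open>A\<close> to \<open>a\<close>, which is only measurable for the completion.\<close>
  have "AE \<tau> in distr \<mu> borel ?N. a \<tau> = A \<tau>"
    unfolding law
    by (subst AE_density) (use A(2) in \<open>auto simp: radial_density_def elim!: eventually_mono split: split_indicator_asm\<close>)
  then have "AE v in \<mu>. a (?N v) = A (?N v)"
    by (rule AE_distrD[OF mN])
  then have ae: "AE v in completion \<mu>. A (?N v) * stiefel_harmonic n k j Y v = a (?N v) * stiefel_harmonic n k j Y v"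
    by (intro AE_completion) (auto elim: eventually_mono)
  have mc: "(\<lambda>v. A (?N v) * stiefel_harmonic n k j Y v) \<in> borel_measurable (completion \<mu>)"
    by (rule measurable_completion[OF m\<mu>])
  show ?thesis
    using Hc has_bochner_integral_cong_AE[OF mc borel_measurable_completion_AE[OF mc ae] ae] by simp
qed

end
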